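(* There is a Local Computation Algorithm (LCA) for the Maximal Independent Set problem that, on any $n$-node graph of maximum degree at most $\Delta$, with probability at least $1-1/n^{10}$ computes a Maximal Independent Set, and has query complexity $\Delta^{O(\log\log\Delta)}\cdot\mathrm{poly}(\log n)$.
   Context: In the LCA model, the algorithm has query access to the input graph $G=(V,E)$: a query to a node $v$ returns the identifiers of all neighbors of $v$ (equivalently, up to a factor $\Delta$ in the count, degree queries and "$i$-th neighbor of $v$" queries). The algorithm also has access to a shared string of random bits (of length $n\,\mathrm{poly}\log n$). When asked about a node $v\in V$, the LCA must answer whether $v$ is in the Maximal Independent Set, and the answers over all $v\in V$ must be consistent with one single Maximal Independent Set of $G$. The query complexity is the maximum number of queries to $G$ made to answer a single question about one node. *)

theory Defs
  imports
    "HOL-Probability.Probability"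
    "HOL-Library.Landau_Symbols"
    "HOL-Computational_Algebra.Polynomial"
    "Graph_Theory.Pair_Digraph"
begin

text \<open>
  Simple undirected graphs are the symmetric loop-free digraphs \<open>pair_graph\<close>; the degree of a node
  is then its out-degree. As usual for local computation algorithms, the identifiers of an
  \<open>n\<close>-node graph are \<open>0, \<dots>, n - 1\<close>; since all labelled graphs on this node set are considered, every
  assignment of these identifiers to an abstract graph is covered.
\<close>

definition bounded_degree_graph :: "nat \<Rightarrow> nat \<Rightarrow> nat pair_pre_digraph \<Rightarrow> bool" where
  "bounded_degree_graph n \<Delta> G \<longleftrightarrow>
     pair_graph G \<and> pverts G = {..<n} \<and> (\<forall>v\<in>pverts G. out_degree (with_proj G) v \<le> \<Delta>)"

definition neighbors :: "'a pair_pre_digraph \<Rightarrow> 'a \<Rightarrow> 'a set" where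
  "neighbors G v = {w. (v, w) \<in> parcs G}"

definition independent_set :: "'a pair_pre_digraph \<Rightarrow> 'a set \<Rightarrow> bool" where
  "independent_set G I \<longleftrightarrow> I \<subseteq> pverts G \<and> (\<forall>u\<in>I. \<forall>v\<in>I. (u, v) \<notin> parcs G)"

definition maximal_independent_set :: "'a pair_pre_digraph \<Rightarrow> 'a set \<Rightarrow> bool" where
  "maximal_independent_set G I \<longleftrightarrow>
     independent_set G I \<and> (\<forall>J. independent_set G J \<and> I \<subseteq> J \<longrightarrow> J = I)"

text \<open>
  The adaptive interaction of an algorithm with the graph: either it stops with a yes/no answer, or
  it queries a node and continues depending on the returned set of identifiers of neighbors.
  Being an inductive datatype, it excludes non-terminating interactions.
\<close>

datatype query_procedure = Answer bool | Query nat "nat set \<Rightarrow> query_procedure"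

primrec answer :: "(nat \<Rightarrow> nat set) \<Rightarrow> query_procedure \<Rightarrow> bool" where
  "answer oracle (Answer b) = b"
| "answer oracle (Query v k) = answer oracle (k (oracle v))"

primrec num_queries :: "(nat \<Rightarrow> nat set) \<Rightarrow> query_procedure \<Rightarrow> nat" where
  "num_queries oracle (Answer b) = 0"
| "num_queries oracle (Query v k) = Suc (num_queries oracle (k (oracle v)))"

text \<open>
  An algorithm is given \<open>n\<close>, \<open>\<Delta>\<close>, the shared random bits and the node \<open>v\<close> it is asked about; reading the
  random bits is free. It keeps no state between questions, so that for fixed random bits the answers
  for all nodes are determined, and define one set of nodes.
\<close>

type_synonym lca = "nat \<Rightarrow> nat \<Rightarrow> bool list \<Rightarrow> nat \<Rightarrow> query_procedure"

definition lca_output :: "lca \<Rightarrow> nat \<Rightarrow> nat \<Rightarrow> nat pair_pre_digraph \<Rightarrow> bool list \<Rightarrow> nat set" where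
  "lca_output A n \<Delta> G r = {v \<in> pverts G. answer (neighbors G) (A n \<Delta> r v)}"

definition random_bits :: "nat \<Rightarrow> bool list pmf" where
  "random_bits l = pmf_of_set {r. length r = l}"

end

theory Submission
  imports Defs "HOL-Real_Asymp.Real_Asymp"
begin

text \<open>
  The algorithm simulates \<open>O(log \<Delta>)\<close> rounds of a process in which every undecided node is marked with its
  own probability \<open>2 ^ - e\<close>. It joins the independent set if it is marked and no neighbour is; it halves
  the probability when it sees a marked neighbour and doubles it otherwise. A node with too large a
  neighbourhood stalls: it halves its probability blindly until the neighbourhood is cheap to inspect.
  To find the marked neighbours of a node in round \<open>t\<close>, one filters the neighbours by their states in the
  rounds \<open>j < t\<close>; at most \<open>16 * D * 8 ^ (t - j)\<close> survive until round \<open>j\<close>, where \<open>D = O(log \<Delta>)\<close>. The resulting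
  recursion for the number of queries has a solution of the form \<open>(log \<Delta>) ^ O(log \<Delta>)\<close>.

  Given the past, every round decreases a potential of an undecided node: either its light neighbours
  have enough weight to dominate the node with constant probability, or the expected weight of its
  neighbourhood shrinks, or its neighbourhood is silent and its own exponent drops. Hence a node stays
  undecided with probability at most \<open>\<Delta> ^ - c\<close>, independently for nodes at distance more than four. With
  high probability, the undecided nodes therefore form components of size \<open>poly(\<Delta>) * log n\<close>, and such a
  component can be explored completely.
\<close>

section \<open>Product distributions with finite support\<close>

text \<open>The obstacle: learning the states of all neighbours in every round would cost about
  \<Delta> ^ T queries for \<open>T\<close> rounds. Hence the rules use only sampled marks, and the
  cut-offs \<open>stalled\<close> and \<open>overflow\<close> belong to the process itself. The
  simulation is therefore exact, the query bound and the independence of the \<open>In\<close> nodes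
  hold for every outcome of the coins, and only the speed of the process is probabilistic. The price
  is that the rules see counts while the potential sees expectations; \<open>fail\<close> collects
  the discrepancies, and \<open>D\<close> proportional to log \<Delta> makes them polynomially rare
  in \<Delta>. After many rounds the fate of a node depends on coins far away, so distant nodes are
  not literally independent. Only a single round, given the past, is local. A product of one
  supermartingale per node is then again a supermartingale, and this replaces independence.\<close>

abbreviation Ev :: "'a pmf \<Rightarrow> ('a \<Rightarrow> real) \<Rightarrow> real" where
  "Ev \<equiv> measure_pmf.expectation"

text \<open>The distributions of the algorithm have finite support, so expectations become finite
  sums and no integrability has to be shown.\<close>

lemma Ev_finite:
  assumes "finite (set_pmf p)"
  shows "Ev p f = (\<Sum>x\<in>set_pmf p. pmf p x * f x)"
  by (subst integral_measure_pmf_real[OF assms]) (auto simp: mult.commute)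

lemma Ev_mono:
  assumes "finite (set_pmf p)" "\<And>x. x \<in> set_pmf p \<Longrightarrow> f x \<le> g x"
  shows "Ev p f \<le> Ev p g"
  using assms by (simp add: Ev_finite sum_mono mult_left_mono)

lemma Ev_cong:
  assumes "\<And>x. x \<in> set_pmf p \<Longrightarrow> f x = g x"
  shows "Ev p f = Ev p g"
  using assms by (intro integral_cong_AE) (auto simp: AE_measure_pmf_iff)

lemma Ev_add:
  assumes "finite (set_pmf p)"
  shows "Ev p (\<lambda>x. f x + g x) = Ev p f + Ev p g"
  using assms by (simp add: Ev_finite distrib_left sum.distrib)

lemma Ev_cmult: "Ev p (\<lambda>x. c * f x) = c * Ev p f"
  by simp

lemma Ev_sum:
  assumes "finite (set_pmf p)"
  shows "Ev p (\<lambda>x. \<Sum>a\<in>A. f a x) = (\<Sum>a\<in>A. Ev p (f a))"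
  using assms by (simp add: Ev_finite sum_distrib_left sum.swap[of _ A])

lemma Ev_const: "Ev p (\<lambda>_. c) = c"
  by simp

lemma Ev_nonneg:
  assumes "\<And>x. x \<in> set_pmf p \<Longrightarrow> 0 \<le> f x"
  shows "0 \<le> Ev p f"
  using assms by (intro integral_nonneg_AE) (auto simp: AE_measure_pmf_iff)

lemma prob_eq_Ev: "measure_pmf.prob p {x. P x} = Ev p (\<lambda>x. of_bool (P x))"
proof -
  have "(\<lambda>x. of_bool (P x)) = (indicator {x. P x} :: _ \<Rightarrow> real)"
    by (auto simp: indicator_def)
  then show ?thesis by simp
qed

lemma of_bool_disj_le: "of_bool (P \<or> Q) \<le> of_bool P + (of_bool Q :: real)"
  by simp

lemma Ev_union_bound:
  assumes "finite A"
  shows "Ev p (\<lambda>x. of_bool (\<exists>a\<in>A. P a x)) \<le> (\<Sum>a\<in>A. Ev p (\<lambda>x. of_bool (P a x)))"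
proof -
  have "{x. \<exists>a\<in>A. P a x} = (\<Union>a\<in>A. {x. P a x})" by auto
  then show ?thesis
    unfolding prob_eq_Ev[symmetric] using measure_UNION_le[OF assms, of "\<lambda>a. {x. P a x}" "measure_pmf p"] by simp
qed

lemma Ev_pair:
  assumes "finite (set_pmf p)" "finite (set_pmf q)"
  shows "Ev (pair_pmf p q) f = Ev p (\<lambda>x. Ev q (\<lambda>y. f (x, y)))"
  using assms
  by (subst Ev_finite) (auto simp: Ev_finite pmf_pair sum.cartesian_product sum_distrib_left
      mult_ac case_prod_unfold intro!: sum.cong)

lemma Ev_map: "Ev (map_pmf g p) f = Ev p (\<lambda>x. f (g x))"
  by simp

lemma finite_set_Pi_pmf:
  assumes "finite A" "\<And>x. x \<in> A \<Longrightarrow> finite (set_pmf (p x))"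
  shows "finite (set_pmf (Pi_pmf A d p))"
  using assms by (subst set_Pi_pmf) auto

lemma Ev_Pi_split:
  assumes "finite A" "B \<subseteq> A" "\<And>x. x \<in> A \<Longrightarrow> finite (set_pmf (p x))"
  shows "Ev (Pi_pmf A d p) f =
    Ev (Pi_pmf B d p) (\<lambda>x. Ev (Pi_pmf (A - B) d p) (\<lambda>y. f (\<lambda>i. if i \<in> B then x i else y i)))"
proof -
  have fin: "finite B" "finite (A - B)" using assms finite_subset by auto
  have "Pi_pmf A d p = Pi_pmf (B \<union> (A - B)) d p" using assms by (simp add: Un_absorb1)
  also have "\<dots> = map_pmf (\<lambda>(f,g) x. if x \<in> B then f x else g x)
             (pair_pmf (Pi_pmf B d p) (Pi_pmf (A - B) d p))"
    by (rule Pi_pmf_union) (use fin in auto)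
  finally have eq: "Pi_pmf A d p = \<dots>" .
  have fs: "finite (set_pmf (Pi_pmf B d p))" "finite (set_pmf (Pi_pmf (A - B) d p))"
    using assms fin by (auto intro!: finite_set_Pi_pmf)
  show ?thesis
    unfolding eq Ev_map Ev_pair[OF fs] by simp
qed

text \<open>Averaging over fresh coordinates in \<open>B\<close> is conditional expectation given
  the others. With a single round as \<open>B\<close>, the past stays fixed while the coins of that
  round are redrawn.\<close>

lemma Ev_Pi_resample:
  assumes "finite A" "B \<subseteq> A" "\<And>x. x \<in> A \<Longrightarrow> finite (set_pmf (p x))"
  shows "Ev (Pi_pmf A d p) f =
    Ev (Pi_pmf A d p) (\<lambda>w. Ev (Pi_pmf B d p) (\<lambda>x. f (\<lambda>i. if i \<in> B then x i else w i)))"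
proof -
  have fin: "finite B" "finite (A - B)" using assms finite_subset by auto
  have fs: "finite (set_pmf (Pi_pmf B d p))" "finite (set_pmf (Pi_pmf (A - B) d p))"
    using assms fin by (auto intro!: finite_set_Pi_pmf)
  have *: "(\<lambda>i. if i \<in> B then x i else if i \<in> B then z i else y i) = (\<lambda>i. if i \<in> B then x i else y i)" for x y z :: "'a \<Rightarrow> 'b"
    by auto
  have "Ev (Pi_pmf A d p) (\<lambda>w. Ev (Pi_pmf B d p) (\<lambda>x. f (\<lambda>i. if i \<in> B then x i else w i)))
    = Ev (Pi_pmf (A - B) d p) (\<lambda>y. Ev (Pi_pmf B d p) (\<lambda>x. f (\<lambda>i. if i \<in> B then x i else y i)))"
    by (subst Ev_Pi_split[OF assms]) (simp_all add: *)
  also have "\<dots> = Ev (Pi_pmf B d p) (\<lambda>x. Ev (Pi_pmf (A - B) d p) (\<lambda>y. f (\<lambda>i. if i \<in> B then x i else y i)))"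
    using fs by (simp add: Ev_finite sum_distrib_left mult_ac sum.swap[of _ "set_pmf (Pi_pmf B d p)"])
  also have "\<dots> = Ev (Pi_pmf A d p) f"
    by (rule Ev_Pi_split[OF assms, symmetric])
  finally show ?thesis ..
qed

text \<open>Stands in for measurability with respect to the coordinates in \<open>B\<close>.\<close>

definition depends_on :: "'a set \<Rightarrow> (('a \<Rightarrow> 'b) \<Rightarrow> 'c) \<Rightarrow> bool" where
  "depends_on B f \<longleftrightarrow> (\<forall>x y. (\<forall>i\<in>B. x i = y i) \<longrightarrow> f x = f y)"

lemma depends_onD: "depends_on B f \<Longrightarrow> (\<And>i. i \<in> B \<Longrightarrow> x i = y i) \<Longrightarrow> f x = f y"
  by (auto simp: depends_on_def)

lemma Ev_indep:
  assumes "finite A" "\<And>x. x \<in> A \<Longrightarrow> finite (set_pmf (p x))"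
    and "depends_on B f" "depends_on C g" "B \<inter> C = {}"
  shows "Ev (Pi_pmf A d p) (\<lambda>x. f x * g x) = Ev (Pi_pmf A d p) f * Ev (Pi_pmf A d p) g"
proof -
  let ?B = "A \<inter> B"
  have sub: "?B \<subseteq> A" by auto
  note out = set_Pi_pmf_subset[THEN subsetD]
  have fin: "finite ?B" "finite (A - ?B)" using assms by auto
  \<comment> \<open>Indices of \<open>B\<close> outside \<open>A\<close> are harmless: there both
    samples take the default \<open>d\<close>.\<close>
  have f1: "f (\<lambda>i. if i \<in> ?B then x i else y i) = f x"
    if "x \<in> set_pmf (Pi_pmf ?B d p)" "y \<in> set_pmf (Pi_pmf (A - ?B) d p)" for x y
    by (rule depends_onD[OF assms(3)]) (use out[OF fin(1) that(1)] out[OF fin(2) that(2)] in auto)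
  have g1: "g (\<lambda>i. if i \<in> ?B then x i else y i) = g y"
    if "x \<in> set_pmf (Pi_pmf ?B d p)" "y \<in> set_pmf (Pi_pmf (A - ?B) d p)" for x y
    by (rule depends_onD[OF assms(4)]) (use assms(5) in auto)
  have "Ev (Pi_pmf A d p) (\<lambda>x. f x * g x) =
    Ev (Pi_pmf ?B d p) (\<lambda>x. Ev (Pi_pmf (A - ?B) d p) (\<lambda>y. f x * g y))"
    by (subst Ev_Pi_split[OF assms(1) sub assms(2)], assumption)
       (intro Ev_cong, simp only: f1 g1)
  also have "\<dots> = Ev (Pi_pmf ?B d p) f * Ev (Pi_pmf (A - ?B) d p) g" by simp
  also have "Ev (Pi_pmf ?B d p) f = Ev (Pi_pmf A d p) f"
    by (subst Ev_Pi_split[OF assms(1) sub assms(2)], assumption)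
       (intro Ev_cong, subst Ev_cong[where g = "\<lambda>_. f x" for x], (simp only: f1)+, simp)
  also have "Ev (Pi_pmf (A - ?B) d p) g = Ev (Pi_pmf A d p) g"
    by (subst Ev_Pi_split[OF assms(1) sub assms(2)], assumption)
       (subst Ev_cong[where g = "\<lambda>_. Ev (Pi_pmf (A - ?B) d p) g"],
        intro Ev_cong, (simp only: g1)+, simp)
  finally show ?thesis .
qed

lemma depends_on_prod:
  assumes "\<And>v. v \<in> S \<Longrightarrow> depends_on (B v) (f v)"
  shows "depends_on (\<Union>v\<in>S. B v) (\<lambda>x. \<Prod>v\<in>S. f v x)"
  unfolding depends_on_def
  by (intro allI impI prod.cong refl) (use assms in \<open>force simp: depends_on_def\<close>)

lemma Ev_indep_prod:
  assumes "finite A" "\<And>x. x \<in> A \<Longrightarrow> finite (set_pmf (p x))" "finite S"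
    and "\<And>v. v \<in> S \<Longrightarrow> depends_on (B v) (f v)"
    and "\<And>u v. u \<in> S \<Longrightarrow> v \<in> S \<Longrightarrow> u \<noteq> v \<Longrightarrow> B u \<inter> B v = {}"
  shows "Ev (Pi_pmf A d p) (\<lambda>x. \<Prod>v\<in>S. f v x) = (\<Prod>v\<in>S. Ev (Pi_pmf A d p) (f v))"
  using assms(3-5)
proof (induction S rule: finite_induct)
  case (insert v S)
  have "Ev (Pi_pmf A d p) (\<lambda>x. f v x * (\<Prod>v\<in>S. f v x)) =
    Ev (Pi_pmf A d p) (f v) * Ev (Pi_pmf A d p) (\<lambda>x. \<Prod>v\<in>S. f v x)"
    by (rule Ev_indep[OF assms(1,2) _ depends_on_prod[where S = S and B = B], where B = "B v"])
       (use insert in \<open>blast+\<close>)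
  then show ?case using insert by simp
qed simp

section \<open>Geometric coins from uniform bits\<close>

definition run_length :: "bool list \<Rightarrow> nat" where
  "run_length r = length (takeWhile id r)"

text \<open>A geometric variable truncated at \<open>m\<close>. Its tail is exactly
  \<open>2 ^ - e\<close> as long as \<open>e \<le> m\<close>, so \<open>m\<close> has to bound the
  exponents that occur.\<close>

definition geo :: "nat \<Rightarrow> nat pmf" where
  "geo m = map_pmf run_length (random_bits m)"

lemma finite_lists: "finite {r :: bool list. length r = l}"
  using finite_lists_length_eq[of "UNIV :: bool set" l] by simp

lemma lists_nonempty: "{r :: bool list. length r = l} \<noteq> {}"
  using Ex_list_of_length[of l] by auto

lemma card_lists: "card {r :: bool list. length r = l} = 2 ^ l"
  using card_lists_length_eq[of "UNIV :: bool set" l] by simp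

lemma set_random_bits: "set_pmf (random_bits l) = {r. length r = l}"
  unfolding random_bits_def by (rule set_pmf_of_set[OF lists_nonempty finite_lists])

lemma finite_random_bits [simp]: "finite (set_pmf (random_bits l))"
  by (simp add: set_random_bits finite_lists)

lemma finite_geo [simp]: "finite (set_pmf (geo m))"
  by (simp add: geo_def)

lemma random_bits_add:
  "random_bits (a + b) = map_pmf (\<lambda>(x, y). x @ y) (pair_pmf (random_bits a) (random_bits b))"
proof -
  have bij: "bij_betw (\<lambda>(x, y). x @ y) ({r :: bool list. length r = a} \<times> {r. length r = b}) {r. length r = a + b}"
    by (rule bij_betw_byWitness[where f' = "\<lambda>r. (take a r, drop a r)"]) auto
  have "pair_pmf (random_bits a) (random_bits b) = pmf_of_set ({r. length r = a} \<times> {r. length r = b})"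
    unfolding random_bits_def using finite_lists lists_nonempty by (intro pmf_eqI)
      (auto simp: pmf_pair indicator_def card_cartesian_product split: prod.splits)
  then show ?thesis
    using map_pmf_of_set_bij_betw[OF bij] finite_lists lists_nonempty by (simp add: random_bits_def)
qed

lemma run_length_ge: "e \<le> run_length r \<longleftrightarrow> take e r = replicate e True"
proof (induction r arbitrary: e)
  case (Cons b r)
  then show ?case by (cases e; cases b) (auto simp: run_length_def)
qed (auto simp: run_length_def)

lemma Ev_geo_ge:
  assumes "e \<le> m"
  shows "Ev (geo m) (\<lambda>g. of_bool (e \<le> g)) = 1 / 2 ^ e"
proof -
  obtain b where m: "m = e + b" using assms le_Suc_ex by blast
  have "Ev (geo m) (\<lambda>g. of_bool (e \<le> g)) = Ev (random_bits e) (\<lambda>x. Ev (random_bits b) (\<lambda>y. of_bool (e \<le> run_length (x @ y))))"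
    by (simp add: geo_def m random_bits_add Ev_pair)
  also have "\<dots> = Ev (random_bits e) (\<lambda>x. Ev (random_bits b) (\<lambda>y. of_bool (x = replicate e True)))"
    by (intro Ev_cong) (auto simp: set_random_bits run_length_ge)
  also have "\<dots> = pmf (random_bits e) (replicate e True)"
    by (simp add: measure_pmf_single flip: prob_eq_Ev)
  also have "\<dots> = 1 / 2 ^ e"
    unfolding random_bits_def using finite_lists lists_nonempty by (simp add: card_lists)
  finally show ?thesis .
qed

text \<open>Consecutive blocks of \<open>m\<close> bits are independent. This is applied twice: to
  the nodes of a round, then to the rounds.\<close>

lemma Pi_random_bits:
  "Pi_pmf {..<N} d (\<lambda>_. map_pmf f (random_bits m)) =
    map_pmf (\<lambda>r i. if i < N then f (take m (drop (i * m) r)) else d) (random_bits (N * m))"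
proof (induction N)
  case 0
  show ?case by (simp add: map_pmf_const)
next
  case (Suc N)
  have "Pi_pmf {..<Suc N} d (\<lambda>_. map_pmf f (random_bits m)) =
    map_pmf (\<lambda>(y, g). g(N := y)) (pair_pmf (map_pmf f (random_bits m)) (Pi_pmf {..<N} d (\<lambda>_. map_pmf f (random_bits m))))"
    by (simp add: lessThan_Suc Pi_pmf_insert)
  also have "\<dots> = map_pmf (\<lambda>(x, y). (\<lambda>i. if i < N then f (take m (drop (i * m) x)) else d)(N := f y))
     (pair_pmf (random_bits (N * m)) (random_bits m))"
    by (subst pair_commute_pmf)
       (simp only: Suc, simp add: map_pair[symmetric] pmf.map_comp o_def case_prod_unfold)
  also have "\<dots> = map_pmf (\<lambda>(x, y). \<lambda>i. if i < Suc N then f (take m (drop (i * m) (x @ y))) else d)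
     (pair_pmf (random_bits (N * m)) (random_bits m))"
  proof (rule map_pmf_cong[OF refl], clarsimp simp: set_random_bits fun_eq_iff, goal_cases)
    case (1 x y i)
    have "i * m + m \<le> N * m" if "i < N"
      using that by (metis Suc_leI add.commute mult_Suc mult_le_mono1)
    then show ?case using 1 by (auto simp: less_Suc_eq)
  qed
  also have "\<dots> = map_pmf (\<lambda>r i. if i < Suc N then f (take m (drop (i * m) r)) else d) (random_bits (Suc N * m))"
    by (simp add: random_bits_add[of "N * m" m] add.commute[of m] pmf.map_comp o_def case_prod_unfold)
  finally show ?case .
qed

section \<open>The randomized process\<close>

text \<open>
  In a round, a node in state \<open>Alive e\<close> is marked with probability \<open>2 ^ - e\<close>. \<open>Out\<close> means that the node
  has noticed a neighbour in \<open>In\<close>; a dominated node may stay \<open>Alive\<close> for a while.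
\<close>

datatype node_state = Alive nat | In | Out
datatype action = Up | Kill | Free

text \<open>The floor 1 on the exponent keeps every marking probability at most 1/2, so the chance
  that no node of a finite set is marked never vanishes.\<close>

fun next_state :: "action \<Rightarrow> nat \<Rightarrow> node_state \<Rightarrow> node_state" where
  "next_state Up x (Alive e) = Alive (Suc e)"
| "next_state Kill x (Alive e) = Out"
| "next_state Free x (Alive e) = (if e \<le> x then In else Alive (max 1 (e - 1)))"
| "next_state a x In = In"
| "next_state a x Out = Out"

type_synonym history = "nat \<Rightarrow> nat \<Rightarrow> node_state"
type_synonym coins = "nat \<Rightarrow> nat \<Rightarrow> nat"

text \<open>
  The coin \<open>w i u\<close> has a geometric distribution, so that \<open>e \<le> w i u\<close> has probability \<open>2 ^ - e\<close>. An exponent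
  drops by at most one per round: the candidates \<open>cand_of H nb w j i v\<close> are the neighbours of \<open>v\<close> that,
  judging by their states in round \<open>j\<close>, may still be marked in round \<open>i\<close>. They are found by filtering
  the candidates for round \<open>j - 1\<close>, which keeps the number of recursive calls small.
\<close>

definition cand_of :: "history \<Rightarrow> (nat \<Rightarrow> nat set) \<Rightarrow> coins \<Rightarrow> nat \<Rightarrow> nat \<Rightarrow> nat \<Rightarrow> nat set" where
  "cand_of H nb w j i v = {u \<in> nb v. \<exists>e. H j u = Alive e \<and> e \<le> w i u + (i - j)}"

text \<open>
  A stalled node halves its marking probability without looking at its neighbours, not even to see
  whether it is dominated. The tolerance grows with the age \<open>t - j\<close> of the observation, so a node
  with large neighbourhood resumes after a number of rounds logarithmic in its size.
\<close>

definition stalled_of :: "nat \<Rightarrow> history \<Rightarrow> (nat \<Rightarrow> nat set) \<Rightarrow> coins \<Rightarrow> nat \<Rightarrow> nat \<Rightarrow> bool" where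
  "stalled_of D H nb w t v \<longleftrightarrow>
     (\<exists>i<t. \<exists>j\<le>i. D * 2 ^ (i - j) * 4 ^ (t - Suc j) < card (cand_of H nb w j i v))"

definition dominated_of :: "history \<Rightarrow> (nat \<Rightarrow> nat set) \<Rightarrow> nat \<Rightarrow> nat \<Rightarrow> bool" where
  "dominated_of H nb t v \<longleftrightarrow> (\<exists>u\<in>nb v. H t u = In)"

text \<open>This caps the search for marked neighbours. Its threshold is consistent with stalling
  (\<open>limit_stalled\<close>), and without failures it is never exceeded at a node that is not
  stalled (\<open>no_overflow\<close>).\<close>

definition overflow_of :: "nat \<Rightarrow> history \<Rightarrow> (nat \<Rightarrow> nat set) \<Rightarrow> coins \<Rightarrow> nat \<Rightarrow> nat \<Rightarrow> bool" where
  "overflow_of D H nb w t v \<longleftrightarrow> (\<exists>j\<le>t. 16 * D * 8 ^ (t - j) < card (cand_of H nb w j t v))"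

definition action_of :: "nat \<Rightarrow> history \<Rightarrow> (nat \<Rightarrow> nat set) \<Rightarrow> coins \<Rightarrow> nat \<Rightarrow> nat \<Rightarrow> action" where
  "action_of D H nb w t v =
     (if stalled_of D H nb w t v then Up
      else if dominated_of H nb t v then Kill
      else if overflow_of D H nb w t v \<or> cand_of H nb w t t v \<noteq> {} then Up else Free)"

text \<open>The whole history is carried along because stalling looks back at all earlier rounds;
  \<open>st\<close> is its diagonal.\<close>

primrec history_upto :: "nat \<Rightarrow> nat \<Rightarrow> (nat \<Rightarrow> nat set) \<Rightarrow> coins \<Rightarrow> nat \<Rightarrow> history" where
  "history_upto D e0 nb w 0 = (\<lambda>_ _. Alive e0)"
| "history_upto D e0 nb w (Suc t) = (history_upto D e0 nb w t)(Suc t :=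
     (\<lambda>v. next_state (action_of D (history_upto D e0 nb w t) nb w t v) (w t v) (history_upto D e0 nb w t t v)))"

locale mis_process =
  fixes D e0 :: nat
begin

definition st :: "(nat \<Rightarrow> nat set) \<Rightarrow> coins \<Rightarrow> nat \<Rightarrow> nat \<Rightarrow> node_state" where
  "st nb w t = history_upto D e0 nb w t t"

abbreviation "cand nb w \<equiv> cand_of (st nb w) nb w"
abbreviation "stalled nb w \<equiv> stalled_of D (st nb w) nb w"
abbreviation "dominated nb w \<equiv> dominated_of (st nb w) nb"
abbreviation "overflow nb w \<equiv> overflow_of D (st nb w) nb w"
abbreviation "act nb w \<equiv> action_of D (st nb w) nb w"

lemma history_upto_eq: "j \<le> t \<Longrightarrow> history_upto D e0 nb w t j = st nb w j"
  by (induction t) (auto simp: st_def le_Suc_eq)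

lemma cand_of_cong: "H j = H' j \<Longrightarrow> cand_of H nb w j i v = cand_of H' nb w j i v"
  by (simp add: cand_of_def)

lemma action_of_cong:
  assumes "\<And>j. j \<le> t \<Longrightarrow> H j = H' j"
  shows "action_of D H nb w t v = action_of D H' nb w t v"
proof -
  have c: "cand_of H nb w j i v = cand_of H' nb w j i v" if "j \<le> t" for j i
    using assms[OF that] by (rule cand_of_cong)
  have "stalled_of D H nb w t v = stalled_of D H' nb w t v"
    unfolding stalled_of_def by (intro iff_exI conj_cong refl) (simp add: c)
  moreover have "overflow_of D H nb w t v = overflow_of D H' nb w t v"
    unfolding overflow_of_def by (intro iff_exI conj_cong refl) (simp add: c)
  moreover have "dominated_of H nb t v = dominated_of H' nb t v"
    unfolding dominated_of_def using assms by simp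
  ultimately show ?thesis using c[of t] by (simp add: action_of_def)
qed

lemma st_0 [simp]: "st nb w 0 v = Alive e0"
  by (simp add: st_def)

lemma st_Suc: "st nb w (Suc t) v = next_state (act nb w t v) (w t v) (st nb w t v)"
proof -
  have "action_of D (history_upto D e0 nb w t) nb w t v = act nb w t v"
    by (rule action_of_cong) (simp add: history_upto_eq)
  then show ?thesis by (simp add: st_def)
qed

text \<open>The process is adapted: states at time \<open>t\<close> are settled before the coins of
  round \<open>t\<close> are read. This is what makes redrawing a single round useful.\<close>

lemma st_coins_cong:
  assumes "\<And>i. i < t \<Longrightarrow> w i = w' i"
  shows "st nb w t = st nb w' t"
  using assms
proof (induction t rule: less_induct)
  case (less t)
  show ?case
  proof (cases t)
    case 0
    then show ?thesis by (simp add: fun_eq_iff)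
  next
    case (Suc s)
    have H: "st nb w j = st nb w' j" if "j \<le> s" for j
      using less Suc that by auto
    have w: "w i = w' i" if "i \<le> s" for i
      using less Suc that by auto
    have c: "cand_of H nb w j i v = cand_of H nb w' j i v" if "i \<le> s" for H j i v
      using w[OF that] by (simp add: cand_of_def)
    have "stalled_of D H nb w s v = stalled_of D H nb w' s v" for H v
      unfolding stalled_of_def by (intro iff_exI conj_cong refl) (simp add: c)
    moreover have "overflow_of D H nb w s v = overflow_of D H nb w' s v" for H v
      unfolding overflow_of_def by (intro iff_exI conj_cong refl) (simp add: c)
    ultimately have "action_of D H nb w s v = action_of D H nb w' s v" for H v
      using c[of s] by (simp add: action_of_def)
    then have "act nb w s v = act nb w' s v" for v
      using action_of_cong[of s "st nb w" "st nb w'" nb w v] H by simp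
    then show ?thesis
      using H[of s] w[of s] Suc by (simp add: fun_eq_iff st_Suc)
  qed
qed

lemma next_state_Alive_le: "next_state a x (Alive e) = Alive e' \<Longrightarrow> e \<le> Suc e' \<and> e' \<le> Suc e"
  by (cases a) (auto split: if_splits)

text \<open>An exponent drops by at most one per round, which is exactly what the tolerance
  \<open>i - j\<close> loses.\<close>

lemma cand_Suc_subset:
  assumes "j < i"
  shows "cand nb w (Suc j) i v \<subseteq> cand nb w j i v"
proof
  fix u assume "u \<in> cand nb w (Suc j) i v"
  then obtain e' where e': "u \<in> nb v" "st nb w (Suc j) u = Alive e'" "e' \<le> w i u + (i - Suc j)"
    by (auto simp: cand_of_def)
  then obtain e where "st nb w j u = Alive e"
    by (metis st_Suc next_state.simps(4,5) node_state.exhaust)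
  with e' assms next_state_Alive_le[of "act nb w j u" "w j u" e e'] show "u \<in> cand nb w j i v"
    by (auto simp: cand_of_def st_Suc)
qed

lemma st_In_mono: "st nb w s v = In \<Longrightarrow> s \<le> t \<Longrightarrow> st nb w t v = In"
  by (induction t) (auto simp: le_Suc_eq st_Suc)

lemma dominated_mono: "dominated nb w s v \<Longrightarrow> s \<le> t \<Longrightarrow> dominated nb w t v"
  unfolding dominated_of_def using st_In_mono by metis

lemma st_Out_dominated: "st nb w t v = Out \<Longrightarrow> dominated nb w t v"
proof (induction t)
  case (Suc t)
  show ?case
  proof (cases "st nb w t v")
    case (Alive e)
    with Suc.prems have "act nb w t v = Kill"
      by (cases "act nb w t v") (auto simp: st_Suc split: if_splits)
    then have "dominated nb w t v" by (auto simp: action_of_def split: if_splits)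
    then show ?thesis by (rule dominated_mono) simp
  next
    case Out
    then show ?thesis by (rule dominated_mono[OF Suc.IH]) simp
  qed (use Suc.prems in \<open>simp add: st_Suc\<close>)
qed simp

lemma st_In_Suc_iff:
  "st nb w (Suc t) v = In \<longleftrightarrow>
     st nb w t v = In \<or> (\<exists>e. st nb w t v = Alive e \<and> act nb w t v = Free \<and> e \<le> w t v)"
  by (cases "st nb w t v"; cases "act nb w t v") (auto simp: st_Suc)

lemma act_Free:
  "act nb w t v = Free \<longleftrightarrow> \<not> stalled nb w t v \<and> \<not> dominated nb w t v \<and> \<not> overflow nb w t v \<and> cand nb w t t v = {}"
  by (auto simp: action_of_def)

text \<open>Look at the round in which the later of two adjacent nodes joins: an earlier member
  would dominate the other node, and two simultaneous joiners would each see the other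
  marked.\<close>

lemma In_independent:
  assumes sym: "\<And>u v. u \<in> nb v \<Longrightarrow> v \<in> nb u"
  shows "st nb w t v = In \<Longrightarrow> st nb w t u = In \<Longrightarrow> u \<notin> nb v"
proof (induction t arbitrary: u v)
  case (Suc t)
  show ?case
  proof
    assume u: "u \<in> nb v"
    consider "st nb w t v = In" "st nb w t u = In"
      | "st nb w t v \<noteq> In" "st nb w t u = In" | "st nb w t v = In" "st nb w t u \<noteq> In"
      | "st nb w t v \<noteq> In" "st nb w t u \<noteq> In" by blast
    then show False
    proof cases
      case 1 then show ?thesis using Suc.IH u by auto
    next
      case 2 then show ?thesis using Suc.prems u by (auto simp: st_In_Suc_iff act_Free dominated_of_def)
    next
      case 3 then show ?thesis using Suc.prems u sym[OF u] by (auto simp: st_In_Suc_iff act_Free dominated_of_def)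
    next
      case 4 then show ?thesis using Suc.prems u by (auto simp: st_In_Suc_iff act_Free cand_of_def)
    qed
  qed
qed simp

lemma st_Alive_ge1:
  assumes "1 \<le> e0"
  shows "st nb w t v = Alive e \<Longrightarrow> 1 \<le> e"
proof (induction t arbitrary: e)
  case (Suc t)
  then show ?case
    by (cases "st nb w t v"; cases "act nb w t v") (auto simp: st_Suc split: if_splits)
qed (use assms in simp)

lemma st_Alive_le: "st nb w t v = Alive e \<Longrightarrow> e \<le> e0 + t + 1"
proof (induction t arbitrary: e)
  case (Suc t)
  then show ?case
    by (cases "st nb w t v"; cases "act nb w t v") (auto simp: st_Suc split: if_splits dest!: Suc.IH)
qed simp

end

section \<open>Query complexity of the process\<close>

text \<open>Arbitrary result types allow procedures to be composed; \<open>to_procedure\<close>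
  returns to the given datatype at the end.\<close>

datatype 'a query_tree = Leaf 'a | Node nat "nat set \<Rightarrow> 'a query_tree"

primrec run :: "(nat \<Rightarrow> nat set) \<Rightarrow> 'a query_tree \<Rightarrow> 'a" where
  "run nb (Leaf x) = x"
| "run nb (Node v k) = run nb (k (nb v))"

primrec cost :: "(nat \<Rightarrow> nat set) \<Rightarrow> 'a query_tree \<Rightarrow> nat" where
  "cost nb (Leaf x) = 0"
| "cost nb (Node v k) = Suc (cost nb (k (nb v)))"

primrec bind_tree :: "'a query_tree \<Rightarrow> ('a \<Rightarrow> 'b query_tree) \<Rightarrow> 'b query_tree" where
  "bind_tree (Leaf x) f = f x"
| "bind_tree (Node v k) f = Node v (\<lambda>S. bind_tree (k S) f)"

lemma run_bind: "run nb (bind_tree t f) = run nb (f (run nb t))"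
  by (induction t) auto

lemma cost_bind: "cost nb (bind_tree t f) = cost nb t + cost nb (f (run nb t))"
  by (induction t) auto

primrec to_procedure :: "bool query_tree \<Rightarrow> query_procedure" where
  "to_procedure (Leaf b) = Answer b"
| "to_procedure (Node v k) = Query v (\<lambda>S. to_procedure (k S))"

lemma answer_to_procedure: "answer nb (to_procedure t) = run nb t"
  by (induction t) auto

lemma num_queries_to_procedure: "num_queries nb (to_procedure t) = cost nb t"
  by (induction t) auto

locale oracle_class =
  fixes \<O> :: "(nat \<Rightarrow> nat set) set"
begin

text \<open>
  Restricting the trees to a class \<open>\<O>\<close> of oracles makes it possible to bound the number of queries by a
  constant although degrees are bounded only for the input graphs.
\<close>

definition queries_le :: "((nat \<Rightarrow> nat set) \<Rightarrow> 'a) \<Rightarrow> real \<Rightarrow> bool" where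
  "queries_le F c \<longleftrightarrow> (\<exists>t. \<forall>nb\<in>\<O>. run nb t = F nb \<and> real (cost nb t) \<le> c)"

lemma queries_le_const: "0 \<le> c \<Longrightarrow> queries_le (\<lambda>_. x) c"
  unfolding queries_le_def by (rule exI[of _ "Leaf x"]) auto

lemma queries_le_query: "1 \<le> c \<Longrightarrow> queries_le (\<lambda>nb. nb v) c"
  unfolding queries_le_def by (rule exI[of _ "Node v Leaf"]) auto

lemma queries_le_mono: "queries_le F c \<Longrightarrow> c \<le> d \<Longrightarrow> queries_le F d"
  unfolding queries_le_def by (meson order_trans)

text \<open>The second stage is bounded only for values \<open>x\<close> that the first stage can
  return, so size bounds known for such values may enter \<open>b\<close>.\<close>

lemma queries_le_bind:
  assumes F: "queries_le F a"
    and G: "\<And>nb x. nb \<in> \<O> \<Longrightarrow> x = F nb \<Longrightarrow> queries_le (G x) b"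
    and H: "\<And>nb. nb \<in> \<O> \<Longrightarrow> H nb = G (F nb) nb"
    and c: "a + b \<le> c"
  shows "queries_le H c"
proof -
  obtain t where t: "\<And>nb. nb \<in> \<O> \<Longrightarrow> run nb t = F nb \<and> real (cost nb t) \<le> a"
    using F by (auto simp: queries_le_def)
  have "\<exists>f. \<forall>x\<in>F ` \<O>. \<forall>nb\<in>\<O>. run nb (f x) = G x nb \<and> real (cost nb (f x)) \<le> b"
    by (rule bchoice) (use G in \<open>auto simp: queries_le_def\<close>)
  then obtain f where f: "\<And>x nb. x \<in> F ` \<O> \<Longrightarrow> nb \<in> \<O> \<Longrightarrow> run nb (f x) = G x nb \<and> real (cost nb (f x)) \<le> b"
    by blast
  show ?thesis
    unfolding queries_le_def
  proof (intro exI[of _ "bind_tree t f"] ballI conjI)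
    fix nb assume nb: "nb \<in> \<O>"
    show "run nb (bind_tree t f) = H nb"
      using t[OF nb] f[of "F nb" nb] nb H[OF nb] by (simp add: run_bind)
    show "real (cost nb (bind_tree t f)) \<le> c"
      using t[OF nb] f[of "F nb" nb] nb c by (simp add: cost_bind)
  qed
qed

lemma queries_le_map:
  assumes "queries_le F c" "\<And>nb. nb \<in> \<O> \<Longrightarrow> H nb = g (F nb)"
  shows "queries_le H c"
  by (rule queries_le_bind[OF assms(1), of "\<lambda>x _. g x" 0])
     (use assms(2) in \<open>auto intro: queries_le_const\<close>)

text \<open>The results are tabulated with \<open>None\<close> outside \<open>A\<close>; the table
  is then determined by the answers on \<open>A\<close> and can be evaluated by a pure
  function.\<close>

lemma queries_le_fun:
  assumes "finite A" "\<And>u. u \<in> A \<Longrightarrow> queries_le (F u) (c u)"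
  shows "queries_le (\<lambda>nb. \<lambda>u. if u \<in> A then Some (F u nb) else None) (\<Sum>u\<in>A. c u)"
  using assms
proof (induction A rule: finite_induct)
  case empty
  show ?case by (rule queries_le_map[OF queries_le_const]) auto
next
  case (insert a A)
  have a: "queries_le (F a) (c a)" using insert by auto
  have IH: "queries_le (\<lambda>nb. \<lambda>u. if u \<in> A then Some (F u nb) else None) (\<Sum>u\<in>A. c u)"
    using insert by auto
  show ?case
  proof (rule queries_le_bind[OF a])
    show "queries_le (\<lambda>nb. (\<lambda>u. if u \<in> A then Some (F u nb) else None)(a := Some x)) (\<Sum>u\<in>A. c u)" for x
      by (rule queries_le_map[OF IH]) auto
  qed (use insert in auto)
qed

lemma queries_le_fun_const:
  assumes "finite A" "card A \<le> N" "\<And>u. u \<in> A \<Longrightarrow> queries_le (F u) c" "0 \<le> c"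
  shows "queries_le (\<lambda>nb u. if u \<in> A then Some (F u nb) else None) (real N * c)"
proof (rule queries_le_mono[OF queries_le_fun[OF assms(1,3)]])
  show "(\<Sum>u\<in>A. c) \<le> real N * c" using assms(2,4) by (simp add: mult_right_mono)
qed

end

context mis_process
begin

text \<open>Recording the exponent with each candidate spares a recomputation of its state: the next
  filtering step asks only for its action in round \<open>j\<close>.\<close>

definition cand_states :: "coins \<Rightarrow> nat \<Rightarrow> nat \<Rightarrow> nat \<Rightarrow> (nat \<Rightarrow> nat set) \<Rightarrow> (nat \<times> nat) set" where
  "cand_states w j i v nb = {(u, e). u \<in> nb v \<and> st nb w j u = Alive e \<and> e \<le> w i u + (i - j)}"

lemma inj_cand_states: "inj_on fst (cand_states w j i v nb)"
  by (auto simp: inj_on_def cand_states_def)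

lemma fst_cand_states: "fst ` cand_states w j i v nb = cand nb w j i v"
  by (force simp: cand_states_def cand_of_def)

lemma card_cand_states: "card (cand_states w j i v nb) = card (cand nb w j i v)"
  using card_image[OF inj_cand_states, of w j i v nb] by (simp add: fst_cand_states)

lemma cand_states_Suc:
  assumes "j < i"
  shows "cand_states w (Suc j) i v nb =
    {(u, e') | u e e'. (u, e) \<in> cand_states w j i v nb \<and>
        next_state (act nb w j u) (w j u) (Alive e) = Alive e' \<and> e' \<le> w i u + (i - Suc j)}"
    (is "?L = ?R")
proof
  show "?R \<subseteq> ?L" by (auto simp: cand_states_def st_Suc)
  show "?L \<subseteq> ?R"
  proof
    fix p assume "p \<in> ?L"
    then obtain u e' where p: "p = (u, e')" "u \<in> nb v" "st nb w (Suc j) u = Alive e'" "e' \<le> w i u + (i - Suc j)"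
      by (auto simp: cand_states_def)
    have "u \<in> cand nb w (Suc j) i v" using p by (auto simp: cand_of_def)
    then have "u \<in> cand nb w j i v" using cand_Suc_subset[OF assms] by auto
    then obtain e where "(u, e) \<in> cand_states w j i v nb"
      by (auto simp: cand_of_def cand_states_def)
    moreover from this have "next_state (act nb w j u) (w j u) (Alive e) = Alive e'"
      using p(3) by (auto simp: cand_states_def st_Suc)
    ultimately show "p \<in> ?R" using p by auto
  qed
qed

definition limit :: "nat \<Rightarrow> nat \<Rightarrow> nat" where
  "limit t j = 16 * D * 8 ^ (t - j)"

text \<open>The limits are tested at all earlier stages too, so the search gives up before it pays
  for an oversized set of candidates.\<close>

definition filtered :: "coins \<Rightarrow> nat \<Rightarrow> nat \<Rightarrow> nat \<Rightarrow> nat \<Rightarrow> (nat \<Rightarrow> nat set) \<Rightarrow> (nat \<times> nat) set option" where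
  "filtered w t i v j nb = (if \<forall>j'\<le>j. card (cand nb w j' i v) \<le> limit t j'
     then Some (cand_states w j i v nb) else None)"

text \<open>Since \<open>2 ^ (i - j) * 4 ^ (t - Suc j) \<le> 8 ^ (t - j)\<close>, a search for an
  earlier round that gives up already proves that the node is stalled.\<close>

lemma limit_stalled:
  assumes "i < t" "j \<le> i" "limit t j < card (cand nb w j i v)"
  shows "stalled nb w t v"
proof -
  have "D * 2 ^ (i - j) * 4 ^ (t - Suc j) \<le> D * 2 ^ (t - j) * 4 ^ (t - j)"
    using assms by (intro mult_mono power_increasing) auto
  also have "\<dots> = D * 8 ^ (t - j)" by (simp add: power_mult_distrib[symmetric])
  also have "\<dots> \<le> limit t j" by (simp add: limit_def)
  finally show ?thesis using assms unfolding stalled_of_def by (meson le_less_trans)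
qed

end

locale bounded_process = mis_process + oracle_class
begin

text \<open>One query lists the neighbours; at time 0 all states are \<open>Alive e0\<close>.
  Passing from stage \<open>j\<close> to the next one asks for the actions of at most
  \<open>limit t j\<close> candidates.\<close>

lemma queries_le_filtered:
  assumes act: "\<And>j u. j < i \<Longrightarrow> queries_le (\<lambda>nb. act nb w j u) (c j)"
    and fin: "\<And>nb v. nb \<in> \<O> \<Longrightarrow> finite (nb v)"
    and c0: "\<And>j. 0 \<le> c j"
  shows "j \<le> i \<Longrightarrow> queries_le (filtered w t i v j) (1 + (\<Sum>j'<j. real (limit t j') * c j'))"
proof (induction j)
  case 0
  have "queries_le (filtered w t i v 0) 1"
  proof (rule queries_le_map[OF queries_le_query[of 1 v], where g = "\<lambda>N.
          let K = {(u, e). u \<in> N \<and> e = e0 \<and> e \<le> w i u + i} in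
          if card K \<le> limit t 0 then Some K else None"], goal_cases)
    case (2 nb)
    have "cand_states w 0 i v nb = {(u, e). u \<in> nb v \<and> e = e0 \<and> e \<le> w i u + i}"
      by (auto simp: cand_states_def)
    then show ?case
      by (simp add: filtered_def Let_def flip: card_cand_states)
  qed simp
  then show ?case by simp
next
  case (Suc j)
  let ?G = "\<lambda>x nb. case x of None \<Rightarrow> None | Some K \<Rightarrow>
     (let K' = {(u, e') | u e e'. (u, e) \<in> K \<and>
        next_state (act nb w j u) (w j u) (Alive e) = Alive e' \<and> e' \<le> w i u + (i - Suc j)}
      in if card K' \<le> limit t (Suc j) then Some K' else None)"
  show ?case
  proof (rule queries_le_bind[OF Suc.IH, where G = ?G and b = "real (limit t j) * c j"])
    fix nb x assume nb: "nb \<in> \<O>" and x: "x = filtered w t i v j nb"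
    show "queries_le (?G x) (real (limit t j) * c j)"
    proof (cases x)
      case None
      then show ?thesis using c0 by (auto intro!: queries_le_const)
    next
      case (Some K)
      then have K: "K = cand_states w j i v nb" "card K \<le> limit t j"
        using x by (auto simp: filtered_def card_cand_states split: if_splits)
      have finK: "finite (fst ` K)"
        using fin[OF nb] by (auto simp: K fst_cand_states cand_of_def)
      have cardK: "card (fst ` K) \<le> limit t j"
        using K card_image[OF inj_cand_states] by metis
      have "queries_le (\<lambda>nb u. if u \<in> fst ` K then Some (act nb w j u) else None) (real (limit t j) * c j)"
        by (rule queries_le_fun_const[OF finK cardK act]) (use Suc c0 in auto)
      then show ?thesis
      proof (rule queries_le_map[where g = "\<lambda>a. (let K' = {(u, e') | u e e'. (u, e) \<in> K \<and>
        next_state (the (a u)) (w j u) (Alive e) = Alive e' \<and> e' \<le> w i u + (i - Suc j)}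
           in if card K' \<le> limit t (Suc j) then Some K' else None)"], goal_cases)
        case (1 nb)
        have "(u, e) \<in> K \<Longrightarrow> u \<in> fst ` K" for u e by force
        then show ?case unfolding Some by (simp cong: conj_cong)
      qed
    qed
  next
    fix nb assume "nb \<in> \<O>"
    have ji: "j < i" using Suc by simp
    show "filtered w t i v (Suc j) nb = ?G (filtered w t i v j nb) nb"
      by (auto simp: filtered_def Let_def cand_states_Suc[OF ji, symmetric] card_cand_states le_Suc_eq)
  qed (use Suc in auto)
qed

text \<open>A neighbour in \<open>In\<close> joined in some round \<open>i\<close>, being marked and
  \<open>Free\<close>. Domination can thus be tested on the small candidate sets instead of on all
  neighbours.\<close>

lemma dominated_iff:
  "dominated nb w t v \<longleftrightarrow> (\<exists>i<t. \<exists>u\<in>cand nb w i i v. act nb w i u = Free)"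
proof (induction t)
  case (Suc t)
  have "dominated nb w (Suc t) v \<longleftrightarrow>
    dominated nb w t v \<or> (\<exists>u\<in>cand nb w t t v. act nb w t u = Free)"
    by (fastforce simp: dominated_of_def st_In_Suc_iff cand_of_def)
  then show ?case by (auto simp: Suc less_Suc_eq)
qed (simp add: dominated_of_def)

text \<open>The action is determined by at most \<open>(t + 1)^2\<close> filtered candidate sets and
  \<open>t\<close> domination tests, each within the cost of one full search.\<close>

lemma queries_le_act_step:
  assumes act: "\<And>j u. j < t \<Longrightarrow> queries_le (\<lambda>nb. act nb w j u) (c j)"
    and fin: "\<And>nb v. nb \<in> \<O> \<Longrightarrow> finite (nb v)"
    and c0: "\<And>j. 0 \<le> c j"
  shows "queries_le (\<lambda>nb. act nb w t v) (2 * (real t + 1)\<^sup>2 * (1 + (\<Sum>j<t. real (limit t j) * c j)))"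
proof -
  let ?s = "\<lambda>k. 1 + (\<Sum>j<k. real (limit t j) * c j)"
  have mono: "?s k \<le> ?s l" if "k \<le> l" for k l
    using that c0 by (intro add_left_mono sum_mono2) auto
  let ?A = "{(i, j). i \<le> t \<and> j \<le> i}"
  have subA: "?A \<subseteq> {..t} \<times> {..t}" by auto
  have finA: "finite ?A" using subA by (rule finite_subset) auto
  have cardA: "card ?A \<le> (t + 1)\<^sup>2"
    using card_mono[OF _ subA] by (simp add: power2_eq_square)
  have f: "queries_le (filtered w t i v j) (?s t)" if "i \<le> t" "j \<le> i" for i j
    by (rule queries_le_mono[OF queries_le_filtered[of i w c] mono])
       (use that act fin c0 in auto)
  \<comment> \<open>\<open>None\<close> means that the search gave up; then \<open>v\<close> is
    stalled and domination is not consulted.\<close>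
  let ?h = "\<lambda>i nb. case filtered w t i v i nb of None \<Rightarrow> None
     | Some K \<Rightarrow> Some (\<exists>u\<in>fst ` K. act nb w i u = Free)"
  have g: "queries_le (?h i) (?s t)" if "i < t" for i
  proof (rule queries_le_mono[OF _ mono[of "Suc i" t]])
    let ?G = "\<lambda>x nb. case x of None \<Rightarrow> None
     | Some K \<Rightarrow> Some (\<exists>u\<in>fst ` K. act nb w i u = Free)"
    have fi: "queries_le (filtered w t i v i) (?s i)"
      by (rule queries_le_filtered) (use that act fin c0 in auto)
    show "queries_le (?h i) (?s (Suc i))"
    proof (rule queries_le_bind[OF fi, where G = ?G and b = "real (limit t i) * c i"])
      fix nb x assume nb: "nb \<in> \<O>" and x: "x = filtered w t i v i nb"
      show "queries_le (?G x) (real (limit t i) * c i)"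
      proof (cases x)
        case None
        then show ?thesis using c0 by (auto intro!: queries_le_const)
      next
        case (Some K)
        then have K: "K = cand_states w i i v nb" "card K \<le> limit t i"
          using x by (auto simp: filtered_def card_cand_states split: if_splits)
        have finK: "finite (fst ` K)"
          using fin[OF nb] by (auto simp: K fst_cand_states cand_of_def)
        have cardK: "card (fst ` K) \<le> limit t i"
          using K card_image[OF inj_cand_states] by metis
        have "queries_le (\<lambda>nb u. if u \<in> fst ` K then Some (act nb w i u) else None) (real (limit t i) * c i)"
          by (rule queries_le_fun_const[OF finK cardK act]) (use that c0 in auto)
        then show ?thesis
          by (rule queries_le_map[where g = "\<lambda>a. Some (\<exists>u\<in>fst ` K. a u = Some Free)"]) (auto simp: Some)
      qed
    qed auto
  qed (use that in auto)
  have F: "queries_le (\<lambda>nb p. if p \<in> ?A then Some (filtered w t (fst p) v (snd p) nb) else None) (\<Sum>p\<in>?A. ?s t)"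
    by (rule queries_le_fun[OF finA]) (use f in auto)
  have H: "queries_le (\<lambda>nb i. if i \<in> {..<t} then Some (?h i nb) else None) (\<Sum>i\<in>{..<t}. ?s t)"
    by (rule queries_le_fun) (use g in auto)
  let ?N = "\<lambda>F i j. the (the (F (i, j)))"
  \<comment> \<open>An aborted search, \<open>Some None\<close> in the table, counts as stalling for
    \<open>i < t\<close> and as overflow for \<open>i = t\<close>.\<close>
  let ?act = "\<lambda>F H. if (\<exists>i<t. \<exists>j\<le>i. F (i, j) = Some None \<or> D * 2 ^ (i - j) * 4 ^ (t - Suc j) < card (?N F i j)) then Up
      else if (\<exists>i<t. H i = Some (Some True)) then Kill
      else if (\<exists>j\<le>t. F (t, j) = Some None \<or> limit t j < card (?N F t j)) \<or> ?N F t t \<noteq> {} then Up else Free"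
  show ?thesis
  proof (rule queries_le_bind[OF F, where G = "\<lambda>F nb. ?act F (\<lambda>i. if i \<in> {..<t} then Some (?h i nb) else None)"
        and b = "\<Sum>i\<in>{..<t}. ?s t"], goal_cases)
    case (1 nb x)
    show ?case by (rule queries_le_map[OF H, where g = "?act x"]) simp
  next
    case (2 nb)
    let ?F = "\<lambda>p. if p \<in> ?A then Some (filtered w t (fst p) v (snd p) nb) else None"
    let ?H = "\<lambda>i. if i \<in> {..<t} then Some (?h i nb) else None"
    have F_None: "?F (i, j) = Some None \<longleftrightarrow> (\<exists>j'\<le>j. limit t j' < card (cand nb w j' i v))" if "i \<le> t" "j \<le> i" for i j
      using that by (auto simp: filtered_def not_le)
    have F_Some: "?N ?F i j = cand_states w j i v nb" if "i \<le> t" "j \<le> i" "?F (i, j) \<noteq> Some None" for i j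
    proof -
      have "\<forall>j'\<le>j. card (cand nb w j' i v) \<le> limit t j'"
        using F_None[OF that(1,2)] that(3) by (meson not_le)
      then have "filtered w t i v j nb = Some (cand_states w j i v nb)"
        unfolding filtered_def by (rule if_P)
      then show ?thesis using that(1,2) by simp
    qed
    have cardF: "card (?N ?F i j) = card (cand nb w j i v)" if "i \<le> t" "j \<le> i" "?F (i, j) \<noteq> Some None" for i j
      unfolding F_Some[OF that] by (rule card_cand_states)
    have 1: "stalled nb w t v \<longleftrightarrow> (\<exists>i<t. \<exists>j\<le>i. ?F (i, j) = Some None \<or> D * 2 ^ (i - j) * 4 ^ (t - Suc j) < card (?N ?F i j))" (is "_ \<longleftrightarrow> ?st")
    proof
      assume "stalled nb w t v"
      then obtain i j where ij: "i < t" "j \<le> i" "D * 2 ^ (i - j) * 4 ^ (t - Suc j) < card (cand nb w j i v)"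
        by (auto simp: stalled_of_def)
      have "?F (i, j) = Some None \<or> D * 2 ^ (i - j) * 4 ^ (t - Suc j) < card (?N ?F i j)"
      proof (cases "?F (i, j) = Some None")
        case False
        show ?thesis
          unfolding cardF[OF less_imp_le[OF ij(1)] ij(2) False] by (rule disjI2) (rule ij(3))
      qed (rule disjI1)
      then show ?st using ij(1,2) by blast
    next
      assume ?st
      then obtain i j where ij: "i < t" "j \<le> i" "?F (i, j) = Some None \<or> D * 2 ^ (i - j) * 4 ^ (t - Suc j) < card (?N ?F i j)"
        by blast
      show "stalled nb w t v"
      proof (cases "?F (i, j) = Some None")
        case True
        then obtain j' where "j' \<le> j" "limit t j' < card (cand nb w j' i v)"
          using F_None[of i j] ij by auto
        then show ?thesis using limit_stalled[of i t j'] ij by auto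
      next
        case False
        have "D * 2 ^ (i - j) * 4 ^ (t - Suc j) < card (cand nb w j i v)"
          using ij(3) unfolding cardF[OF less_imp_le[OF ij(1)] ij(2) False]
          by (rule disjE) (use False in blast)
        then show ?thesis using ij unfolding stalled_of_def by blast
      qed
    qed
    have 2: "dominated nb w t v \<longleftrightarrow> (\<exists>i<t. ?H i = Some (Some True))" if ns: "\<not> stalled nb w t v"
    proof -
      have "?H i = Some (Some True) \<longleftrightarrow> (\<exists>u\<in>cand nb w i i v. act nb w i u = Free)" if "i < t" for i
      proof -
        have "\<forall>j'\<le>i. card (cand nb w j' i v) \<le> limit t j'"
          using ns limit_stalled[OF that] by (meson not_le)
        then have "filtered w t i v i nb = Some (cand_states w i i v nb)"
          unfolding filtered_def by (rule if_P)
        then show ?thesis using that by (simp add: fst_cand_states)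
      qed
      then show ?thesis unfolding dominated_iff by (intro iff_exI conj_cong refl) simp
    qed
    have 3: "overflow nb w t v \<longleftrightarrow> (\<exists>j\<le>t. ?F (t, j) = Some None \<or> limit t j < card (?N ?F t j))" (is "_ \<longleftrightarrow> ?ov")
    proof
      assume "overflow nb w t v"
      then obtain j where "j \<le> t" "limit t j < card (cand nb w j t v)"
        by (auto simp: overflow_of_def limit_def)
      then show ?ov using F_None[of t j] by blast
    next
      assume ?ov
      then obtain j where j: "j \<le> t" "?F (t, j) = Some None \<or> limit t j < card (?N ?F t j)"
        by blast
      have "\<exists>j\<le>t. limit t j < card (cand nb w j t v)"
      proof (cases "?F (t, j) = Some None")
        case True
        then obtain j' where "j' \<le> j" "limit t j' < card (cand nb w j' t v)"
          using F_None[OF order_refl j(1)] by blast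
        then show ?thesis using j(1) by (intro exI[of _ j']) simp
      next
        case False
        have "limit t j < card (cand nb w j t v)"
          using j(2) unfolding cardF[OF order_refl j(1) False] by (rule disjE) (use False in blast)
        then show ?thesis using j(1) by blast
      qed
      then show "overflow nb w t v" by (auto simp: overflow_of_def limit_def)
    qed
    have 4: "cand nb w t t v \<noteq> {} \<longleftrightarrow> ?N ?F t t \<noteq> {}" if "\<not> overflow nb w t v"
    proof -
      have "?F (t, t) \<noteq> Some None" using that 3 by blast
      then show ?thesis using F_Some[of t t] fst_cand_states[of w t t v nb] by auto
    qed
    show ?case
    proof (subst action_of_def, rule if_cong[OF 1 refl], rule if_cong[OF 2 refl], goal_cases)
      case 1
      then show ?case unfolding \<open>stalled nb w t v = _\<close> .
    next
      case 2
      show ?case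
      proof (rule if_cong[OF _ refl refl])
        show "(overflow nb w t v \<or> cand nb w t t v \<noteq> {}) \<longleftrightarrow>
          (\<exists>j\<le>t. ?F (t, j) = Some None \<or> limit t j < card (?N ?F t j)) \<or> ?N ?F t t \<noteq> {}"
          using 4 unfolding 3[symmetric] by argo
      qed
    qed
  next
    case 3
    have s1: "1 \<le> ?s t" using c0 by (simp add: sum_nonneg)
    have "real (card ?A) * ?s t + real t * ?s t \<le> (real t + 1)\<^sup>2 * ?s t + (real t + 1)\<^sup>2 * ?s t"
    proof (intro add_mono mult_right_mono)
      have "real (card ?A) \<le> real ((t + 1)\<^sup>2)" using cardA by (rule of_nat_mono)
      then show "real (card ?A) \<le> (real t + 1)\<^sup>2" by (simp add: add.commute)
      show "real t \<le> (real t + 1)\<^sup>2" by (simp add: power2_eq_square algebra_simps)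
    qed (use s1 in auto)
    then show ?case by simp
  qed
qed

text \<open>With \<open>X = 8 + 128 * D * P\<close>, the term \<open>P * X ^ t\<close> solves the
  recurrence, because \<open>X ^ t - 8 ^ t = (X - 8) * (\<Sum>j<t. 8 ^ (t - Suc j) * X ^ j)\<close>
  and \<open>X - 8\<close> is \<open>16 * D * 8 * P\<close>.\<close>

lemma queries_le_act:
  fixes P :: real
  assumes fin: "\<And>nb v. nb \<in> \<O> \<Longrightarrow> finite (nb v)" and P: "2 * (real T + 1)\<^sup>2 \<le> P"
  shows "t \<le> T \<Longrightarrow> queries_le (\<lambda>nb. act nb w t v) (P * (8 + 128 * real D * P) ^ t)"
proof (induction t arbitrary: v rule: less_induct)
  case (less t)
  let ?X = "8 + 128 * real D * P"
  have P0: "0 \<le> P" by (rule order_trans[OF _ P]) simp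
  have X0: "0 \<le> ?X" using P0 by simp
  have "queries_le (\<lambda>nb. act nb w t v) (2 * (real t + 1)\<^sup>2 * (1 + (\<Sum>j<t. real (limit t j) * (P * ?X ^ j))))"
  proof (rule queries_le_act_step[where c = "\<lambda>j. P * ?X ^ j"])
    show "queries_le (\<lambda>nb. act nb w j u) (P * ?X ^ j)" if "j < t" for j u
      using that less.prems by (intro less.IH) simp_all
    show "finite (nb v)" if "nb \<in> \<O>" for nb v using that by (rule fin)
    show "0 \<le> P * ?X ^ j" for j
      using P0 X0 by (intro mult_nonneg_nonneg zero_le_power)
  qed
  then show ?case
  proof (rule queries_le_mono)
    have pos: "0 \<le> 1 + (\<Sum>j<t. real (limit t j) * (P * ?X ^ j))"
      using P0 X0 by (intro add_nonneg_nonneg sum_nonneg mult_nonneg_nonneg zero_le_power) simp_all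
    have "2 * (real t + 1)\<^sup>2 \<le> P"
      by (rule order_trans[OF _ P]) (intro mult_left_mono power_mono, use less.prems in simp_all)
    then have A: "2 * (real t + 1)\<^sup>2 * (1 + (\<Sum>j<t. real (limit t j) * (P * ?X ^ j)))
      \<le> P * (1 + (\<Sum>j<t. real (limit t j) * (P * ?X ^ j)))"
      using pos by (rule mult_right_mono)
    have B: "1 + (\<Sum>j<t. real (limit t j) * (P * ?X ^ j)) \<le> ?X ^ t"
    proof -
      have "?X ^ t - 8 ^ t = (?X - 8) * (\<Sum>j<t. 8 ^ (t - Suc j) * ?X ^ j)"
        by (rule power_diff_sumr2)
      also have "\<dots> = (\<Sum>j<t. real (limit t j) * (P * ?X ^ j))"
        unfolding sum_distrib_left
      proof (rule sum.cong)
        fix j assume "j \<in> {..<t}"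
        then obtain k where "t = Suc (j + k)" by (auto simp: less_iff_Suc_add)
        then have k: "t - Suc j = k" "t - j = Suc k" by auto
        have *: "(8 + 128 * d * P - 8) * (a * b) = 16 * d * (8 * a) * (P * b)" for a b d :: real
          by (simp add: algebra_simps)
        show "(?X - 8) * (8 ^ (t - Suc j) * ?X ^ j) = real (limit t j) * (P * ?X ^ j)"
          unfolding k limit_def of_nat_mult of_nat_power power_Suc of_nat_numeral by (rule *)
      qed simp
      finally have "(\<Sum>j<t. real (limit t j) * (P * ?X ^ j)) = ?X ^ t - 8 ^ t" by (rule sym)
      moreover have "1 \<le> (8 :: real) ^ t" by (rule one_le_power) simp
      ultimately show ?thesis by linarith
    qed
    show "2 * (real t + 1)\<^sup>2 * (1 + (\<Sum>j<t. real (limit t j) * (P * ?X ^ j))) \<le> P * ?X ^ t"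
      by (rule order_trans[OF A mult_left_mono[OF B P0]])
  qed
qed

lemma queries_le_st:
  fixes P :: real
  assumes fin: "\<And>nb v. nb \<in> \<O> \<Longrightarrow> finite (nb v)" and P: "2 * (real T + 1)\<^sup>2 \<le> P"
  shows "queries_le (\<lambda>nb. st nb w T v) (T * (P * (8 + 128 * real D * P) ^ T))"
proof -
  let ?X = "8 + 128 * real D * P"
  have P0: "0 \<le> P" by (rule order_trans[OF _ P]) simp
  have "queries_le (\<lambda>nb t. if t \<in> {..<T} then Some (act nb w t v) else None) (\<Sum>t\<in>{..<T}. P * ?X ^ t)"
    by (rule queries_le_fun) (simp, rule queries_le_act[OF _ P], erule fin, simp)
  then have "queries_le (\<lambda>nb. st nb w T v) (\<Sum>t\<in>{..<T}. P * ?X ^ t)"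
  proof (rule queries_le_map[where g = "\<lambda>a. rec_nat (Alive e0) (\<lambda>t s. next_state (the (a t)) (w t v) s) T"])
    fix nb
    let ?a = "\<lambda>t. if t \<in> {..<T} then Some (act nb w t v) else None"
    have "t \<le> T \<Longrightarrow> st nb w t v = rec_nat (Alive e0) (\<lambda>t s. next_state (the (?a t)) (w t v) s) t" for t
      by (induction t) (auto simp: st_Suc)
    then show "st nb w T v = rec_nat (Alive e0) (\<lambda>t s. next_state (the (?a t)) (w t v) s) T" by simp
  qed
  then show ?thesis
  proof (rule queries_le_mono)
    have "(\<Sum>t<T. P * ?X ^ t) \<le> (\<Sum>t<T. P * ?X ^ T)"
      using P0 by (intro sum_mono mult_left_mono power_increasing) simp_all
    then show "(\<Sum>t\<in>{..<T}. P * ?X ^ t) \<le> T * (P * ?X ^ T)" by simp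
  qed
qed

end

section \<open>Weights and concentration in one round\<close>

lemma of_bool_prod_power:
  assumes "finite A"
  shows "(\<Prod>u\<in>A. 1 + z * of_bool (E u)) = (1 + z :: real) ^ card {u \<in> A. E u}"
proof -
  have "(\<Prod>u\<in>A. 1 + z * of_bool (E u)) = (\<Prod>u\<in>A. if E u then 1 + z else 1)"
    by (intro prod.cong) auto
  also have "\<dots> = (\<Prod>u\<in>{u \<in> A. E u}. 1 + z)"
    by (rule prod.inter_filter[OF assms, symmetric])
  finally show ?thesis by simp
qed

text \<open>The chord of the convex function \<open>4 powr (- x)\<close> over [0, 1/2] is
  \<open>1 - x\<close>.\<close>

lemma prod_one_minus_ge:
  assumes "finite A" "\<And>u. u \<in> A \<Longrightarrow> 0 \<le> f u \<and> f u \<le> (1/2 :: real)"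
  shows "4 powr (- (\<Sum>u\<in>A. f u)) \<le> (\<Prod>u\<in>A. 1 - f u)"
proof -
  have "4 powr (- (\<Sum>u\<in>A. f u)) = (\<Prod>u\<in>A. 4 powr (- f u))"
    using assms(1) by (simp add: powr_sum flip: sum_negf)
  also have "\<dots> \<le> (\<Prod>u\<in>A. 1 - f u)"
  proof (rule prod_mono)
    fix u assume "u \<in> A"
    then have u: "0 \<le> f u" "f u \<le> 1/2" using assms by auto
    have "convex_on {0..1/2} (\<lambda>x :: real. 4 powr (- x))"
    proof (rule convex_on_realI[where f' = "\<lambda>x. - ln 4 * 4 powr (- x)"])
      show "((\<lambda>x. 4 powr - x) has_real_derivative - ln 4 * 4 powr - x) (at x)" for x :: real
        by (auto intro!: derivative_eq_intros simp: powr_def)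
    qed auto
    then have "4 powr (- ((1 - 2 * f u) *\<^sub>R 0 + (2 * f u) *\<^sub>R (1/2))) \<le>
      (1 - 2 * f u) * 4 powr (- 0) + 2 * f u * 4 powr (- (1/2))"
      by (rule convex_onD) (use u in auto)
    also have "4 powr (- (1/2)) = (1/2 :: real)"
      by (simp add: powr_minus powr_half_sqrt field_simps)
    finally show "0 \<le> 4 powr (- f u) \<and> 4 powr (- f u) \<le> 1 - f u" by simp
  qed
  finally show ?thesis .
qed

lemma prod_one_plus_le_exp:
  assumes "\<And>u. u \<in> A \<Longrightarrow> 0 \<le> 1 + f u"
  shows "(\<Prod>u\<in>A. 1 + f u) \<le> exp (\<Sum>u\<in>A. f u :: real)"
proof (cases "finite A")
  case True
  then have "exp (\<Sum>u\<in>A. f u) = (\<Prod>u\<in>A. exp (f u))" by (simp add: exp_sum)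
  then show ?thesis
    using assms by (auto intro!: prod_mono simp: exp_ge_add_one_self)
qed simp

text \<open>Adding elements one by one overshoots \<open>k\<close> by at most one summand.\<close>

lemma subset_sum_between:
  assumes "finite A" "\<And>u. u \<in> A \<Longrightarrow> 0 \<le> f u \<and> f u \<le> (b :: real)" "k \<le> (\<Sum>u\<in>A. f u)" "0 \<le> k" "0 \<le> b"
  shows "\<exists>B\<subseteq>A. k \<le> (\<Sum>u\<in>B. f u) \<and> (\<Sum>u\<in>B. f u) \<le> k + b"
  using assms(1-3)
proof (induction A rule: finite_induct)
  case empty
  then show ?case using assms(4,5) by auto
next
  case (insert a A)
  show ?case
  proof (cases "k \<le> (\<Sum>u\<in>A. f u)")
    case True
    then obtain B where "B \<subseteq> A" "k \<le> (\<Sum>u\<in>B. f u)" "(\<Sum>u\<in>B. f u) \<le> k + b"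
      using insert by auto
    then show ?thesis by blast
  next
    case False
    have "f a \<le> b" using insert.prems(1)[of a] by simp
    then have "(\<Sum>u\<in>insert a A. f u) \<le> k + b" using insert.hyps False by simp
    then show ?thesis using insert.prems by blast
  qed
qed

locale graph_nb =
  fixes nb :: "nat \<Rightarrow> nat set" and n \<Delta> :: nat
  assumes nb_sub: "nb v \<subseteq> {..<n}"
    and nb_sym: "u \<in> nb v \<Longrightarrow> v \<in> nb u"
    and nb_irrefl: "v \<notin> nb v"
    and nb_card: "card (nb v) \<le> \<Delta>"
begin

lemma finite_nb [simp]: "finite (nb v)"
  using nb_sub finite_subset by blast

end

text \<open>The bound \<open>\<Delta> \<le> 2 ^ e0\<close> makes the initial expected number of
  marked neighbours at most 1; \<open>m\<close> is the number of bits per coin.\<close>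

locale mis_graph = mis_process + graph_nb +
  fixes m :: nat
  assumes e0_pos: "1 \<le> e0" and \<Delta>_le: "\<Delta> \<le> 2 ^ e0" and D_pos: "1 \<le> D"
begin

definition row :: "(nat \<Rightarrow> nat) pmf" where
  "row = Pi_pmf {..<n} 0 (\<lambda>_. geo m)"

lemma finite_row [simp]: "finite (set_pmf row)"
  unfolding row_def by (rule finite_set_Pi_pmf) auto

lemmas row_linear = Ev_add[OF finite_row] Ev_cmult Ev_const

lemma row_component: "u < n \<Longrightarrow> Ev row (\<lambda>x. f (x u)) = Ev (geo m) f"
proof -
  assume "u < n"
  then have "map_pmf (\<lambda>x. x u) row = geo m" by (simp add: row_def Pi_pmf_component)
  then show ?thesis by (metis Ev_map)
qed

lemma row_prod:
  assumes "A \<subseteq> {..<n}"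
  shows "Ev row (\<lambda>x. \<Prod>u\<in>A. f u (x u)) = (\<Prod>u\<in>A. Ev (geo m) (f u))"
proof -
  have "finite A" using assms finite_subset by blast
  then have "Ev row (\<lambda>x. \<Prod>u\<in>A. f u (x u)) = (\<Prod>u\<in>A. Ev row (\<lambda>x. f u (x u)))"
    unfolding row_def by (intro Ev_indep_prod[where B = "\<lambda>u. {u}"]) (auto simp: depends_on_def)
  also have "\<dots> = (\<Prod>u\<in>A. Ev (geo m) (f u))"
    using assms by (intro prod.cong refl row_component) auto
  finally show ?thesis .
qed

lemma row_prod_of_bool:
  assumes "A \<subseteq> {..<n}"
  shows "Ev row (\<lambda>x. (1 + z) ^ card {u \<in> A. E u (x u)}) = (\<Prod>u\<in>A. 1 + z * Ev (geo m) (\<lambda>g. of_bool (E u g)))"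
proof -
  have fin: "finite A" using assms finite_subset by blast
  have "Ev row (\<lambda>x. (1 + z) ^ card {u \<in> A. E u (x u)}) = Ev row (\<lambda>x. \<Prod>u\<in>A. 1 + z * of_bool (E u (x u)))"
    by (simp only: of_bool_prod_power[OF fin])
  also have "\<dots> = (\<Prod>u\<in>A. Ev (geo m) (\<lambda>g. 1 + z * of_bool (E u g)))"
    by (rule row_prod[OF assms])
  also have "\<dots> = (\<Prod>u\<in>A. 1 + z * Ev (geo m) (\<lambda>g. of_bool (E u g)))"
    by (subst Ev_add) (auto simp: Ev_cmult)
  finally show ?thesis .
qed

lemma Ev_of_bool_bounds: "0 \<le> Ev p (\<lambda>x. of_bool (P x))" "Ev p (\<lambda>x. of_bool (P x)) \<le> 1"
  by (simp_all flip: prob_eq_Ev)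

text \<open>Markov's inequality for \<open>2 ^ X\<close>, where \<open>X\<close> is the count: its
  expectation is at most \<open>exp \<mu> \<le> 4 powr \<mu>\<close>.\<close>

lemma row_count_upper:
  assumes "A \<subseteq> {..<n}" "(\<Sum>u\<in>A. Ev (geo m) (\<lambda>g. of_bool (E u g))) \<le> \<mu>"
  shows "Ev row (\<lambda>x. of_bool (2 * \<mu> + a < real (card {u \<in> A. E u (x u)}))) \<le> 2 powr (- a)"
proof -
  let ?\<pi> = "\<lambda>u. Ev (geo m) (\<lambda>g. of_bool (E u g))"
  have "Ev row (\<lambda>x. of_bool (2 * \<mu> + a < real (card {u \<in> A. E u (x u)})))
    \<le> Ev row (\<lambda>x. 2 powr (- 2 * \<mu> - a) * (1 + 1) ^ card {u \<in> A. E u (x u)})"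
  proof (rule Ev_mono[OF finite_row])
    fix x
    let ?c = "card {u \<in> A. E u (x u)}"
    have "1 \<le> 2 powr (- 2 * \<mu> - a) * 2 ^ ?c" if "2 * \<mu> + a < real ?c"
    proof -
      have "1 \<le> 2 powr (- 2 * \<mu> - a + real ?c)" using that by (intro ge_one_powr_ge_zero) auto
      then show ?thesis by (simp add: powr_add powr_realpow)
    qed
    then show "of_bool (2 * \<mu> + a < real ?c) \<le> 2 powr (- 2 * \<mu> - a) * (1 + 1) ^ ?c" by auto
  qed
  also have "\<dots> = 2 powr (- 2 * \<mu> - a) * (\<Prod>u\<in>A. 1 + 1 * ?\<pi> u)"
    unfolding Ev_cmult row_prod_of_bool[OF assms(1)] ..
  also have "\<dots> \<le> 2 powr (- 2 * \<mu> - a) * exp (\<Sum>u\<in>A. 1 * ?\<pi> u)"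
    by (intro mult_left_mono prod_one_plus_le_exp) (auto simp: Ev_of_bool_bounds)
  also have "\<dots> \<le> 2 powr (- 2 * \<mu> - a) * exp \<mu>"
    using assms(2) by simp
  also have "exp \<mu> = exp 1 powr \<mu>" by (simp add: powr_def)
  also have "2 powr (- 2 * \<mu> - a) * exp 1 powr \<mu> \<le> 2 powr (- 2 * \<mu> - a) * 4 powr \<mu>"
  proof (intro mult_left_mono powr_mono2)
    show "0 \<le> \<mu>" using assms(2) by (rule order_trans[rotated]) (auto intro!: sum_nonneg Ev_of_bool_bounds)
    show "exp 1 \<le> (4 :: real)" using exp_le by linarith
  qed auto
  also have "(4 :: real) powr \<mu> = 2 powr (2 * \<mu>)"
    unfolding powr_powr[symmetric] by simp
  finally show ?thesis by (simp flip: powr_add)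
qed

text \<open>The same argument with \<open>(1 / 2) ^ X\<close>, whose expectation is at most
  \<open>exp (- \<mu> / 2) \<le> 2 powr (- \<mu> / 2)\<close>.\<close>

lemma row_count_lower:
  fixes E :: "nat \<Rightarrow> nat \<Rightarrow> bool"
  assumes "A \<subseteq> {..<n}"
  defines "\<mu> \<equiv> (\<Sum>u\<in>A. Ev (geo m) (\<lambda>g. of_bool (E u g)))"
  shows "Ev row (\<lambda>x. of_bool (real (card {u \<in> A. E u (x u)}) < \<mu> / 2 - a)) \<le> 2 powr (- a)"
proof -
  let ?\<pi> = "\<lambda>u. Ev (geo m) (\<lambda>g. of_bool (E u g))"
  have "Ev row (\<lambda>x. of_bool (real (card {u \<in> A. E u (x u)}) < \<mu> / 2 - a))
    \<le> Ev row (\<lambda>x. 2 powr (\<mu> / 2 - a) * (1 + - 1 / 2) ^ card {u \<in> A. E u (x u)})"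
  proof (rule Ev_mono[OF finite_row])
    fix x
    let ?c = "card {u \<in> A. E u (x u)}"
    have "1 \<le> 2 powr (\<mu> / 2 - a) * (1 / 2) ^ ?c" if "real ?c < \<mu> / 2 - a"
    proof -
      have "1 \<le> 2 powr (\<mu> / 2 - a - real ?c)" using that by (intro ge_one_powr_ge_zero) auto
      then show ?thesis by (simp add: powr_diff powr_realpow power_divide)
    qed
    then show "of_bool (real ?c < \<mu> / 2 - a) \<le> 2 powr (\<mu> / 2 - a) * (1 + - 1 / 2) ^ ?c" by auto
  qed
  also have "\<dots> = 2 powr (\<mu> / 2 - a) * (\<Prod>u\<in>A. 1 + - 1 / 2 * ?\<pi> u)"
    unfolding Ev_cmult row_prod_of_bool[OF assms(1)] ..
  also have "\<dots> \<le> 2 powr (\<mu> / 2 - a) * exp (\<Sum>u\<in>A. - 1 / 2 * ?\<pi> u)"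
  proof (intro mult_left_mono prod_one_plus_le_exp)
    fix u show "0 \<le> 1 + - 1 / 2 * ?\<pi> u" using Ev_of_bool_bounds(2)[of "geo m" "E u"] by simp
  qed auto
  also have "(\<Sum>u\<in>A. - 1 / 2 * ?\<pi> u) = - \<mu> / 2"
    unfolding \<mu>_def by (simp add: sum_negf sum_divide_distrib)
  also have "exp (- \<mu> / 2) = exp 1 powr (- \<mu> / 2)" by (simp add: powr_def)
  also have "2 powr (\<mu> / 2 - a) * exp 1 powr (- \<mu> / 2) \<le> 2 powr (\<mu> / 2 - a) * 2 powr (- \<mu> / 2)"
  proof (intro mult_left_mono powr_mono2')
    have "0 \<le> \<mu>" unfolding \<mu>_def by (intro sum_nonneg Ev_of_bool_bounds)
    then show "- \<mu> / 2 \<le> 0" by simp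
    show "2 \<le> exp (1 :: real)" using exp_ge_add_one_self[of 1] by simp
  qed auto
  finally show ?thesis by (simp flip: powr_add)
qed

definition wt :: "coins \<Rightarrow> nat \<Rightarrow> nat \<Rightarrow> real" where
  "wt w t u = (case st nb w t u of Alive e \<Rightarrow> 1 / 2 ^ e | _ \<Rightarrow> 0)"

text \<open>Known as the effective degree: the expected number of neighbours marked in round
  \<open>t\<close>, given the past.\<close>

definition deg :: "coins \<Rightarrow> nat \<Rightarrow> nat \<Rightarrow> real" where
  "deg w t v = (\<Sum>u\<in>nb v. wt w t u)"

text \<open>
  Stalling reacts to degrees of earlier rounds. The discounted sum remembers them, so that a stalled
  node still has a large \<open>mem\<close> after most of its neighbours have disappeared.
\<close>

primrec mem :: "coins \<Rightarrow> nat \<Rightarrow> nat \<Rightarrow> real" where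
  "mem w 0 v = deg w 0 v"
| "mem w (Suc t) v = deg w (Suc t) v + mem w t v / 4"

text \<open>
  A failure is a deviation of the sampled neighbourhoods from their expected sizes.
\<close>

definition fail :: "coins \<Rightarrow> nat \<Rightarrow> nat \<Rightarrow> bool" where
  "fail w t u \<longleftrightarrow>
     (\<exists>j\<le>t. 2 * (2 ^ (t - j) * deg w j u) + D / 2 * 2 ^ (t - j) < card (cand nb w j t u)) \<or>
     real (card (cand nb w t t u)) < deg w t u / 2 - D / 2"

definition marked :: "coins \<Rightarrow> nat \<Rightarrow> nat \<Rightarrow> nat \<Rightarrow> bool" where
  "marked w t u g \<longleftrightarrow> (\<exists>e. st nb w t u = Alive e \<and> e \<le> g)"

text \<open>Putting \<open>x\<close> into round \<open>t\<close> models conditioning on the rounds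
  before \<open>t\<close>. This and the following facts record what is already settled by the
  past.\<close>

lemma st_upd: "j \<le> t \<Longrightarrow> st nb (w(t := x)) j = st nb w j"
  by (rule st_coins_cong) auto

lemma wt_upd: "j \<le> t \<Longrightarrow> wt (w(t := x)) j u = wt w j u"
  by (simp add: wt_def st_upd)

lemma deg_upd: "j \<le> t \<Longrightarrow> deg (w(t := x)) j u = deg w j u"
  by (simp add: deg_def wt_upd)

lemma mem_upd: "j \<le> t \<Longrightarrow> mem (w(t := x)) j u = mem w j u"
  by (induction j) (auto simp: deg_upd)

lemma cand_upd: "j \<le> t \<Longrightarrow> i < t \<Longrightarrow> cand nb (w(t := x)) j i u = cand nb w j i u"
  by (simp add: cand_of_def st_upd)

lemma cand_upd_same: "j \<le> t \<Longrightarrow> cand nb (w(t := x)) j t v = {u \<in> nb v. marked w j u (x u + (t - j))}"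
  by (simp add: cand_of_def st_upd marked_def)

lemma cand_upd_now: "cand nb (w(t := x)) t t v = {u \<in> nb v. marked w t u (x u)}"
  by (simp add: cand_upd_same)

lemma stalled_upd: "stalled nb (w(t := x)) t u = stalled nb w t u"
  unfolding stalled_of_def by (intro iff_exI conj_cong refl) (simp add: cand_upd)

lemma dominated_upd: "j \<le> t \<Longrightarrow> dominated nb (w(t := x)) j u = dominated nb w j u"
  by (simp add: dominated_of_def st_upd)

lemma fail_upd: "s < t \<Longrightarrow> fail (w(t := x)) s u = fail w s u"
  unfolding fail_def by (simp add: cand_upd deg_upd cong: conj_cong)

lemma wt_nonneg: "0 \<le> wt w t u"
  by (auto simp: wt_def split: node_state.splits)

lemma wt_le_half: "wt w t u \<le> 1 / 2"
proof (cases "st nb w t u")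
  case (Alive e)
  then have "1 \<le> e" using st_Alive_ge1[OF e0_pos] by blast
  then have "(2 :: real) ^ 1 \<le> 2 ^ e" by (rule power_increasing) simp
  then show ?thesis using Alive by (simp add: wt_def field_simps)
qed (auto simp: wt_def)

lemma deg_nonneg: "0 \<le> deg w t v"
  by (simp add: deg_def sum_nonneg wt_nonneg)

lemma mem_nonneg: "0 \<le> mem w t v"
  by (induction t) (auto simp: deg_nonneg)

lemma deg_le_mem: "deg w t v \<le> mem w t v"
  by (cases t) (auto simp: mem_nonneg)

lemma wt_Suc_le: "wt w (Suc t) u \<le> 2 * wt w t u"
proof (cases "st nb w t u")
  case (Alive e)
  show ?thesis
  proof (cases "st nb w (Suc t) u")
    case (Alive e')
    with \<open>st nb w t u = Alive e\<close> have "e \<le> Suc e'"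
      using next_state_Alive_le by (metis st_Suc)
    then have "(2 :: real) ^ e \<le> 2 ^ Suc e'" by (rule power_increasing) simp
    then show ?thesis using Alive \<open>st nb w t u = Alive e\<close> by (simp add: wt_def field_simps)
  qed (use Alive in \<open>auto simp: wt_def\<close>)
qed (auto simp: wt_def st_Suc)

lemma deg_Suc_le: "deg w (Suc t) v \<le> 2 * deg w t v"
  unfolding deg_def sum_distrib_left by (intro sum_mono wt_Suc_le)

lemma deg_0_le: "deg w 0 v \<le> 1"
proof -
  have "deg w 0 v = card (nb v) / 2 ^ e0" by (simp add: deg_def wt_def)
  also have "\<dots> \<le> real (2 ^ e0) / 2 ^ e0"
    using nb_card[of v] \<Delta>_le by (intro divide_right_mono of_nat_mono) auto
  finally show ?thesis by simp
qed

lemma mem_ge_deg: "j \<le> t \<Longrightarrow> deg w j v / 4 ^ (t - j) \<le> mem w t v"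
proof (induction t)
  case (Suc t)
  show ?case
  proof (cases "j = Suc t")
    case False
    then have "j \<le> t" using Suc by simp
    then have "deg w j v / 4 ^ (Suc t - j) = deg w j v / 4 ^ (t - j) / 4" by (simp add: Suc_diff_le)
    also have "\<dots> \<le> mem w t v / 4" using Suc.IH[OF \<open>j \<le> t\<close>] by simp
    also have "\<dots> \<le> mem w (Suc t) v" by (simp add: deg_nonneg)
    finally show ?thesis .
  qed (use deg_le_mem[of w "Suc t" v] in simp)
qed simp

lemma fail_upperD:
  assumes "\<not> fail w i u" "j \<le> i"
  shows "real (card (cand nb w j i u)) \<le> 2 * (2 ^ (i - j) * deg w j u) + D / 2 * 2 ^ (i - j)"
  using assms unfolding fail_def by (meson not_le)

text \<open>Here the growth of the tolerance meets the discount in \<open>mem\<close>: without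
  failures an overfull sample forces \<open>D * 4 ^ (t - Suc j) / 4 \<le> deg w j v\<close>, and the
  discount \<open>4 ^ (t - j)\<close> leaves \<open>D / 16\<close>.\<close>

lemma stalled_mem:
  assumes "\<And>s. s < t \<Longrightarrow> \<not> fail w s v" "stalled nb w t v"
  shows "D / 16 \<le> mem w t v"
proof -
  obtain i j where ij: "i < t" "j \<le> i" "D * 2 ^ (i - j) * 4 ^ (t - Suc j) < card (cand nb w j i v)"
    using assms(2) by (auto simp: stalled_of_def)
  let ?p = "2 ^ (i - j) :: real" and ?q = "4 ^ (t - Suc j) :: real"
  have q1: "1 \<le> ?q" by simp
  have "real (D * 2 ^ (i - j) * 4 ^ (t - Suc j)) < card (cand nb w j i v)"
    using ij(3) by (simp only: of_nat_less_iff)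
  also have "\<dots> \<le> 2 * (?p * deg w j v) + D / 2 * ?p"
    by (rule fail_upperD) (use assms(1) ij in auto)
  finally have "?p * (D * ?q) < ?p * (2 * deg w j v + D / 2)" by (simp add: algebra_simps)
  then have "D * ?q < 2 * deg w j v + D / 2" by simp
  moreover have "D / 2 \<le> D * ?q / 2" using mult_left_mono[OF q1, of D] by simp
  ultimately have "D * ?q / 4 \<le> deg w j v" by simp
  then have "D * ?q / 4 / 4 ^ (t - j) \<le> deg w j v / 4 ^ (t - j)" by (intro divide_right_mono) auto
  also have "\<dots> \<le> mem w t v" by (rule mem_ge_deg) (use ij in auto)
  also have "(4 :: real) ^ (t - j) = 4 * ?q"
    using ij by (metis Suc_diff_Suc le_less_trans power_Suc)
  finally show ?thesis by simp
qed

text \<open>The origin of \<open>16 * D * 8 ^ (t - j)\<close>. Not being stalled bounds earlier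
  degrees by \<open>3 * D * 4 ^ (t - Suc j)\<close>, and one more round at most doubles them. The
  tail bound turns \<open>6 * D * 4 ^ (t - j)\<close> into at most
  \<open>(12 + 1/2) * D * 8 ^ (t - j)\<close> candidates.\<close>

lemma no_overflow:
  assumes nf: "\<And>s. s \<le> t \<Longrightarrow> \<not> fail w s v" and ns: "\<not> stalled nb w t v"
  shows "\<not> overflow nb w t v"
proof -
  have deg_j: "deg w j v \<le> 3 * D * 4 ^ (t - Suc j)" if "j < t" for j
  proof -
    have q1: "1 \<le> (4 :: real) ^ (t - Suc j)" by simp
    have "card (cand nb w j j v) \<le> D * 4 ^ (t - Suc j)"
      using ns that unfolding stalled_of_def by (metis diff_self_eq_0 le_refl mult.right_neutral not_le power_0)
    then have "real (card (cand nb w j j v)) \<le> real (D * 4 ^ (t - Suc j))" by (rule of_nat_mono)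
    moreover have "deg w j v / 2 - D / 2 \<le> card (cand nb w j j v)"
      using nf[of j] that unfolding fail_def by auto
    ultimately have "deg w j v \<le> 2 * (D * 4 ^ (t - Suc j)) + D" by simp
    also have "\<dots> \<le> 3 * D * 4 ^ (t - Suc j)" using mult_left_mono[OF q1, of D] by simp
    finally show ?thesis .
  qed
  have "card (cand nb w j t v) \<le> 16 * D * 8 ^ (t - j)" if j: "j \<le> t" for j
  proof -
    have D1: "1 \<le> real D" using D_pos by simp
    have d6: "deg w j v \<le> 6 * D * 4 ^ (t - j)"
    proof (cases "j < t")
      case True
      have "deg w j v \<le> 3 * D * 4 ^ (t - Suc j)" by (rule deg_j[OF True])
      also have "\<dots> \<le> 6 * D * 4 ^ (t - j)" by (intro of_nat_mono mult_mono power_increasing) auto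
      finally show ?thesis .
    next
      case False
      then have [simp]: "j = t" using j by simp
      show ?thesis
      proof (cases t)
        case 0
        then show ?thesis using deg_0_le[of w v] D1 by simp
      next
        case (Suc s)
        then show ?thesis using deg_Suc_le[of w s v] deg_j[of s] by simp
      qed
    qed
    have "real (card (cand nb w j t v)) \<le> 2 * (2 ^ (t - j) * deg w j v) + D / 2 * 2 ^ (t - j)"
      by (rule fail_upperD) (use nf j in auto)
    also have "\<dots> \<le> 2 * (2 ^ (t - j) * (6 * D * 4 ^ (t - j))) + D / 2 * (2 ^ (t - j) * 4 ^ (t - j))"
      using d6 by (intro add_mono mult_left_mono) auto
    also have "\<dots> = (12 * D + D / 2) * (2 ^ (t - j) * 4 ^ (t - j))" by (simp add: algebra_simps)
    also have "(2 :: real) ^ (t - j) * 4 ^ (t - j) = 8 ^ (t - j)" by (simp flip: power_mult_distrib)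
    also have "(12 * D + D / 2) * 8 ^ (t - j) \<le> real (16 * D * 8 ^ (t - j))" using D1 by simp
    finally show ?thesis by (simp only: of_nat_le_iff)
  qed
  then show ?thesis by (auto simp: overflow_of_def not_less)
qed

lemma marked_prob:
  assumes "e0 + t + 1 \<le> m"
  shows "Ev (geo m) (\<lambda>g. of_bool (marked w t u g)) = wt w t u"
proof (cases "st nb w t u")
  case (Alive e)
  then have "e \<le> m" using st_Alive_le assms by (meson order_trans)
  then show ?thesis using Alive by (simp add: marked_def wt_def Ev_geo_ge)
qed (auto simp: marked_def wt_def)

text \<open>Only an inequality, since natural subtraction cuts \<open>e - k\<close> off at
  0.\<close>

lemma marked_prob_shift:
  assumes "e0 + j + 1 \<le> m"
  shows "Ev (geo m) (\<lambda>g. of_bool (marked w j u (g + k))) \<le> 2 ^ k * wt w j u"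
proof (cases "st nb w j u")
  case (Alive e)
  then have em: "e \<le> m" using st_Alive_le assms by (meson order_trans)
  have "Ev (geo m) (\<lambda>g. of_bool (marked w j u (g + k))) = Ev (geo m) (\<lambda>g. of_bool (e - k \<le> g))"
    using Alive by (simp add: marked_def le_diff_conv)
  also have "\<dots> = 1 / 2 ^ (e - k)" by (rule Ev_geo_ge) (use em in simp)
  also have "\<dots> \<le> 2 ^ k / 2 ^ e"
  proof -
    have "(2 :: real) ^ e \<le> 2 ^ (k + (e - k))" by (rule power_increasing) auto
    then show ?thesis by (simp add: power_add field_simps)
  qed
  finally show ?thesis using Alive by (simp add: wt_def)
qed (auto simp: marked_def wt_def)

lemma row_marked_none:
  assumes "e0 + t + 1 \<le> m" "A \<subseteq> {..<n}"
  shows "Ev row (\<lambda>x. of_bool (\<forall>u\<in>A. \<not> marked w t u (x u))) = (\<Prod>u\<in>A. 1 - wt w t u)"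
proof -
  have fin: "finite A" using assms finite_subset by blast
  have "Ev row (\<lambda>x. of_bool (\<forall>u\<in>A. \<not> marked w t u (x u))) = Ev row (\<lambda>x. (1 + - 1) ^ card {u \<in> A. marked w t u (x u)})"
    using fin by (intro Ev_cong) (auto simp: power_0_left)
  also have "\<dots> = (\<Prod>u\<in>A. 1 + - 1 * wt w t u)"
    unfolding row_prod_of_bool[OF assms(2)] marked_prob[OF assms(1)] ..
  finally show ?thesis by simp
qed

text \<open>A union bound over \<open>t + 1\<close> upper deviations, whose slack is at least
  \<open>D / 2\<close>, and a single lower one.\<close>

lemma fail_prob:
  assumes "e0 + t + 1 \<le> m"
  shows "Ev row (\<lambda>x. of_bool (fail (w(t := x)) t u)) \<le> (real t + 2) * 2 powr (- (D / 2))"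
proof -
  let ?up = "\<lambda>j x. 2 * (2 ^ (t - j) * deg w j u) + D / 2 * 2 ^ (t - j) < card {y \<in> nb u. marked w j y (x y + (t - j))}"
  let ?lo = "\<lambda>x. real (card {y \<in> nb u. marked w t y (x y)}) < deg w t u / 2 - D / 2"
  have up: "Ev row (\<lambda>x. of_bool (?up j x)) \<le> 2 powr (- (D / 2))" if "j \<le> t" for j
  proof -
    have "Ev row (\<lambda>x. of_bool (?up j x)) \<le> 2 powr (- (D / 2 * 2 ^ (t - j)))"
    proof (rule row_count_upper[OF nb_sub])
      show "(\<Sum>y\<in>nb u. Ev (geo m) (\<lambda>g. of_bool (marked w j y (g + (t - j))))) \<le> 2 ^ (t - j) * deg w j u"
        unfolding deg_def sum_distrib_left by (intro sum_mono marked_prob_shift) (use assms that in auto)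
    qed
    also have "\<dots> \<le> 2 powr (- (D / 2))"
      using mult_left_mono[of 1 "2 ^ (t - j) :: real" "D / 2"] by (intro powr_mono) auto
    finally show ?thesis .
  qed
  have lo: "Ev row (\<lambda>x. of_bool (?lo x)) \<le> 2 powr (- (D / 2))"
    using row_count_lower[OF nb_sub[of u], where E = "marked w t" and a = "D / 2"]
    unfolding marked_prob[OF assms] deg_def by simp
  have "fail (w(t := x)) t u \<longleftrightarrow> (\<exists>j\<in>{..t}. ?up j x) \<or> ?lo x" for x
    unfolding fail_def by (simp add: cand_upd_same deg_upd Bex_def cong: conj_cong)
  then have "Ev row (\<lambda>x. of_bool (fail (w(t := x)) t u)) \<le> Ev row (\<lambda>x. of_bool (\<exists>j\<in>{..t}. ?up j x) + of_bool (?lo x))"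
    by (intro Ev_mono[OF finite_row]) (simp only: of_bool_disj_le)
  also have "\<dots> \<le> (\<Sum>j\<le>t. Ev row (\<lambda>x. of_bool (?up j x))) + Ev row (\<lambda>x. of_bool (?lo x))"
    unfolding Ev_add[OF finite_row] by (intro add_right_mono Ev_union_bound) simp
  also have "\<dots> \<le> (\<Sum>j\<le>t. 2 powr (- (D / 2))) + 2 powr (- (D / 2))"
    by (intro add_mono sum_mono lo up) auto
  also have "\<dots> = (real t + 2) * 2 powr (- (D / 2))" by (simp add: algebra_simps)
  finally show ?thesis .
qed

end

section \<open>The potential decreases in every round\<close>

text \<open>For negative \<open>z\<close> it follows from
  \<open>(1 + z + z^2) * (1 - z) = 1 - z^3 \<ge> 1\<close> and
  \<open>1 - z \<le> exp (- z)\<close>.\<close>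

lemma exp_le_quadratic:
  assumes "\<bar>z :: real\<bar> \<le> 1"
  shows "exp z \<le> 1 + z + z\<^sup>2"
proof (cases "0 \<le> z")
  case True
  then show ?thesis using exp_bound[of z] assms by auto
next
  case False
  have pos: "0 < 1 + z + z\<^sup>2"
    using False assms by (cases "z = -1") (auto simp: power2_eq_square intro: add_pos_nonneg)
  have "1 \<le> (1 + z + z\<^sup>2) * (1 - z)"
  proof -
    have "(1 + z + z\<^sup>2) * (1 - z) = 1 - z ^ 3" by (simp add: algebra_simps power2_eq_square power3_eq_cube)
    moreover have "z ^ 3 \<le> 0" using False unfolding power3_eq_cube by (intro mult_nonneg_nonpos) (auto simp: mult_nonpos_nonpos)
    ultimately show ?thesis by simp
  qed
  also have "\<dots> \<le> (1 + z + z\<^sup>2) * exp (- z)"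
    using pos exp_ge_add_one_self[of "- z"] by (intro mult_left_mono) auto
  finally show ?thesis by (simp add: exp_minus field_simps)
qed

context mis_graph
begin

text \<open>Such a node, once marked, faces fewer than 3 expected competitors; in the absence of
  failures it joins with constant probability.\<close>

definition light :: "coins \<Rightarrow> nat \<Rightarrow> nat \<Rightarrow> bool" where
  "light w t u \<longleftrightarrow> (\<exists>e. st nb w t u = Alive e) \<and> \<not> stalled nb w t u \<and> \<not> dominated nb w t u \<and> deg w t u < 3"

definition light_deg :: "coins \<Rightarrow> nat \<Rightarrow> nat \<Rightarrow> real" where
  "light_deg w t v = (\<Sum>u\<in>{u \<in> nb v. light w t u}. wt w t u)"

text \<open>Not the same as being \<open>Alive\<close>: a dominated node counts as decided even
  while it is still \<open>Alive\<close>.\<close>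

definition undecided :: "coins \<Rightarrow> nat \<Rightarrow> nat \<Rightarrow> bool" where
  "undecided w t v \<longleftrightarrow> st nb w t v \<noteq> In \<and> \<not> dominated nb w t v"

text \<open>Failures at neighbours matter as well: a neighbour can settle \<open>v\<close> by
  joining only if its own search does not overflow.\<close>

definition clean :: "coins \<Rightarrow> nat \<Rightarrow> nat \<Rightarrow> bool" where
  "clean w t v \<longleftrightarrow> (\<forall>s<t. \<forall>u\<in>insert v (nb v). \<not> fail w s u)"

definition good :: "coins \<Rightarrow> nat \<Rightarrow> nat \<Rightarrow> bool" where
  "good w t v \<longleftrightarrow> undecided w (Suc t) v \<and> (\<forall>u\<in>insert v (nb v). \<not> fail w t u)"

lemma undecided_Alive: "undecided w t v \<Longrightarrow> \<exists>e. st nb w t v = Alive e"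
  using st_Out_dominated by (cases "st nb w t v") (auto simp: undecided_def)

lemma undecided_SucD: "undecided w (Suc t) v \<Longrightarrow> undecided w t v"
  unfolding undecided_def by (auto simp: st_In_Suc_iff intro: dominated_mono)

lemma wt_Suc_half:
  assumes "act nb w t u \<noteq> Free"
  shows "wt w (Suc t) u \<le> wt w t u / 2"
  using assms by (cases "st nb w t u"; cases "act nb w t u") (auto simp: wt_def st_Suc)

text \<open>If \<open>3 \<le> deg w t u\<close>, silence has probability at most
  \<open>exp (- 3) \<le> 1 / 15\<close>. The weight at most doubles then and at least halves
  otherwise, which gives \<open>1/2 + 3/2 * 1/15 = 0.6\<close>.\<close>

lemma Ev_wt_Suc:
  assumes t: "e0 + t + 1 \<le> m" and "\<not> light w t u"
  shows "Ev row (\<lambda>x. wt (w(t := x)) (Suc t) u) \<le> 0.6 * wt w t u"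
proof -
  have const: ?thesis if "\<And>x. wt (w(t := x)) (Suc t) u \<le> 0.6 * wt w t u"
  proof -
    have "Ev row (\<lambda>x. wt (w(t := x)) (Suc t) u) \<le> Ev row (\<lambda>x. 0.6 * wt w t u)"
      by (rule Ev_mono[OF finite_row]) (rule that)
    then show ?thesis by simp
  qed
  consider "\<not> (\<exists>e. st nb w t u = Alive e)" | "stalled nb w t u \<or> dominated nb w t u" | "3 \<le> deg w t u"
    using assms(2) by (auto simp: light_def)
  then show ?thesis
  proof cases
    case 1
    then have "wt w t u = 0" by (auto simp: wt_def split: node_state.splits)
    then show ?thesis using wt_Suc_le[of "w(t := x)" t u for x]
      by (intro const) (simp add: wt_upd)
  next
    case 2
    show ?thesis
    proof (rule const)
      fix x
      have "act nb (w(t := x)) t u \<noteq> Free"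
        using 2 by (auto simp: action_of_def stalled_upd dominated_upd)
      then have "wt (w(t := x)) (Suc t) u \<le> wt w t u / 2"
        using wt_Suc_half by (metis wt_upd order_refl)
      then show "wt (w(t := x)) (Suc t) u \<le> 0.6 * wt w t u" using wt_nonneg[of w t u] by simp
    qed
  next
    case 3
    let ?none = "\<lambda>x. \<forall>y\<in>nb u. \<not> marked w t y (x y)"
    have "Ev row (\<lambda>x. wt (w(t := x)) (Suc t) u) \<le> Ev row (\<lambda>x. wt w t u / 2 + 3 / 2 * wt w t u * of_bool (?none x))"
    proof (rule Ev_mono[OF finite_row])
      fix x
      show "wt (w(t := x)) (Suc t) u \<le> wt w t u / 2 + 3 / 2 * wt w t u * of_bool (?none x)"
      proof (cases "?none x")
        case True
        then show ?thesis using wt_Suc_le[of "w(t := x)" t u] by (simp add: wt_upd)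
      next
        case False
        then have "act nb (w(t := x)) t u \<noteq> Free" by (auto simp: act_Free cand_upd_now)
        then have "wt (w(t := x)) (Suc t) u \<le> wt w t u / 2"
          using wt_Suc_half by (metis wt_upd order_refl)
        moreover have "(of_bool (?none x) :: real) = 0" using False by (simp only: of_bool_eq)
        ultimately show ?thesis by (simp only: mult_zero_right add_0_right)
      qed
    qed
    also have "\<dots> = wt w t u / 2 + 3 / 2 * wt w t u * (\<Prod>y\<in>nb u. 1 - wt w t y)"
      by (simp only: row_linear row_marked_none[OF t nb_sub])
    finally have le: "Ev row (\<lambda>x. wt (w(t := x)) (Suc t) u) \<le> wt w t u / 2 + 3 / 2 * wt w t u * (\<Prod>y\<in>nb u. 1 - wt w t y)" .
    have "(\<Prod>y\<in>nb u. 1 - wt w t y) \<le> 1 / 15"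
    proof -
      have "(\<Prod>y\<in>nb u. 1 + - wt w t y) \<le> exp (\<Sum>y\<in>nb u. - wt w t y)"
        using wt_le_half by (intro prod_one_plus_le_exp) (smt (verit) field_sum_of_halves)
      also have "\<dots> \<le> exp (- 3)" using 3 by (simp add: deg_def sum_negf)
      also have "\<dots> \<le> 1 / 15"
      proof -
        have "(5 / 2) ^ 3 \<le> exp (1 :: real) ^ 3"
          using exp_lower_Taylor_quadratic[of 1] by (intro power_mono) auto
        also have "\<dots> = exp 3" by (simp flip: exp_of_nat_mult)
        finally show ?thesis by (simp add: exp_minus field_simps power3_eq_cube)
      qed
      finally show ?thesis by simp
    qed
    then have "3 / 2 * wt w t u * (\<Prod>y\<in>nb u. 1 - wt w t y) \<le> 3 / 2 * wt w t u * (1 / 15)"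
      by (rule mult_left_mono) (simp add: wt_nonneg)
    then show ?thesis using le by simp
  qed
qed

lemma Ev_deg_Suc:
  assumes t: "e0 + t + 1 \<le> m"
  shows "Ev row (\<lambda>x. deg (w(t := x)) (Suc t) v) \<le> 0.6 * deg w t v + 1.4 * light_deg w t v"
proof -
  have "Ev row (\<lambda>x. deg (w(t := x)) (Suc t) v) = (\<Sum>u\<in>nb v. Ev row (\<lambda>x. wt (w(t := x)) (Suc t) u))"
    unfolding deg_def by (rule Ev_sum[OF finite_row])
  also have "\<dots> \<le> (\<Sum>u\<in>nb v. 0.6 * wt w t u + 1.4 * (if light w t u then wt w t u else 0))"
  proof (rule sum_mono)
    fix u
    show "Ev row (\<lambda>x. wt (w(t := x)) (Suc t) u) \<le> 0.6 * wt w t u + 1.4 * (if light w t u then wt w t u else 0)"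
    proof (cases "light w t u")
      case True
      have "Ev row (\<lambda>x. wt (w(t := x)) (Suc t) u) \<le> Ev row (\<lambda>x. 2 * wt w t u)"
        using wt_Suc_le[of "w(t := x)" t u for x] by (intro Ev_mono) (auto simp: wt_upd)
      then show ?thesis using True by simp
    qed (use Ev_wt_Suc[OF t] in simp)
  qed
  also have "\<dots> = 0.6 * deg w t v + 1.4 * light_deg w t v"
    by (simp only: deg_def light_deg_def sum.distrib sum_distrib_left sum.inter_filter[OF finite_nb])
  finally show ?thesis .
qed

text \<open>The node \<open>v\<close> gets dominated if some \<open>u\<close> in \<open>A\<close> is
  marked alone among \<open>A\<close> and its own neighbours. These events are disjoint, and each
  has probability at least \<open>wt w t u * 4 powr (- 4)\<close>, because the competing weight is
  at most 1 + 3.\<close>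

lemma golden_round:
  assumes t: "e0 + t + 1 \<le> m" and clean: "clean w t v" and light: "\<kappa> \<le> light_deg w t v"
    and \<kappa>: "0 \<le> \<kappa>" "\<kappa> \<le> 1 / 2"
  shows "Ev row (\<lambda>x. of_bool (good (w(t := x)) t v)) \<le> 1 - \<kappa> / 256"
proof -
  \<comment> \<open>Trimming the light neighbours to total weight at most 1 keeps the competition
    inside \<open>A\<close> bounded.\<close>
  obtain A where A: "A \<subseteq> {u \<in> nb v. light w t u}" "\<kappa> \<le> (\<Sum>u\<in>A. wt w t u)" "(\<Sum>u\<in>A. wt w t u) \<le> \<kappa> + 1 / 2"
    using subset_sum_between[of "{u \<in> nb v. light w t u}" "wt w t" "1/2" \<kappa>] light \<kappa> wt_nonneg wt_le_half
    unfolding light_deg_def by auto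
  have finA: "finite A" using A(1) finite_subset[OF _ finite_nb[of v]] by auto
  have An: "A \<subseteq> {..<n}" using A(1) nb_sub by blast
  define B where "B u = (A \<union> nb u) - {u}" for u
  let ?none = "\<lambda>C x. \<forall>y\<in>C. \<not> marked w t y (x y)"
  let ?alone = "\<lambda>u x. marked w t u (x u) \<and> ?none (B u) x"
  have finB: "finite (B u)" for u using finA by (simp add: B_def)
  have Bn: "B u \<subseteq> {..<n}" for u using An nb_sub by (auto simp: B_def)
  have alone: "wt w t u / 256 \<le> Ev row (\<lambda>x. of_bool (?alone u x))" if "u \<in> A" for u
  proof -
    have un: "insert u (B u) \<subseteq> {..<n}" using Bn that An by blast
    have "Ev row (\<lambda>x. of_bool (?none (B u) x)) =
      Ev row (\<lambda>x. of_bool (?alone u x) + of_bool (?none (insert u (B u)) x))"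
      by (intro Ev_cong) auto
    then have "Ev row (\<lambda>x. of_bool (?alone u x)) =
      Ev row (\<lambda>x. of_bool (?none (B u) x)) - Ev row (\<lambda>x. of_bool (?none (insert u (B u)) x))"
      by (simp add: Ev_add)
    also have "\<dots> = wt w t u * (\<Prod>y\<in>B u. 1 - wt w t y)"
    proof -
      have "(\<Prod>y\<in>insert u (B u). 1 - wt w t y) = (1 - wt w t u) * (\<Prod>y\<in>B u. 1 - wt w t y)"
        by (rule prod.insert[OF finB]) (simp add: B_def)
      then show ?thesis
        unfolding row_marked_none[OF t Bn] row_marked_none[OF t un] by (simp add: left_diff_distrib)
    qed
    finally have eq: "Ev row (\<lambda>x. of_bool (?alone u x)) = wt w t u * (\<Prod>y\<in>B u. 1 - wt w t y)" .
    have "(\<Sum>y\<in>B u. wt w t y) \<le> (\<Sum>y\<in>A \<union> nb u. wt w t y)"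
      using finA by (intro sum_mono2) (auto simp: B_def wt_nonneg)
    also have "\<dots> \<le> (\<Sum>y\<in>A. wt w t y) + (\<Sum>y\<in>nb u. wt w t y)"
      using sum.union_inter[OF finA finite_nb, of "wt w t" u] sum_nonneg[of "A \<inter> nb u" "wt w t"]
      by (simp add: wt_nonneg)
    also have "\<dots> \<le> 4"
    proof -
      have "deg w t u < 3" using that A(1) by (auto simp: light_def)
      then show ?thesis using A(3) \<kappa> by (simp add: deg_def)
    qed
    finally have "4 powr (- 4) \<le> (4 :: real) powr (- (\<Sum>y\<in>B u. wt w t y))" by simp
    also have "\<dots> \<le> (\<Prod>y\<in>B u. 1 - wt w t y)"
      by (rule prod_one_minus_ge[OF finB]) (use wt_nonneg wt_le_half in auto)
    finally have "1 / 256 \<le> (\<Prod>y\<in>B u. 1 - wt w t y)" by (simp add: powr_minus powr_numeral)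
    then show ?thesis unfolding eq using mult_left_mono[OF _ wt_nonneg[of w t u]] by fastforce
  qed
  have "Ev row (\<lambda>x. of_bool (good (w(t := x)) t v)) \<le> Ev row (\<lambda>x. 1 + (- 1) * (\<Sum>u\<in>A. of_bool (?alone u x)))"
  proof (rule Ev_mono[OF finite_row])
    fix x
    show "of_bool (good (w(t := x)) t v) \<le> 1 + (- 1) * (\<Sum>u\<in>A. of_bool (?alone u x) :: real)"
    proof (cases "\<exists>u\<in>A. ?alone u x")
      case False
      then have "(\<Sum>u\<in>A. of_bool (?alone u x) :: real) = 0" by (intro sum.neutral) auto
      then show ?thesis by simp
    next
      case True
      then obtain u where u: "u \<in> A" "?alone u x" by blast
      have "(\<Sum>u'\<in>A. of_bool (?alone u' x) :: real) = (\<Sum>u'\<in>A. if u' = u then 1 else 0)"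
        using u by (intro sum.cong) (auto simp: B_def)
      also have "\<dots> = 1" using finA u by simp
      finally have "(\<Sum>u'\<in>A. of_bool (?alone u' x) :: real) = 1" .
      moreover have "\<not> good (w(t := x)) t v"
      proof
        assume g: "good (w(t := x)) t v"
        let ?w = "w(t := x)"
        have uv: "u \<in> nb v" and lu: "light w t u" using u A(1) by auto
        \<comment> \<open>\<open>clean\<close> excludes failures at \<open>u\<close> in earlier
          rounds and \<open>good\<close> in round \<open>t\<close>; hence no overflow holds
          \<open>u\<close> back.\<close>
        have nf: "\<not> fail ?w s u" if "s \<le> t" for s
          using that clean g uv by (cases "s < t") (auto simp: clean_def good_def fail_upd)
        have ns: "\<not> stalled nb ?w t u" using lu by (simp add: light_def stalled_upd)
        have "\<not> overflow nb ?w t u" by (rule no_overflow[OF nf ns])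
        moreover have "cand nb ?w t t u = {}"
          using u nb_irrefl[of u] by (auto simp: cand_upd_now B_def)
        ultimately have "act nb ?w t u = Free"
          using ns lu by (auto simp: act_Free light_def dominated_upd)
        moreover have "\<exists>e. st nb ?w t u = Alive e \<and> e \<le> ?w t u"
          using u by (auto simp: marked_def st_upd)
        ultimately have "st nb ?w (Suc t) u = In" by (auto simp: st_In_Suc_iff)
        then show False using g uv by (auto simp: good_def undecided_def dominated_of_def)
      qed
      ultimately show ?thesis by simp
    qed
  qed
  also have "\<dots> = 1 - (\<Sum>u\<in>A. Ev row (\<lambda>x. of_bool (?alone u x)))"
    by (simp only: Ev_add[OF finite_row] Ev_cmult Ev_sum[OF finite_row] Ev_const)
  also have "\<dots> \<le> 1 - (\<Sum>u\<in>A. wt w t u / 256)"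
    by (intro diff_left_mono sum_mono alone)
  also have "\<dots> \<le> 1 - \<kappa> / 256"
    using A(2) by (simp flip: sum_divide_distrib)
  finally show ?thesis .
qed

definition expo :: "coins \<Rightarrow> nat \<Rightarrow> nat \<Rightarrow> real" where
  "expo w t v = (case st nb w t v of Alive e \<Rightarrow> real e | _ \<Rightarrow> 0)"

text \<open>
  The factor 30 makes the loss in the second summand outweigh the gain in the first one when a node
  with a large \<open>mem\<close> halves its marking probability. The offset \<open>1 / 100\<close> separates the nodes that
  almost surely have no marked neighbour; for those the exponent itself drops.
\<close>

definition pot :: "coins \<Rightarrow> nat \<Rightarrow> nat \<Rightarrow> real" where
  "pot w t v = ln 2 * expo w t v + 30 * ln (1 / 100 + mem w t v)"

lemma expo_diff:
  assumes "undecided w (Suc t) v"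
  shows "\<bar>expo w (Suc t) v - expo w t v\<bar> \<le> 1"
proof -
  obtain e e' where e: "st nb w t v = Alive e" "st nb w (Suc t) v = Alive e'"
    using undecided_Alive[OF assms] undecided_Alive[OF undecided_SucD[OF assms]] by blast
  then show ?thesis
    using next_state_Alive_le[of "act nb w t v" "w t v" e e'] by (auto simp: expo_def st_Suc)
qed

lemma mem_Suc_bounds: "mem w t v / 4 \<le> mem w (Suc t) v" "mem w (Suc t) v \<le> 9 / 4 * mem w t v"
  using deg_Suc_le[of w t v] deg_le_mem[of w t v] deg_nonneg[of w "Suc t" v] by auto

lemma ln_ratio_le:
  "ln (1 / 100 + mem w (Suc t) v) - ln (1 / 100 + mem w t v)
     \<le> (1 / 100 + mem w (Suc t) v) / (1 / 100 + mem w t v) - 1"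
proof -
  have pos: "0 < 1 / 100 + mem w s v" for s using mem_nonneg[of w s v] by linarith
  have "ln ((1 / 100 + mem w (Suc t) v) / (1 / 100 + mem w t v)) =
    ln (1 / 100 + mem w (Suc t) v) - ln (1 / 100 + mem w t v)"
    by (rule ln_divide_pos[OF pos pos])
  then show ?thesis
    using ln_le_minus_one[OF divide_pos_pos[OF pos[of "Suc t"] pos[of t]]] by simp
qed

text \<open>The argument of the logarithm changes by a factor between 1/4 and 4, so the total change
  is at most \<open>61 * ln 2\<close>.\<close>

lemma pot_diff_bound:
  assumes "undecided w (Suc t) v"
  shows "\<bar>pot w (Suc t) v - pot w t v\<bar> \<le> 50"
proof -
  let ?x = "1 / 100 + mem w t v" and ?x' = "1 / 100 + mem w (Suc t) v"
  have pos: "0 < 1 / 100 + mem w s v" for s using mem_nonneg[of w s v] by linarith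
  have "?x / 4 \<le> ?x'" using mem_Suc_bounds[of w t v] by simp
  then have "ln (?x / 4) \<le> ln ?x'" using pos[of t] pos[of "Suc t"] by (subst ln_le_cancel_iff) auto
  moreover have "ln (?x / 4) = ln ?x - 2 * ln 2"
    using pos[of t] by (simp add: ln_div ln_realpow[of 2 2, simplified])
  moreover have "ln ?x' \<le> ln (4 * ?x)"
    using pos[of t] pos[of "Suc t"] mem_Suc_bounds[of w t v] mem_nonneg[of w t v] by (subst ln_le_cancel_iff) auto
  moreover have "ln (4 * ?x) = 2 * ln 2 + ln ?x"
    using pos[of t] by (subst ln_mult) (auto simp: ln_realpow[of 2 2, simplified])
  ultimately have "\<bar>ln ?x' - ln ?x\<bar> \<le> 2 * ln 2" by linarith
  moreover have "\<bar>ln 2 * (expo w (Suc t) v - expo w t v)\<bar> \<le> ln 2 * 1"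
    unfolding abs_mult using expo_diff[OF assms] by (intro mult_mono) auto
  ultimately show ?thesis
    using ln2_le_25_over_36 unfolding pot_def by (simp add: algebra_simps abs_le_iff)
qed

text \<open>
  The value of \<open>\<alpha>\<close> is dictated by the golden rounds: there \<open>exp (50 * \<alpha>)\<close> must be compensated by the
  probability \<open>1 / (28000 * 256)\<close> of being dominated.
\<close>

definition \<alpha> :: real where "\<alpha> = 1 / (28000 * 51200)"

text \<open>If light neighbours abound, the chance of domination outweighs any growth of the
  potential. If the exponent is 1 and the neighbourhood nearly silent, \<open>v\<close> itself joins
  often enough. Otherwise a drift of \<open>- 1 / 2\<close> suffices, because the error of
  linearizing \<open>exp\<close> is of second order in \<alpha>.\<close>

lemma row_step:
  assumes t: "e0 + t + 1 \<le> m" and v: "v < n" and clean: "clean w t v" and und: "undecided w t v"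
  shows "Ev row (\<lambda>x. of_bool (good (w(t := x)) t v) * exp (\<alpha> * (pot (w(t := x)) (Suc t) v - pot w t v))) \<le> 1 - \<alpha> / 4"
    (is "Ev row ?F \<le> _")
proof -
  let ?w = "\<lambda>x. w(t := x)"
  let ?Y = "\<lambda>x. pot (?w x) (Suc t) v - pot w t v"
  have pot_upd: "pot (?w x) t v = pot w t v" for x by (simp add: pot_def expo_def st_upd mem_upd)
  have expo_upd: "expo (?w x) t v = expo w t v" for x by (simp add: expo_def st_upd)
  have \<alpha>0: "0 < \<alpha>" and \<alpha>50: "\<alpha> * 50 \<le> 1 / 100" by (simp_all add: \<alpha>_def)
  have Y50: "\<bar>?Y x\<bar> \<le> 50" if "good (?w x) t v" for x
    using pot_diff_bound[of "?w x" t v] that by (simp add: good_def pot_upd)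
  have expY: "exp (\<alpha> * ?Y x) \<le> exp (\<alpha> * 50)" if "good (?w x) t v" for x
    using Y50[OF that] \<alpha>0 by (auto simp: abs_le_iff)
  have e50: "exp (\<alpha> * 50) \<le> 1 + 100 * \<alpha>"
  proof -
    have "exp (\<alpha> * 50) \<le> 1 + \<alpha> * 50 + (\<alpha> * 50)\<^sup>2" by (rule exp_le_quadratic) (simp add: \<alpha>_def)
    also have "\<dots> \<le> 1 + 100 * \<alpha>" by (simp add: \<alpha>_def power2_eq_square)
    finally show ?thesis .
  qed
  define M where "M = mem w t v"
  have M0: "0 \<le> M" and dM: "deg w t v \<le> M" by (simp_all add: M_def mem_nonneg deg_le_mem)
  show ?thesis
  proof (cases "1 / 28000 \<le> light_deg w t v")
    case True
    have "Ev row ?F \<le> Ev row (\<lambda>x. exp (\<alpha> * 50) * of_bool (good (?w x) t v))"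
      by (rule Ev_mono[OF finite_row]) (use expY in auto)
    also have "\<dots> = exp (\<alpha> * 50) * Ev row (\<lambda>x. of_bool (good (?w x) t v))" by (rule Ev_cmult)
    \<comment> \<open>\<open>100 * \<alpha>\<close> is half of
      \<open>1 / (28000 * 256)\<close>.\<close>
    also have "\<dots> \<le> (1 + 100 * \<alpha>) * (1 - 1 / 28000 / 256)"
      by (intro mult_mono e50 golden_round[OF t clean True]) (auto simp: \<alpha>_def Ev_of_bool_bounds)
    also have "\<dots> \<le> 1 - \<alpha> / 4" by (simp add: \<alpha>_def)
    finally show ?thesis .
  next
    case False
    define mem' where "mem' x = deg (?w x) (Suc t) v + M / 4" for x
    have mem'_eq: "mem (?w x) (Suc t) v = mem' x" for x
      by (simp add: mem'_def M_def mem_upd)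
    have mem'0: "0 \<le> mem' x" for x using deg_nonneg[of "?w x" "Suc t" v] M0 by (simp add: mem'_def)
    \<comment> \<open>Of \<open>M\<close>, the share 0.6 remains through the degrees and 0.25
      through the discount. The threshold 28000 makes the light part
      \<open>1.4 / 28000 = 0.00005\<close>.\<close>
    have Emem: "Ev row (\<lambda>x. mem' x) \<le> 0.85 * M + 0.00005"
    proof -
      have "Ev row (\<lambda>x. mem' x) = Ev row (\<lambda>x. deg (?w x) (Suc t) v) + M / 4"
        unfolding mem'_def by (simp only: Ev_add[OF finite_row] Ev_const)
      also have "\<dots> \<le> 0.6 * deg w t v + 1.4 * light_deg w t v + M / 4"
        using Ev_deg_Suc[OF t] by (rule add_right_mono)
      finally show ?thesis using dM False by simp
    qed
    have pos: "0 < 1 / 100 + M" using M0 by simp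
    define r where "r x = (1 / 100 + mem' x) / (1 / 100 + M) - 1" for x
    have r_ge: "- 1 \<le> r x" for x using mem'0[of x] pos by (simp add: r_def)
    have Er: "Ev row r = (1 / 100 + Ev row mem') / (1 / 100 + M) - 1"
    proof -
      have "Ev row r = Ev row (\<lambda>x. (1 / (1 / 100 + M)) * (1 / 100 + mem' x) + - 1)"
        by (intro Ev_cong) (simp add: r_def)
      also have "\<dots> = (1 / (1 / 100 + M)) * (1 / 100 + Ev row mem') + - 1"
        by (simp only: row_linear)
      finally show ?thesis by simp
    qed
    have Y_le: "?Y x \<le> ln 2 * (expo (?w x) (Suc t) v - expo w t v) + 30 * r x" for x
    proof -
      have "ln (1 / 100 + mem' x) - ln (1 / 100 + M) \<le> r x"
        using ln_ratio_le[of "?w x" t v] unfolding mem'_eq mem_upd[OF order_refl] r_def M_def .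
      moreover have "?Y x = ln 2 * (expo (?w x) (Suc t) v - expo w t v) + 30 * (ln (1 / 100 + mem' x) - ln (1 / 100 + M))"
        unfolding pot_def mem'_eq M_def by (simp only: right_diff_distrib)
      ultimately show ?thesis by (simp only: add_left_mono mult_left_mono)
    qed
    \<comment> \<open>The bound \<open>- 100 \<le> Z x\<close> keeps the linear majorant nonnegative
      where \<open>good\<close> fails.\<close>
    have linear: "Ev row ?F \<le> 1 - \<alpha> / 4"
      if Z: "\<And>x. good (?w x) t v \<Longrightarrow> ?Y x \<le> Z x" and Zge: "\<And>x. - 100 \<le> Z x" and EZ: "Ev row Z \<le> - 1 / 2" for Z
    proof -
      have "Ev row ?F \<le> Ev row (\<lambda>x. (1 + 2500 * \<alpha>\<^sup>2) + \<alpha> * Z x)"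
      proof (rule Ev_mono[OF finite_row])
        fix x
        show "?F x \<le> (1 + 2500 * \<alpha>\<^sup>2) + \<alpha> * Z x"
        proof (cases "good (?w x) t v")
          case True
          have a: "\<bar>\<alpha> * ?Y x\<bar> \<le> \<alpha> * 50"
            unfolding abs_mult using Y50[OF True] \<alpha>0 by (intro mult_mono) auto
          have "?F x \<le> 1 + \<alpha> * ?Y x + (\<alpha> * ?Y x)\<^sup>2"
            using True exp_le_quadratic[of "\<alpha> * ?Y x"] a \<alpha>50 by simp
          also have "(\<alpha> * ?Y x)\<^sup>2 \<le> (\<alpha> * 50)\<^sup>2"
            using a \<alpha>0 by (metis abs_ge_zero power2_abs power_mono)
          also have "\<alpha> * ?Y x \<le> \<alpha> * Z x" using Z[OF True] \<alpha>0 by (intro mult_left_mono) auto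
          finally show ?thesis by (simp add: power_mult_distrib)
        next
          case False
          have "- 100 * \<alpha> \<le> \<alpha> * Z x" using mult_left_mono[OF Zge[of x], of \<alpha>] \<alpha>0 by simp
          moreover have "100 * \<alpha> \<le> 1" by (simp add: \<alpha>_def)
          moreover have "0 \<le> 2500 * \<alpha>\<^sup>2" by simp
          ultimately have "0 \<le> (1 + 2500 * \<alpha>\<^sup>2) + \<alpha> * Z x" by linarith
          then show ?thesis using False by simp
        qed
      qed
      also have "\<dots> = (1 + 2500 * \<alpha>\<^sup>2) + \<alpha> * Ev row Z"
        by (simp only: row_linear)
      also have "\<dots> \<le> (1 + 2500 * \<alpha>\<^sup>2) + \<alpha> * (- 1 / 2)"
        using EZ \<alpha>0 by (intro add_left_mono mult_left_mono) auto
      also have "\<dots> \<le> 1 - \<alpha> / 4" by (simp add: \<alpha>_def power2_eq_square)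
      finally show ?thesis .
    qed
    show ?thesis
    proof (cases "1 / 100 \<le> M")
      case True
      show ?thesis
      proof (rule linear[of "\<lambda>x. ln 2 + 30 * r x"])
        fix x assume "good (?w x) t v"
        then have "expo (?w x) (Suc t) v - expo w t v \<le> 1"
          using expo_diff[of "?w x" t v] by (simp add: good_def expo_upd abs_le_iff)
        then have "ln 2 * (expo (?w x) (Suc t) v - expo w t v) \<le> ln 2 * 1"
          by (intro mult_left_mono) auto
        then have "ln 2 * (expo (?w x) (Suc t) v - expo w t v) + 30 * r x \<le> ln 2 * 1 + 30 * r x"
          by (rule add_right_mono)
        from order_trans[OF Y_le this] show "?Y x \<le> ln 2 + 30 * r x" by (simp only: mult_1_right)
      next
        show "- 100 \<le> ln 2 + 30 * r x" for x
          using r_ge[of x] ln2_ge_two_thirds by linarith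
        \<comment> \<open>At \<open>M = 1 / 100\<close> the bound is
          \<open>- 0.00145 / 0.02\<close>, and it decreases as \<open>M\<close> grows.\<close>
        have "Ev row r \<le> - 0.07"
          unfolding Er using Emem True pos by (simp add: field_simps)
        moreover have "Ev row (\<lambda>x. ln 2 + 30 * r x) = ln 2 + 30 * Ev row r"
          by (simp only: row_linear)
        ultimately show "Ev row (\<lambda>x. ln 2 + 30 * r x) \<le> - 1 / 2"
          using ln2_le_25_over_36 by simp
      qed
    next
      case False
      then have M1: "M < 1 / 100" by simp
      let ?h = "\<lambda>x. \<exists>u\<in>nb v. marked w t u (x u)"
      have Eh: "Ev row (\<lambda>x. of_bool (?h x)) \<le> 1 / 100"
      proof -
        have "Ev row (\<lambda>x. of_bool (?h x)) \<le> (\<Sum>u\<in>nb v. Ev row (\<lambda>x. of_bool (marked w t u (x u))))"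
          by (rule Ev_union_bound) simp
        also have "\<dots> = (\<Sum>u\<in>nb v. Ev (geo m) (\<lambda>g. of_bool (marked w t u g)))"
          using nb_sub[of v] by (intro sum.cong refl row_component) auto
        also have "\<dots> = deg w t v" unfolding marked_prob[OF t] deg_def ..
        finally show ?thesis using dM M1 by simp
      qed
      \<comment> \<open>Stalling would force \<open>mem\<close> to be at least
        \<open>D / 16\<close>, which exceeds 1/100.\<close>
      have ns: "\<not> stalled nb w t v"
      proof
        assume "stalled nb w t v"
        then have "D / 16 \<le> mem w t v"
          using clean by (intro stalled_mem) (auto simp: clean_def)
        then show False using M1 D_pos by (simp add: M_def)
      qed
      obtain e where e: "st nb w t v = Alive e" using undecided_Alive[OF und] by blast
      have e1: "1 \<le> e" using st_Alive_ge1[OF e0_pos e] .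
      have step: "\<not> e \<le> x v \<and> st nb (?w x) (Suc t) v = Alive (max 1 (e - 1))"
        if g: "good (?w x) t v" and h: "\<not> ?h x" for x
      proof -
        have nf: "\<not> fail (?w x) s v" if "s \<le> t" for s
          using that clean g by (cases "s < t") (auto simp: clean_def good_def fail_upd)
        have ns': "\<not> stalled nb (?w x) t v" using ns by (simp add: stalled_upd)
        have "act nb (?w x) t v = Free"
          using no_overflow[OF nf ns'] ns' und h by (auto simp: act_Free cand_upd_now dominated_upd undecided_def)
        then have "st nb (?w x) (Suc t) v = (if e \<le> x v then In else Alive (max 1 (e - 1)))"
          by (simp add: st_Suc st_upd e)
        then show ?thesis using g by (auto simp: good_def undecided_def split: if_splits)
      qed
      show ?thesis
      proof (cases "e = 1")
        case True
        \<comment> \<open>The exponent cannot drop below 1. The gain comes from joining instead: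
          \<open>v\<close> is marked with probability 1/2 and joins unless a neighbour is marked or
          a failure interferes.\<close>
        have "Ev row ?F \<le> Ev row (\<lambda>x. exp (\<alpha> * 50) * (of_bool (?h x) + (1 + - 1 * of_bool (1 \<le> x v))))"
        proof (rule Ev_mono[OF finite_row])
          fix x
          show "?F x \<le> exp (\<alpha> * 50) * (of_bool (?h x) + (1 + - 1 * of_bool (1 \<le> x v)))"
          proof (cases "good (?w x) t v")
            case good: True
            have "?F x \<le> exp (\<alpha> * 50) * 1" using expY[OF good] good by simp
            also have "\<dots> \<le> exp (\<alpha> * 50) * (of_bool (?h x) + (1 + - 1 * of_bool (1 \<le> x v)))"
              using step[OF good] True by (intro mult_left_mono) (cases "?h x"; simp)+
            finally show ?thesis .
          qed simp
        qed
        also have "\<dots> = exp (\<alpha> * 50) * (Ev row (\<lambda>x. of_bool (?h x)) + (1 + - 1 * Ev (geo m) (\<lambda>g. of_bool (1 \<le> g))))"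
          by (simp only: row_linear row_component[OF v, of "\<lambda>g. of_bool (1 \<le> g)"])
        also have "Ev (geo m) (\<lambda>g. of_bool (1 \<le> g)) = 1 / 2 ^ 1" by (rule Ev_geo_ge) (use t in simp)
        also have "exp (\<alpha> * 50) * (Ev row (\<lambda>x. of_bool (?h x)) + (1 + - 1 * (1 / 2 ^ 1))) \<le> (1 + 100 * \<alpha>) * (1 / 100 + (1 + - 1 * (1 / 2 ^ 1)))"
          using Eh Ev_of_bool_bounds(1)[of row ?h] by (intro mult_mono[OF e50]) (simp_all add: \<alpha>_def)
        also have "\<dots> \<le> 1 - \<alpha> / 4" by (simp add: \<alpha>_def)
        finally show ?thesis .
      next
        case False
        show ?thesis
        proof (rule linear[of "\<lambda>x. (- ln 2 + 2 * ln 2 * of_bool (?h x)) + 30 * r x"])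
          fix x assume g: "good (?w x) t v"
          show "?Y x \<le> (- ln 2 + 2 * ln 2 * of_bool (?h x)) + 30 * r x"
          proof (cases "?h x")
            case True
            have "expo (?w x) (Suc t) v - expo w t v \<le> 1"
              using g expo_diff[of "?w x" t v] by (simp add: good_def expo_upd abs_le_iff)
            then have "ln 2 * (expo (?w x) (Suc t) v - expo w t v) \<le> ln 2 * 1"
              by (intro mult_left_mono) auto
            then have "ln 2 * (expo (?w x) (Suc t) v - expo w t v) + 30 * r x \<le> ln 2 * 1 + 30 * r x"
              by (rule add_right_mono)
            also have "\<dots> = (- ln 2 + 2 * ln 2 * of_bool (?h x)) + 30 * r x" using True by simp
            finally show ?thesis by (rule order_trans[OF Y_le])
          next
            case h: False
            have "expo (?w x) (Suc t) v - expo w t v = - 1"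
              using step[OF g h] e e1 False by (simp add: expo_def of_nat_diff)
            then show ?thesis using Y_le[of x] h by simp
          qed
        next
          show "- 100 \<le> (- ln 2 + 2 * ln 2 * of_bool (?h x)) + 30 * r x" for x
          proof -
            have "0 \<le> 2 * ln 2 * (of_bool (?h x) :: real)" by simp
            then show ?thesis using r_ge[of x] ln2_le_25_over_36 by linarith
          qed
          \<comment> \<open>The tightest estimate: \<open>0.98 * 2/3 - 30 * 0.005\<close> barely
            exceeds 1/2.\<close>
          have arith: "a \<le> - 1 / 2" if "a = (- l + p) + 30 * q" "p \<le> 2 * l * (1 / 100)" "q \<le> 0.005" "2 / 3 \<le> l"
            for a l p q :: real
            using that by simp
          show "Ev row (\<lambda>x. (- ln 2 + 2 * ln 2 * of_bool (?h x)) + 30 * r x) \<le> - 1 / 2"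
          proof (rule arith[OF _ _ _ ln2_ge_two_thirds])
            show "Ev row (\<lambda>x. (- ln 2 + 2 * ln 2 * of_bool (?h x)) + 30 * r x) =
              (- ln 2 + 2 * ln 2 * Ev row (\<lambda>x. of_bool (?h x))) + 30 * Ev row r"
              by (simp only: row_linear)
            show "2 * ln 2 * Ev row (\<lambda>x. of_bool (?h x)) \<le> 2 * ln 2 * (1 / 100)"
              using Eh by (intro mult_left_mono) auto
            show "Ev row r \<le> 0.005"
              unfolding Er using Emem M0 pos by (simp add: field_simps)
          qed
        qed
      qed
    qed
  qed
qed

end

section \<open>Independence of distant nodes\<close>

context mis_graph
begin

definition \<eta> :: "nat \<Rightarrow> real" where
  "\<eta> T = (real T + 2) * 2 powr (- (D / 2))"

text \<open>
  A supermartingale that ends above the indicator of being undecided; the last summand reserves the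
  probability of the failures still to come.
\<close>

definition U :: "nat \<Rightarrow> coins \<Rightarrow> nat \<Rightarrow> nat \<Rightarrow> real" where
  "U T w t v = (if clean w t v
     then of_bool (undecided w t v) * ((1 - \<alpha> / 4) ^ (T - t) * exp (\<alpha> * (pot w t v + 30 * ln 100)))
     else 1) + real (T - t) * ((real \<Delta> + 1) * \<eta> T)"

lemma \<eta>_nonneg: "0 \<le> \<eta> T"
  by (simp add: \<eta>_def)

lemma lambda_nonneg: "0 \<le> 1 - \<alpha> / 4"
  by (simp add: \<alpha>_def)

lemma U_nonneg: "0 \<le> U T w t v"
  using lambda_nonneg \<eta>_nonneg[of T] by (auto simp: U_def)

lemma clean_upd: "clean (w(t := x)) t v = clean w t v"
  by (auto simp: clean_def fail_upd)

lemma clean_Suc: "clean w (Suc t) v \<longleftrightarrow> clean w t v \<and> (\<forall>u\<in>insert v (nb v). \<not> fail w t u)"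
  by (auto simp: clean_def less_Suc_eq)

lemma undecided_upd: "undecided (w(t := x)) t v = undecided w t v"
  by (simp add: undecided_def st_upd dominated_upd)

lemma some_fail_prob:
  assumes t: "e0 + t + 1 \<le> m" and "t < T"
  shows "Ev row (\<lambda>x. of_bool (\<exists>u\<in>insert v (nb v). fail (w(t := x)) t u)) \<le> (real \<Delta> + 1) * \<eta> T"
proof -
  let ?N = "insert v (nb v)"
  have "Ev row (\<lambda>x. of_bool (\<exists>u\<in>?N. fail (w(t := x)) t u)) \<le> (\<Sum>u\<in>?N. Ev row (\<lambda>x. of_bool (fail (w(t := x)) t u)))"
    by (rule Ev_union_bound) simp
  also have "\<dots> \<le> (\<Sum>u\<in>?N. \<eta> T)"
  proof (rule sum_mono)
    fix u
    have "Ev row (\<lambda>x. of_bool (fail (w(t := x)) t u)) \<le> (real t + 2) * 2 powr (- (D / 2))"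
      by (rule fail_prob[OF t])
    also have "\<dots> \<le> \<eta> T"
      unfolding \<eta>_def using \<open>t < T\<close> by (intro mult_right_mono) auto
    finally show "Ev row (\<lambda>x. of_bool (fail (w(t := x)) t u)) \<le> \<eta> T" .
  qed
  also have "\<dots> = real (card ?N) * \<eta> T" by simp
  also have "\<dots> \<le> (real \<Delta> + 1) * \<eta> T"
  proof (rule mult_right_mono[OF _ \<eta>_nonneg])
    have "card ?N \<le> Suc (card (nb v))" by (rule card_insert_le_m1) auto
    then show "real (card ?N) \<le> real \<Delta> + 1" using nb_card[of v] by linarith
  qed
  finally show ?thesis .
qed

text \<open>Survival contributes the factor \<open>1 - \<alpha> / 4\<close> by which the power in
  \<open>U\<close> grows as \<open>T - t\<close> shrinks; a failure lifts the first summand to 1 and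
  is paid by one of the reserved terms.\<close>

lemma U_step:
  assumes T: "e0 + T \<le> m" and t: "t < T" and v: "v < n"
  shows "Ev row (\<lambda>x. U T (w(t := x)) (Suc t) v) \<le> U T w t v"
proof -
  let ?L = "1 - \<alpha> / 4" and ?r = "(real \<Delta> + 1) * \<eta> T"
  let ?bad = "\<lambda>x. \<exists>u\<in>insert v (nb v). fail (w(t := x)) t u"
  have t': "e0 + t + 1 \<le> m" using T t by simp
  have r0: "0 \<le> ?r" using \<eta>_nonneg[of T] by simp
  have Tt: "real (T - t) = real (T - Suc t) + 1" using t by simp
  show ?thesis
  proof (cases "clean w t v")
    case False
    then have "U T (w(t := x)) (Suc t) v = 1 + real (T - Suc t) * ?r" for x
      by (simp add: U_def clean_Suc clean_upd)
    then show ?thesis using False r0 by (simp add: U_def Tt algebra_simps)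
  next
    case clean: True
    let ?E = "exp (\<alpha> * (pot w t v + 30 * ln 100))"
    let ?K = "of_bool (undecided w t v) * (?L ^ (T - Suc t) * ?E)"
    let ?F = "\<lambda>x. of_bool (good (w(t := x)) t v) * exp (\<alpha> * (pot (w(t := x)) (Suc t) v - pot w t v))"
    have le: "U T (w(t := x)) (Suc t) v \<le>
      ?K * ?F x + (of_bool (?bad x) + real (T - Suc t) * ?r)" for x
    proof (cases "?bad x")
      case True
      have "0 \<le> ?K * ?F x"
        by (intro mult_nonneg_nonneg zero_le_power lambda_nonneg) simp_all
      moreover have "U T (w(t := x)) (Suc t) v = 1 + real (T - Suc t) * ?r"
      proof -
        have "\<not> clean (w(t := x)) (Suc t) v" using True by (auto simp: clean_Suc)
        then show ?thesis by (simp add: U_def)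
      qed
      moreover have "(of_bool (?bad x) :: real) = 1" using True by (simp only: of_bool_eq)
      ultimately show ?thesis by linarith
    next
      case False
      have cl: "clean (w(t := x)) (Suc t) v" using False clean by (simp add: clean_Suc clean_upd)
      show ?thesis
      proof (cases "undecided (w(t := x)) (Suc t) v")
        case True
        have "undecided w t v" using undecided_SucD[OF True] by (simp add: undecided_upd)
        moreover have "good (w(t := x)) t v" using True False by (auto simp: good_def)
        moreover have "exp (\<alpha> * (pot (w(t := x)) (Suc t) v + 30 * ln 100)) =
          ?E * exp (\<alpha> * (pot (w(t := x)) (Suc t) v - pot w t v))"
          by (simp add: algebra_simps flip: exp_add)
        ultimately have "U T (w(t := x)) (Suc t) v = ?K * ?F x + real (T - Suc t) * ?r"
          using cl True by (simp add: U_def)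
        then show ?thesis by simp
      next
        case und: False
        have "0 \<le> ?K * ?F x"
          by (intro mult_nonneg_nonneg zero_le_power lambda_nonneg) simp_all
        moreover have "U T (w(t := x)) (Suc t) v = real (T - Suc t) * ?r"
          using cl und by (simp add: U_def)
        moreover have "0 \<le> (of_bool (?bad x) :: real)" by simp
        ultimately show ?thesis by linarith
      qed
    qed
    have "Ev row (\<lambda>x. U T (w(t := x)) (Suc t) v) \<le>
      Ev row (\<lambda>x. ?K * ?F x + (of_bool (?bad x) + real (T - Suc t) * ?r))"
      by (rule Ev_mono[OF finite_row]) (rule le)
    also have "\<dots> = ?K * Ev row ?F + (Ev row (\<lambda>x. of_bool (?bad x)) + real (T - Suc t) * ?r)"
      by (simp only: row_linear)
    also have "\<dots> \<le> ?K * ?L + (?r + real (T - Suc t) * ?r)"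
    proof (intro add_mono order_refl some_fail_prob[OF t' t])
      show "?K * Ev row ?F \<le> ?K * ?L"
      proof (cases "undecided w t v")
        case True
        show ?thesis
          by (rule mult_left_mono[OF row_step[OF t' v clean True]])
             (intro mult_nonneg_nonneg zero_le_power lambda_nonneg; simp)
      qed simp
    qed
    also have "\<dots> = of_bool (undecided w t v) * (?L ^ Suc (T - Suc t) * ?E) + (real (T - Suc t) + 1) * ?r"
      by (simp add: algebra_simps)
    also have "Suc (T - Suc t) = T - t" using t by simp
    also have "of_bool (undecided w t v) * (?L ^ (T - t) * ?E) + (real (T - Suc t) + 1) * ?r = U T w t v"
      using clean by (simp add: U_def Tt)
    finally show ?thesis .
  qed
qed

text \<open>The coins of a round that influence the value of \<open>U\<close> at \<open>v\<close> after this round.\<close>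

definition near :: "nat \<Rightarrow> nat set" where
  "near v = insert v (nb v) \<union> (\<Union>u\<in>nb v. insert u (nb u))"

lemma local_eq:
  assumes "\<And>y. y \<in> insert u (nb u) \<Longrightarrow> x y = x' y"
  shows "st nb (w(t := x)) (Suc t) u = st nb (w(t := x')) (Suc t) u"
    and "fail (w(t := x)) t u = fail (w(t := x')) t u"
proof -
  have c: "cand nb (w(t := x)) j t u = cand nb (w(t := x')) j t u" if "j \<le> t" for j
    using that assms by (auto simp: cand_upd_same)
  have "overflow nb (w(t := x)) t u = overflow nb (w(t := x')) t u"
    unfolding overflow_of_def by (intro iff_exI conj_cong refl) (simp add: c)
  then have "act nb (w(t := x)) t u = act nb (w(t := x')) t u"
    using c[of t] by (simp add: action_of_def stalled_upd dominated_upd)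
  then show "st nb (w(t := x)) (Suc t) u = st nb (w(t := x')) (Suc t) u"
    using assms[of u] by (simp add: st_Suc st_upd)
  show "fail (w(t := x)) t u = fail (w(t := x')) t u"
    unfolding fail_def by (simp add: c deg_upd cong: conj_cong)
qed

text \<open>Two hops: \<open>pot\<close>, \<open>undecided\<close> and \<open>clean\<close> involve
  the new states and failures of the neighbours of \<open>v\<close>, and each of these reads the
  coins one hop further.\<close>

lemma U_depends: "depends_on (near v) (\<lambda>x. U T (w(t := x)) (Suc t) v)"
  unfolding depends_on_def
proof (intro allI impI)
  fix x x' :: "nat \<Rightarrow> nat"
  assume eq: "\<forall>i\<in>near v. x i = x' i"
  have st: "st nb (w(t := x)) (Suc t) u = st nb (w(t := x')) (Suc t) u"
    and fl: "fail (w(t := x)) t u = fail (w(t := x')) t u" if "u \<in> insert v (nb v)" for u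
    by (rule local_eq; use that eq in \<open>auto simp: near_def\<close>)+
  have "deg (w(t := x)) (Suc t) v = deg (w(t := x')) (Suc t) v"
    unfolding deg_def wt_def by (intro sum.cong refl) (simp add: st)
  then have "pot (w(t := x)) (Suc t) v = pot (w(t := x')) (Suc t) v"
    by (simp add: pot_def expo_def st mem_upd)
  moreover have "undecided (w(t := x)) (Suc t) v = undecided (w(t := x')) (Suc t) v"
    using st by (simp add: undecided_def dominated_of_def)
  moreover have "clean (w(t := x)) (Suc t) v = clean (w(t := x')) (Suc t) v"
    using fl by (simp add: clean_Suc clean_upd)
  ultimately show "U T (w(t := x)) (Suc t) v = U T (w(t := x')) (Suc t) v"
    by (simp add: U_def)
qed

definition coin_pmf :: "nat \<Rightarrow> coins pmf" where
  "coin_pmf T = Pi_pmf {..<T} (\<lambda>_. 0) (\<lambda>_. row)"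

lemma finite_coin_pmf [simp]: "finite (set_pmf (coin_pmf T))"
  unfolding coin_pmf_def by (rule finite_set_Pi_pmf) auto

lemma coin_resample:
  assumes "t < T"
  shows "Ev (coin_pmf T) f = Ev (coin_pmf T) (\<lambda>w. Ev row (\<lambda>x. f (w(t := x))))"
proof -
  have *: "(\<lambda>i. if i \<in> {t} then (if i = t then x else (\<lambda>_. 0)) else w i) = w(t := x)" for w :: coins and x
    by auto
  have "Ev (coin_pmf T) f = Ev (coin_pmf T) (\<lambda>w. Ev (Pi_pmf {t} (\<lambda>_. 0) (\<lambda>_. row)) (\<lambda>x. f (\<lambda>i. if i \<in> {t} then x i else w i)))"
    unfolding coin_pmf_def by (rule Ev_Pi_resample) (use assms in auto)
  then show ?thesis unfolding Pi_pmf_singleton Ev_map * .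
qed

text \<open>A bound for the initial value of \<open>U\<close>. In \<open>200 = 2 * 100\<close>, the
  2 bounds \<open>1 / 100 + mem\<close> at time 0 and the 100 is the offset in
  \<open>U\<close>.\<close>

definition \<epsilon> :: "nat \<Rightarrow> real" where
  "\<epsilon> T = (1 - \<alpha> / 4) ^ T * exp (\<alpha> * (ln 2 * real e0 + 30 * ln 200)) + real T * ((real \<Delta> + 1) * \<eta> T)"

lemma U_0: "U T w 0 v \<le> \<epsilon> T"
proof -
  have "ln (1 / 100 + mem w 0 v) \<le> ln 2"
    using deg_0_le[of w v] mem_nonneg[of w 0 v] by (subst ln_le_cancel_iff) auto
  moreover have "ln (200 :: real) = ln 2 + ln 100" using ln_mult_pos[of 2 "100 :: real"] by simp
  ultimately have p: "pot w 0 v + 30 * ln 100 \<le> ln 2 * real e0 + 30 * ln 200"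
    unfolding pot_def by (simp add: expo_def)
  have "of_bool (undecided w 0 v) * ((1 - \<alpha> / 4) ^ T * exp (\<alpha> * (pot w 0 v + 30 * ln 100)))
    \<le> 1 * ((1 - \<alpha> / 4) ^ T * exp (\<alpha> * (ln 2 * real e0 + 30 * ln 200)))"
    using p by (intro mult_mono mult_nonneg_nonneg zero_le_power lambda_nonneg) (auto simp: \<alpha>_def)
  then show ?thesis by (simp add: U_def \<epsilon>_def clean_def)
qed

lemma U_T: "of_bool (undecided w T v) \<le> U T w T v"
proof (cases "clean w T v \<and> undecided w T v")
  case True
  have "0 \<le> expo w T v" by (auto simp: expo_def split: node_state.splits)
  moreover have "ln (1 / 100) \<le> ln (1 / 100 + mem w T v)"
    using mem_nonneg[of w T v] by (subst ln_le_cancel_iff) auto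
  moreover have "ln (1 / 100 :: real) = - ln 100" by (simp add: ln_div)
  ultimately have "0 \<le> pot w T v + 30 * ln 100"
    unfolding pot_def by (smt (verit) ln_gt_zero mult_nonneg_nonneg)
  then have "1 \<le> exp (\<alpha> * (pot w T v + 30 * ln 100))" by (simp add: \<alpha>_def)
  then show ?thesis using True by (simp add: U_def)
qed (auto simp: U_def)

text \<open>Given the past, disjoint sets \<open>near\<close> let the factors of the product of all
  \<open>U\<close> be averaged separately over the coins of one round, so \<open>U_step\<close>
  applies to each of them.\<close>

lemma undecided_prob:
  assumes S: "S \<subseteq> {..<n}" and disj: "\<And>u v. u \<in> S \<Longrightarrow> v \<in> S \<Longrightarrow> u \<noteq> v \<Longrightarrow> near u \<inter> near v = {}"
    and T: "e0 + T \<le> m"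
  shows "Ev (coin_pmf T) (\<lambda>w. of_bool (\<forall>v\<in>S. undecided w T v)) \<le> \<epsilon> T ^ card S"
proof -
  have finS: "finite S" using S finite_subset by blast
  have step: "Ev (coin_pmf T) (\<lambda>w. \<Prod>v\<in>S. U T w (Suc t) v) \<le> Ev (coin_pmf T) (\<lambda>w. \<Prod>v\<in>S. U T w t v)"
    if "t < T" for t
  proof -
    have "Ev (coin_pmf T) (\<lambda>w. \<Prod>v\<in>S. U T w (Suc t) v) =
      Ev (coin_pmf T) (\<lambda>w. Ev row (\<lambda>x. \<Prod>v\<in>S. U T (w(t := x)) (Suc t) v))"
      by (rule coin_resample[OF that])
    also have "\<dots> = Ev (coin_pmf T) (\<lambda>w. \<Prod>v\<in>S. Ev row (\<lambda>x. U T (w(t := x)) (Suc t) v))"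
      unfolding row_def
      by (intro Ev_cong Ev_indep_prod[where B = near]) (use finS disj in \<open>auto intro: U_depends\<close>)
    also have "\<dots> \<le> Ev (coin_pmf T) (\<lambda>w. \<Prod>v\<in>S. U T w t v)"
      by (intro Ev_mono prod_mono conjI Ev_nonneg U_nonneg U_step[OF T that]) (use S in auto)
    finally show ?thesis .
  qed
  have "t \<le> T \<Longrightarrow> Ev (coin_pmf T) (\<lambda>w. \<Prod>v\<in>S. U T w t v) \<le> Ev (coin_pmf T) (\<lambda>w. \<Prod>v\<in>S. U T w 0 v)" for t
  proof (induction t)
    case (Suc t)
    then show ?case using step[of t] by simp
  qed simp
  then have "Ev (coin_pmf T) (\<lambda>w. \<Prod>v\<in>S. U T w T v) \<le> Ev (coin_pmf T) (\<lambda>w. \<Prod>v\<in>S. U T w 0 v)" by simp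
  also have "\<dots> \<le> Ev (coin_pmf T) (\<lambda>w. \<Prod>v\<in>S. \<epsilon> T)"
    by (intro Ev_mono prod_mono conjI U_nonneg U_0) auto
  also have "\<dots> = \<epsilon> T ^ card S" by simp
  finally have *: "Ev (coin_pmf T) (\<lambda>w. \<Prod>v\<in>S. U T w T v) \<le> \<epsilon> T ^ card S" .
  have "Ev (coin_pmf T) (\<lambda>w. of_bool (\<forall>v\<in>S. undecided w T v)) \<le> Ev (coin_pmf T) (\<lambda>w. \<Prod>v\<in>S. U T w T v)"
  proof (rule Ev_mono[OF finite_coin_pmf])
    fix w
    have "of_bool (\<forall>v\<in>S. undecided w T v) = (\<Prod>v\<in>S. of_bool (undecided w T v) :: real)"
      using finS by (induction S rule: finite_induct) auto
    also have "\<dots> \<le> (\<Prod>v\<in>S. U T w T v)" by (intro prod_mono conjI U_T) auto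
    finally show "of_bool (\<forall>v\<in>S. undecided w T v) \<le> (\<Prod>v\<in>S. U T w T v)" .
  qed
  then show ?thesis using * by simp
qed

end

section \<open>Shattering and the remaining clusters\<close>

fun hop_ball :: "(nat \<Rightarrow> nat set) \<Rightarrow> nat \<Rightarrow> nat \<Rightarrow> nat set" where
  "hop_ball nb 0 v = {v}"
| "hop_ball nb (Suc k) v = hop_ball nb k v \<union> (\<Union>u\<in>hop_ball nb k v. nb u)"

lemma hop_ball_trans: "y \<in> hop_ball nb a x \<Longrightarrow> z \<in> hop_ball nb b y \<Longrightarrow> z \<in> hop_ball nb (a + b) x"
  by (induction b arbitrary: z) auto

lemma hop_ball_self: "v \<in> hop_ball nb k v"
  by (induction k) auto

lemma hop_ball_sym:
  assumes "\<And>u v. u \<in> nb v \<Longrightarrow> v \<in> nb u"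
  shows "u \<in> hop_ball nb k v \<Longrightarrow> v \<in> hop_ball nb k u"
proof (induction k arbitrary: u)
  case (Suc k)
  then consider "u \<in> hop_ball nb k v" | x where "x \<in> hop_ball nb k v" "u \<in> nb x" by auto
  then show ?case
  proof cases
    case 1
    then show ?thesis using Suc.IH by auto
  next
    case 2
    then have "x \<in> hop_ball nb 1 u" using assms by auto
    moreover have "v \<in> hop_ball nb k x" using 2 Suc.IH by auto
    ultimately show ?thesis using hop_ball_trans[of x nb 1 u v k] by simp
  qed
qed simp

lemma hop_ball_finite_card:
  assumes "\<And>v. finite (nb v)" "\<And>v. card (nb v) \<le> \<Delta>"
  shows "finite (hop_ball nb k v) \<and> card (hop_ball nb k v) \<le> (\<Delta> + 1) ^ k"
proof (induction k)
  case (Suc k)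
  have "card (hop_ball nb (Suc k) v) \<le> card (hop_ball nb k v) + card (\<Union>u\<in>hop_ball nb k v. nb u)"
    by (simp add: card_Un_le)
  also have "card (\<Union>u\<in>hop_ball nb k v. nb u) \<le> (\<Sum>u\<in>hop_ball nb k v. card (nb u))"
    using Suc by (intro card_UN_le) auto
  also have "\<dots> \<le> (\<Sum>u\<in>hop_ball nb k v. \<Delta>)" by (intro sum_mono assms)
  also have "card (hop_ball nb k v) + (\<Sum>u\<in>hop_ball nb k v. \<Delta>) = card (hop_ball nb k v) * (\<Delta> + 1)" by simp
  also have "\<dots> \<le> (\<Delta> + 1) ^ k * (\<Delta> + 1)" using Suc by (intro mult_right_mono) auto
  finally show ?case using Suc assms by (simp add: mult.commute)
qed simp

definition component :: "(nat \<Rightarrow> nat set) \<Rightarrow> nat set \<Rightarrow> nat \<Rightarrow> nat set" where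
  "component nb X v = {u. (v, u) \<in> {(x, y). x \<in> X \<and> y \<in> X \<and> y \<in> nb x}\<^sup>*}"

lemma component_self: "v \<in> component nb X v"
  by (simp add: component_def)

lemma component_subset: "v \<in> X \<Longrightarrow> component nb X v \<subseteq> X"
  unfolding component_def by (auto elim: rtranclE)

lemma component_step: "u \<in> component nb X v \<Longrightarrow> v \<in> X \<Longrightarrow> y \<in> nb u \<Longrightarrow> y \<in> X \<Longrightarrow> y \<in> component nb X v"
  using component_subset[of v X nb] unfolding component_def by (auto intro: rtrancl_into_rtrancl)

lemma component_eq:
  assumes "\<And>u v. u \<in> nb v \<Longrightarrow> v \<in> nb u" "u \<in> component nb X v"
  shows "component nb X u = component nb X v"
proof -
  let ?R = "{(x, y). x \<in> X \<and> y \<in> X \<and> y \<in> nb x}"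
  have "sym ?R" using assms(1) by (auto simp: sym_def)
  then have "sym (?R\<^sup>*)" by (rule sym_rtrancl)
  then have "(u, v) \<in> ?R\<^sup>*" "(v, u) \<in> ?R\<^sup>*" using assms(2) by (auto simp: component_def sym_def)
  then show ?thesis unfolding component_def by (blast intro: rtrancl_trans)
qed

text \<open>A path from \<open>v\<close> to \<open>u\<close> has to leave \<open>N\<close> along
  some edge.\<close>

lemma component_crossing:
  assumes "u \<in> component nb X v" "v \<in> N" "u \<notin> N"
  shows "\<exists>x\<in>component nb X v. \<exists>y\<in>component nb X v. x \<in> N \<and> y \<notin> N \<and> y \<in> nb x"
proof -
  let ?R = "{(x, y). x \<in> X \<and> y \<in> X \<and> y \<in> nb x}"
  have "(v, u) \<in> ?R\<^sup>*" using assms(1) by (simp add: component_def)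
  then have "u \<notin> N \<longrightarrow> (\<exists>x y. (v, x) \<in> ?R\<^sup>* \<and> (x, y) \<in> ?R \<and> x \<in> N \<and> y \<notin> N)"
  proof (induction rule: rtrancl_induct)
    case (step y z)
    then show ?case by blast
  qed (use assms in auto)
  then obtain x y where xy: "(v, x) \<in> ?R\<^sup>*" "(x, y) \<in> ?R" "x \<in> N" "y \<notin> N" using assms(3) by blast
  then have "(v, y) \<in> ?R\<^sup>*" by (rule_tac rtrancl_into_rtrancl)
  then show ?thesis using xy unfolding component_def by blast
qed

context graph_nb
begin

lemma finite_hop_ball: "finite (hop_ball nb k v)" and card_hop_ball: "card (hop_ball nb k v) \<le> (\<Delta> + 1) ^ k"
  using hop_ball_finite_card[OF finite_nb nb_card] by auto

lemma nb_ball_sym: "u \<in> hop_ball nb k v \<Longrightarrow> v \<in> hop_ball nb k u"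
  by (rule hop_ball_sym[OF nb_sym])

lemma nb_component_eq: "u \<in> component nb X v \<Longrightarrow> component nb X u = component nb X v"
  by (rule component_eq) (use nb_sym in auto)

text \<open>
  Counting scattered subsets of a component as such would be awkward; a walk of length \<open>2 * k - 1\<close>
  (an Euler tour of a spanning tree) enumerates \<open>k\<close> scattered nodes, and there are few walks.
\<close>

definition scattered_walk :: "nat \<Rightarrow> nat list \<Rightarrow> bool" where
  "scattered_walk k ws \<longleftrightarrow> Suc (length ws) = 2 * k \<and> card (set ws) = k \<and>
     successively (\<lambda>a b. b \<in> hop_ball nb 5 a) ws \<and>
     (\<forall>a\<in>set ws. \<forall>b\<in>set ws. a \<noteq> b \<longrightarrow> b \<notin> hop_ball nb 4 a)"

text \<open>Greedy growth: the 4-hop balls around \<open>j\<close> chosen nodes do not cover the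
  component, so an edge leads out of their union to a new node \<open>x\<close>, at most 5 hops from
  a chosen \<open>a\<close>.\<close>

lemma scattered_walk_exists:
  assumes v: "v \<in> X"
  shows "1 \<le> j \<Longrightarrow> (j - 1) * (\<Delta> + 1) ^ 4 < card (component nb X v) \<Longrightarrow>
    \<exists>ws. scattered_walk j ws \<and> v \<in> set ws \<and> set ws \<subseteq> component nb X v"
proof (induction j rule: nat_induct_at_least)
  case base
  then show ?case
    by (intro exI[of _ "[v]"]) (auto simp: scattered_walk_def component_self)
next
  case (Suc j)
  let ?C = "component nb X v"
  have "(j - 1) * (\<Delta> + 1) ^ 4 \<le> (Suc j - 1) * (\<Delta> + 1) ^ 4" by (intro mult_right_mono) auto
  from le_less_trans[OF this Suc.prems] obtain ws
    where ws: "scattered_walk j ws" "v \<in> set ws" "set ws \<subseteq> ?C"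
    using Suc.IH by blast
  define N where "N = (\<Union>a\<in>set ws. hop_ball nb 4 a)"
  have finN: "finite N" by (simp add: N_def finite_hop_ball)
  have "card N \<le> (\<Sum>a\<in>set ws. card (hop_ball nb 4 a))" unfolding N_def by (rule card_UN_le) simp
  also have "\<dots> \<le> (\<Sum>a\<in>set ws. (\<Delta> + 1) ^ 4)" by (intro sum_mono card_hop_ball)
  also have "\<dots> = j * (\<Delta> + 1) ^ 4" using ws by (simp add: scattered_walk_def)
  also have "\<dots> < card ?C" using Suc.prems by simp
  finally have "\<not> ?C \<subseteq> N" using card_mono[OF finN, of ?C] by auto
  then obtain u where u: "u \<in> ?C" "u \<notin> N" by blast
  have "v \<in> N" using ws(2) hop_ball_self unfolding N_def by blast
  then obtain p x where px: "x \<in> ?C" "p \<in> N" "x \<notin> N" "x \<in> nb p"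
    using component_crossing[OF u(1) _ u(2)] by blast
  then obtain a where a: "a \<in> set ws" "p \<in> hop_ball nb 4 a" by (auto simp: N_def)
  have xa: "x \<in> hop_ball nb 5 a"
    using hop_ball_trans[of p nb 4 a x 1] a px by auto
  have ax: "a \<in> hop_ball nb 5 x" by (rule hop_ball_sym[OF nb_sym xa])
  obtain us vs where split: "ws = us @ a # vs" using a(1) by (meson split_list)
  \<comment> \<open>The detour from \<open>a\<close> to \<open>x\<close> and back adds two entries
    but only one new node.\<close>
  let ?ws = "us @ a # x # a # vs"
  have set: "set ?ws = insert x (set ws)" by (auto simp: split)
  have far: "x \<notin> hop_ball nb 4 b" "b \<notin> hop_ball nb 4 x" if "b \<in> set ws" for b
    using px(3) that nb_ball_sym by (auto simp: N_def)
  have "x \<notin> set ws" using far hop_ball_self by blast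
  then have "scattered_walk (Suc j) ?ws"
    using ws(1) xa ax far unfolding scattered_walk_def set
    by (auto simp: split successively_append_iff successively_Cons)
  moreover have "set ?ws \<subseteq> ?C" "v \<in> set ?ws" unfolding set using ws px by auto
  ultimately show ?case by blast
qed

lemma card_walks:
  "card {ws. length ws = Suc l \<and> set ws \<subseteq> {..<n} \<and> successively (\<lambda>a b. b \<in> hop_ball nb 5 a) ws}
     \<le> n * ((\<Delta> + 1) ^ 5) ^ l"
  (is "card (?S l) \<le> _")
proof (induction l)
  case 0
  have "?S 0 \<subseteq> (\<lambda>x. [x]) ` {..<n}" by (auto simp: length_Suc_conv)
  then have "card (?S 0) \<le> card ((\<lambda>x. [x]) ` {..<n})" by (intro card_mono) auto
  also have "\<dots> \<le> n" using card_image_le[of "{..<n}" "\<lambda>x. [x]"] by simp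
  finally show ?case by simp
next
  case (Suc l)
  have fin: "finite (?S l)"
    by (rule finite_subset[OF _ finite_lists_length_eq[of "{..<n}" "Suc l"]]) auto
  have "?S (Suc l) \<subseteq> (\<Union>ws\<in>?S l. (\<lambda>x. x # ws) ` hop_ball nb 5 (hd ws))"
  proof
    fix zs assume "zs \<in> ?S (Suc l)"
    then obtain x ws where zs: "zs = x # ws" "ws \<in> ?S l" "hd ws \<in> hop_ball nb 5 x"
      by (auto simp: length_Suc_conv successively_Cons)
    have "x \<in> hop_ball nb 5 (hd ws)" by (rule nb_ball_sym[OF zs(3)])
    then show "zs \<in> (\<Union>ws\<in>?S l. (\<lambda>x. x # ws) ` hop_ball nb 5 (hd ws))" using zs by blast
  qed
  then have "card (?S (Suc l)) \<le> card (\<Union>ws\<in>?S l. (\<lambda>x. x # ws) ` hop_ball nb 5 (hd ws))"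
    by (rule card_mono[rotated]) (use fin finite_hop_ball in auto)
  also have "\<dots> \<le> (\<Sum>ws\<in>?S l. card ((\<lambda>x. x # ws) ` hop_ball nb 5 (hd ws)))"
    by (rule card_UN_le[OF fin])
  also have "\<dots> \<le> (\<Sum>ws\<in>?S l. (\<Delta> + 1) ^ 5)"
    by (intro sum_mono order_trans[OF card_image_le card_hop_ball] finite_hop_ball)
  also have "\<dots> = card (?S l) * (\<Delta> + 1) ^ 5" by simp
  also have "\<dots> \<le> n * ((\<Delta> + 1) ^ 5) ^ l * (\<Delta> + 1) ^ 5" by (rule mult_right_mono[OF Suc]) simp
  finally show ?case by (simp add: mult_ac)
qed

text \<open>The cap \<open>M\<close> bounds the cost even if the component turns out to be too
  large; such an outcome is recognised by its cardinality.\<close>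

fun explore :: "nat \<Rightarrow> nat set \<Rightarrow> nat \<Rightarrow> nat \<Rightarrow> nat set" where
  "explore M X v 0 = {v}"
| "explore M X v (Suc i) = (let W = explore M X v i in
     if M < card W then W else W \<union> {u \<in> (\<Union>x\<in>W. nb x). u \<in> X})"

lemma explore_subset: "v \<in> X \<Longrightarrow> explore M X v i \<subseteq> component nb X v"
proof (induction i)
  case (Suc i)
  then show ?case by (auto simp: Let_def intro: component_step)
qed (simp add: component_self)

lemma explore_self: "v \<in> explore M X v i"
  by (induction i) (auto simp: Let_def)

lemma finite_explore: "finite (explore M X v i)"
  by (induction i) (auto simp: Let_def finite_nb)

lemma explore_closed:
  assumes v: "v \<in> X" and W: "{u \<in> (\<Union>x\<in>W. nb x). u \<in> X} \<subseteq> W" "v \<in> W" "W \<subseteq> component nb X v"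
  shows "W = component nb X v"
proof
  show "component nb X v \<subseteq> W"
  proof
    fix u assume "u \<in> component nb X v"
    then show "u \<in> W" using component_crossing[of u nb X v W] W component_subset[OF v] by blast
  qed
qed (rule W)

text \<open>Until the set is closed every step adds a node, so \<open>M\<close> steps
  suffice.\<close>

lemma explore_eq_component:
  assumes v: "v \<in> X" and M: "card (component nb X v) \<le> M" and X: "X \<subseteq> {..<n}"
  shows "explore M X v M = component nb X v"
proof -
  have finC: "finite (component nb X v)"
    using component_subset[OF v, of nb] X finite_subset[OF _ finite_lessThan[of n]] by blast
  have le: "card (explore M X v i) \<le> M" for i
    using card_mono[OF finC explore_subset[OF v]] M by (rule order_trans)
  have "explore M X v i = component nb X v \<or> i < card (explore M X v i)" for i
  proof (induction i)
    case 0
    show ?case by simp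
  next
    case (Suc i)
    let ?W = "explore M X v i"
    have S: "explore M X v (Suc i) = ?W \<union> {u \<in> (\<Union>x\<in>?W. nb x). u \<in> X}"
      using le[of i] by (simp add: Let_def)
    show ?case
    proof (cases "{u \<in> (\<Union>x\<in>?W. nb x). u \<in> X} \<subseteq> ?W")
      case True
      then have "?W = component nb X v"
        by (rule explore_closed[OF v _ explore_self explore_subset[OF v]])
      then show ?thesis using S True by blast
    next
      case False
      then have "?W \<subset> explore M X v (Suc i)" unfolding S by blast
      then have "card ?W < card (explore M X v (Suc i))" by (rule psubset_card_mono[OF finite_explore])
      moreover have "?W \<noteq> component nb X v"
        using explore_subset[OF v, of M "Suc i"] \<open>?W \<subset> _\<close> by blast
      ultimately show ?thesis using Suc by linarith
    qed
  qed
  then show ?thesis using le[of M] by (metis not_le)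
qed

end

definition local_mis :: "nat set \<Rightarrow> (nat \<Rightarrow> nat set) \<Rightarrow> nat set" where
  "local_mis W f = (SOME J. J \<subseteq> W \<and> (\<forall>a\<in>J. \<forall>b\<in>J. b \<notin> f a) \<and> (\<forall>a\<in>W - J. \<exists>b\<in>J. b \<in> f a))"

text \<open>Finiteness provides an inclusion-maximal independent subset of \<open>W\<close>, and
  maximality makes it dominating.\<close>

lemma local_mis:
  assumes "finite W" "\<And>a. a \<in> W \<Longrightarrow> a \<notin> f a" "\<And>a b. a \<in> W \<Longrightarrow> b \<in> W \<Longrightarrow> b \<in> f a \<Longrightarrow> a \<in> f b"
  shows "local_mis W f \<subseteq> W \<and> (\<forall>a\<in>local_mis W f. \<forall>b\<in>local_mis W f. b \<notin> f a) \<and>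
    (\<forall>a\<in>W - local_mis W f. \<exists>b\<in>local_mis W f. b \<in> f a)"
proof -
  let ?I = "{J \<in> Pow W. \<forall>a\<in>J. \<forall>b\<in>J. b \<notin> f a}"
  have fin: "finite ?I" and ne: "?I \<noteq> {}" using assms(1) by auto
  obtain J where J: "J \<in> ?I" and max: "\<forall>B\<in>?I. J \<subseteq> B \<longrightarrow> J = B"
    by (rule bexE[OF finite_has_maximal[OF fin ne]])
  have "\<exists>b\<in>J. b \<in> f a" if a: "a \<in> W - J" for a
  proof (rule ccontr)
    assume no: "\<not> (\<exists>b\<in>J. b \<in> f a)"
    have "insert a J \<in> ?I"
    proof -
      have "c \<notin> f b" if "b \<in> insert a J" "c \<in> insert a J" for b c
      proof
        assume c: "c \<in> f b"
        have "b \<in> W" "c \<in> W" using that J a by auto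
        then have bc: "b \<in> f c" using assms(3) c by blast
        show False
        proof (cases "b = a")
          case True
          then show False using that c no assms(2)[of a] a by blast
        next
          case False
          then have "b \<in> J" using that by simp
          then show False using that J c bc no by blast
        qed
      qed
      then show ?thesis using J a by simp
    qed
    from bspec[OF max this] show False using a by blast
  qed
  then have "J \<subseteq> W \<and> (\<forall>a\<in>J. \<forall>b\<in>J. b \<notin> f a) \<and> (\<forall>a\<in>W - J. \<exists>b\<in>J. b \<in> f a)" using J by blast
  then show ?thesis unfolding local_mis_def by (rule someI)
qed

context mis_process
begin

definition survivors :: "(nat \<Rightarrow> nat set) \<Rightarrow> coins \<Rightarrow> nat \<Rightarrow> nat set" where
  "survivors nb w T = {v. st nb w T v \<noteq> In \<and> (\<forall>u\<in>nb v. st nb w T u \<noteq> In)}"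

text \<open>The recursion of \<open>explore\<close> with the oracle as an argument, since the set of
  survivors depends on it as well.\<close>

primrec cluster :: "coins \<Rightarrow> nat \<Rightarrow> nat \<Rightarrow> nat \<Rightarrow> nat \<Rightarrow> (nat \<Rightarrow> nat set) \<Rightarrow> nat set" where
  "cluster w T M v 0 nb = {v}"
| "cluster w T M v (Suc i) nb = (let W = cluster w T M v i nb in
     if M < card W then W else W \<union> {u \<in> (\<Union>x\<in>W. nb x). u \<in> survivors nb w T})"

text \<open>
  The choice in \<open>local_mis\<close> sees the oracle only on the cluster, so all nodes of a cluster agree on it.
\<close>

definition mis_answer :: "coins \<Rightarrow> nat \<Rightarrow> nat \<Rightarrow> nat \<Rightarrow> (nat \<Rightarrow> nat set) \<Rightarrow> bool" where
  "mis_answer w T M v nb =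
     (if v \<in> survivors nb w T then
        let W = cluster w T M v M nb in
        card W \<le> M \<and> v \<in> local_mis W (\<lambda>x. if x \<in> W then nb x else {})
      else st nb w T v = In)"

end

context mis_graph
begin

lemma undecided_iff_survivors: "undecided w T v \<longleftrightarrow> v \<in> survivors nb w T"
  by (auto simp: undecided_def survivors_def dominated_of_def)

lemma cluster_eq: "cluster w T M v i nb = explore M (survivors nb w T) v i"
  by (induction i) (simp_all add: Let_def)

text \<open>Identifiers from \<open>n\<close> on are isolated and may count as survivors too; the
  intersection restores finiteness.\<close>

definition live :: "coins \<Rightarrow> nat \<Rightarrow> nat set" where
  "live w T = survivors nb w T \<inter> {..<n}"

lemma explore_live:
  assumes "v < n"
  shows "explore M (survivors nb w T) v i = explore M (live w T) v i"
proof (induction i)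
  case (Suc i)
  have "{u \<in> (\<Union>x\<in>W. nb x). u \<in> survivors nb w T} = {u \<in> (\<Union>x\<in>W. nb x). u \<in> live w T}" for W
    using nb_sub by (auto simp: live_def)
  then show ?case using Suc by (simp add: Let_def)
qed simp

text \<open>Adjacent live nodes share their component and hence the value of
  \<open>local_mis\<close>. A live node has no neighbour in \<open>In\<close>, so the two parts of
  the answer do not interfere.\<close>

lemma mis_answer_correct:
  assumes small: "\<And>v. v \<in> live w T \<Longrightarrow> card (component nb (live w T) v) \<le> M"
  defines "I \<equiv> {v. v < n \<and> mis_answer w T M v nb}"
  shows "\<forall>u\<in>I. \<forall>v\<in>I. v \<notin> nb u" and "\<forall>u. u < n \<and> u \<notin> I \<longrightarrow> (\<exists>v\<in>I. v \<in> nb u)"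
proof -
  let ?L = "live w T"
  let ?C = "component nb ?L"
  let ?J = "\<lambda>v. local_mis (?C v) (\<lambda>x. if x \<in> ?C v then nb x else {})"
  have LN: "?L \<subseteq> {..<n}" by (simp add: live_def)
  have cl: "cluster w T M v M nb = ?C v" if "v \<in> ?L" for v
  proof -
    have "v < n" using that LN by blast
    then show ?thesis
      unfolding cluster_eq explore_live[OF \<open>v < n\<close>] by (intro explore_eq_component that small LN)
  qed
  have out: "v \<in> I \<longleftrightarrow> (if v \<in> ?L then v \<in> ?J v else v < n \<and> st nb w T v = In)" for v
  proof (cases "v \<in> ?L")
    case True
    then have "v < n" "v \<in> survivors nb w T" by (auto simp: live_def)
    then show ?thesis using True small[OF True] by (simp add: I_def mis_answer_def cl Let_def)
  next
    case False
    then show ?thesis by (auto simp: I_def mis_answer_def live_def)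
  qed
  have Csub: "?C v \<subseteq> ?L" if "v \<in> ?L" for v using component_subset[OF that] .
  have J: "?J v \<subseteq> ?C v" "\<forall>a\<in>?J v. \<forall>b\<in>?J v. b \<notin> nb a" "\<forall>a\<in>?C v - ?J v. \<exists>b\<in>?J v. b \<in> nb a" if "v \<in> ?L" for v
  proof -
    have fin: "finite (?C v)" using Csub[OF that] LN finite_subset[OF _ finite_lessThan[of n]] by blast
    note * = local_mis[OF fin, of "\<lambda>x. if x \<in> ?C v then nb x else {}"]
    have **: "?J v \<subseteq> ?C v \<and> (\<forall>a\<in>?J v. \<forall>b\<in>?J v. b \<notin> (if a \<in> ?C v then nb a else {})) \<and>
       (\<forall>a\<in>?C v - ?J v. \<exists>b\<in>?J v. b \<in> (if a \<in> ?C v then nb a else {}))"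
      by (rule *) (use nb_irrefl nb_sym in auto)
    then show "?J v \<subseteq> ?C v" by blast
    show "\<forall>a\<in>?J v. \<forall>b\<in>?J v. b \<notin> nb a"
    proof (intro ballI)
      fix a b assume ab: "a \<in> ?J v" "b \<in> ?J v"
      then have "b \<notin> (if a \<in> ?C v then nb a else {})" using ** by blast
      moreover have "a \<in> ?C v" using ab ** by blast
      ultimately show "b \<notin> nb a" by simp
    qed
    show "\<forall>a\<in>?C v - ?J v. \<exists>b\<in>?J v. b \<in> nb a"
    proof
      fix a assume a: "a \<in> ?C v - ?J v"
      then obtain b where "b \<in> ?J v" "b \<in> (if a \<in> ?C v then nb a else {})" using ** by blast
      then show "\<exists>b\<in>?J v. b \<in> nb a" using a by auto
    qed
  qed
  show "\<forall>u\<in>I. \<forall>v\<in>I. v \<notin> nb u"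
  proof (intro ballI)
    fix u v assume u: "u \<in> I" and v: "v \<in> I"
    show "v \<notin> nb u"
    proof
      assume uv: "v \<in> nb u"
      consider "u \<in> ?L" "v \<in> ?L" | "u \<in> ?L" "v \<notin> ?L" | "u \<notin> ?L" "v \<in> ?L" | "u \<notin> ?L" "v \<notin> ?L" by blast
      then show False
      proof cases
        case 1
        have "v \<in> ?C u" by (rule component_step[of u nb ?L u v, OF component_self 1(1) uv 1(2)])
        then have "?C v = ?C u" by (rule nb_component_eq)
        then have "u \<in> ?J u" "v \<in> ?J u" using u v 1 out by auto
        then show False using J(2)[OF 1(1)] uv by blast
      next
        case 2
        then have "st nb w T v = In" using v out by auto
        then show False using 2(1) uv by (auto simp: live_def survivors_def)
      next
        case 3
        then have "st nb w T u = In" using u out by auto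
        then show False using 3(2) nb_sym[OF uv] by (auto simp: live_def survivors_def)
      next
        case 4
        then have "st nb w T u = In" "st nb w T v = In" using u v out by auto
        then show False using In_independent[of nb w T u v] nb_sym uv by blast
      qed
    qed
  qed
  show "\<forall>u. u < n \<and> u \<notin> I \<longrightarrow> (\<exists>v\<in>I. v \<in> nb u)"
  proof (intro allI impI, elim conjE)
    fix u assume u: "u < n" "u \<notin> I"
    show "\<exists>v\<in>I. v \<in> nb u"
    proof (cases "u \<in> ?L")
      case True
      then have "u \<in> ?C u - ?J u" using u out component_self by auto
      then obtain b where b: "b \<in> ?J u" "b \<in> nb u" using J(3)[OF True] by blast
      then have bC: "b \<in> ?C u" using J(1)[OF True] by blast
      then have "?C b = ?C u" by (rule nb_component_eq)
      moreover have "b \<in> ?L" using bC Csub[OF True] by blast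
      ultimately have "b \<in> I" using b out by auto
      then show ?thesis using b by blast
    next
      case False
      then have "st nb w T u \<noteq> In" using u out by auto
      then obtain v where v: "v \<in> nb u" "st nb w T v = In"
        using False u by (auto simp: live_def survivors_def)
      have "v \<notin> ?L" using v by (auto simp: live_def survivors_def)
      moreover have "v < n" using v nb_sub by blast
      ultimately show ?thesis using v out by auto
    qed
  qed
qed

lemma near_eq_hop_ball: "near v = hop_ball nb 2 v"
  by (auto simp: near_def numeral_2_eq_2)

lemma \<epsilon>_nonneg: "0 \<le> \<epsilon> T"
  using lambda_nonneg \<eta>_nonneg[of T] by (simp add: \<epsilon>_def)

text \<open>A large component contains a scattered walk with \<open>k\<close> nodes. The balls of
  radius 2 around them are disjoint, hence one factor \<open>\<epsilon> T\<close> per node. Each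
  node also accounts for two steps with \<open>(\<Delta> + 1) ^ 5\<close> choices, hence the power
  10.\<close>

lemma large_component_prob:
  assumes T: "e0 + T \<le> m" and k: "1 \<le> k"
  shows "Ev (coin_pmf T) (\<lambda>w. of_bool (\<exists>v\<in>live w T. k * (\<Delta> + 1) ^ 4 < card (component nb (live w T) v)))
    \<le> n * ((real \<Delta> + 1) ^ 10 * \<epsilon> T) ^ k"
proof -
  obtain l where l: "k = Suc l" using k by (cases k) auto
  let ?W = "{ws. length ws = Suc (2 * l) \<and> set ws \<subseteq> {..<n} \<and> successively (\<lambda>a b. b \<in> hop_ball nb 5 a) ws}"
  let ?S = "{ws \<in> ?W. scattered_walk k ws}"
  have finW: "finite ?W"
    by (rule finite_subset[OF _ finite_lists_length_eq[of "{..<n}" "Suc (2 * l)"]]) auto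
  have finS: "finite ?S" by (rule finite_subset[OF _ finW]) auto
  let ?all = "\<lambda>ws w. \<forall>v\<in>set ws. undecided w T v"
  have "Ev (coin_pmf T) (\<lambda>w. of_bool (\<exists>v\<in>live w T. k * (\<Delta> + 1) ^ 4 < card (component nb (live w T) v)))
    \<le> Ev (coin_pmf T) (\<lambda>w. of_bool (\<exists>ws\<in>?S. ?all ws w))"
  proof (rule Ev_mono[OF finite_coin_pmf])
    fix w
    have "\<exists>ws\<in>?S. ?all ws w" if v: "v \<in> live w T" "k * (\<Delta> + 1) ^ 4 < card (component nb (live w T) v)" for v
    proof -
      have "(k - 1) * (\<Delta> + 1) ^ 4 \<le> k * (\<Delta> + 1) ^ 4" by (intro mult_right_mono) auto
      then obtain ws where ws: "scattered_walk k ws" "set ws \<subseteq> component nb (live w T) v"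
        using scattered_walk_exists[OF v(1) k] v(2) by (meson le_less_trans)
      have sub: "set ws \<subseteq> live w T" using ws(2) component_subset[OF v(1)] by blast
      have "ws \<in> ?S" using ws(1) sub by (auto simp: scattered_walk_def l live_def)
      moreover have "?all ws w" using sub by (auto simp: undecided_iff_survivors live_def)
      ultimately show ?thesis by blast
    qed
    then show "of_bool (\<exists>v\<in>live w T. k * (\<Delta> + 1) ^ 4 < card (component nb (live w T) v)) \<le> (of_bool (\<exists>ws\<in>?S. ?all ws w) :: real)"
      unfolding of_bool_less_eq_iff by blast
  qed
  also have "\<dots> \<le> (\<Sum>ws\<in>?S. Ev (coin_pmf T) (\<lambda>w. of_bool (?all ws w)))"
    by (rule Ev_union_bound[OF finS])
  also have "\<dots> \<le> (\<Sum>ws\<in>?S. \<epsilon> T ^ k)"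
  proof (rule sum_mono)
    fix ws assume ws: "ws \<in> ?S"
    have "Ev (coin_pmf T) (\<lambda>w. of_bool (?all ws w)) \<le> \<epsilon> T ^ card (set ws)"
    proof (rule undecided_prob[OF _ _ T])
      fix u v assume uv: "u \<in> set ws" "v \<in> set ws" "u \<noteq> v"
      show "near u \<inter> near v = {}"
      proof (rule ccontr)
        assume "near u \<inter> near v \<noteq> {}"
        then obtain z where z: "z \<in> hop_ball nb 2 u" "z \<in> hop_ball nb 2 v" by (auto simp: near_eq_hop_ball)
        have "v \<in> hop_ball nb 2 z" by (rule hop_ball_sym[OF nb_sym z(2)])
        then have "v \<in> hop_ball nb 4 u" using hop_ball_trans[OF z(1)] by fastforce
        then show False using ws uv by (auto simp: scattered_walk_def)
      qed
    qed (use ws in auto)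
    then show "Ev (coin_pmf T) (\<lambda>w. of_bool (?all ws w)) \<le> \<epsilon> T ^ k"
      using ws by (simp add: scattered_walk_def)
  qed
  also have "\<dots> = real (card ?S) * \<epsilon> T ^ k" by simp
  also have "\<dots> \<le> n * ((real \<Delta> + 1) ^ 5) ^ (2 * k) * \<epsilon> T ^ k"
  proof (rule mult_right_mono)
    have "card ?S \<le> card ?W" by (rule card_mono[OF finW]) auto
    also have "\<dots> \<le> n * ((\<Delta> + 1) ^ 5) ^ (2 * l)" by (rule card_walks)
    also have "\<dots> \<le> n * ((\<Delta> + 1) ^ 5) ^ (2 * k)"
      by (intro mult_left_mono power_increasing) (auto simp: l)
    finally have "real (card ?S) \<le> real (n * ((\<Delta> + 1) ^ 5) ^ (2 * k))" by (rule of_nat_mono)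
    then show "real (card ?S) \<le> n * ((real \<Delta> + 1) ^ 5) ^ (2 * k)" by (simp add: add.commute)
  qed (simp add: \<epsilon>_nonneg)
  also have "\<dots> = n * ((real \<Delta> + 1) ^ 10 * \<epsilon> T) ^ k"
    by (simp add: power_mult_distrib flip: power_mult)
  finally show ?thesis .
qed

end

section \<open>The local algorithm\<close>

context bounded_process
begin

lemma finite_cluster:
  assumes "\<And>v. finite (nb v)"
  shows "finite (cluster w T M v i nb)"
  by (induction i) (use assms in \<open>auto simp: Let_def\<close>)

lemma queries_le_survivors:
  assumes fin: "\<And>nb v. nb \<in> \<O> \<Longrightarrow> finite (nb v)" and card: "\<And>nb v. nb \<in> \<O> \<Longrightarrow> card (nb v) \<le> \<Delta>"
    and st: "\<And>v. queries_le (\<lambda>nb. st nb w T v) J" and J: "0 \<le> J"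
  shows "queries_le (\<lambda>nb. (u \<in> survivors nb w T, st nb w T u = In)) (1 + (real \<Delta> + 1) * J)"
proof (rule queries_le_bind[OF queries_le_query[OF order_refl, of u],
    where G = "\<lambda>N nb. (st nb w T u \<noteq> In \<and> (\<forall>y\<in>N. st nb w T y \<noteq> In), st nb w T u = In)" and b = "(real \<Delta> + 1) * J"])
  fix nb and N :: "nat set" assume nb: "nb \<in> \<O>" and N: "N = nb u"
  have finN: "finite (insert u N)" using fin[OF nb] N by simp
  have "card (insert u N) \<le> Suc (card N)" using finN by (intro card_insert_le_m1) auto
  then have "card (insert u N) \<le> Suc \<Delta>" using card[OF nb, of u] N by simp
  from queries_le_fun_const[OF finN this st J]
  have "queries_le (\<lambda>nb y. if y \<in> insert u N then Some (st nb w T y) else None) ((real \<Delta> + 1) * J)"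
    by (simp only: of_nat_Suc add.commute)
  then show "queries_le (\<lambda>nb. (st nb w T u \<noteq> In \<and> (\<forall>y\<in>N. st nb w T y \<noteq> In), st nb w T u = In)) ((real \<Delta> + 1) * J)"
    by (rule queries_le_map[where g = "\<lambda>a. (a u \<noteq> Some In \<and> (\<forall>y\<in>N. a y \<noteq> Some In), a u = Some In)"]) auto
qed (auto simp: survivors_def)

lemma queries_le_cluster:
  assumes fin: "\<And>nb v. nb \<in> \<O> \<Longrightarrow> finite (nb v)" and card: "\<And>nb v. nb \<in> \<O> \<Longrightarrow> card (nb v) \<le> \<Delta>"
    and K: "\<And>u. queries_le (\<lambda>nb. (u \<in> survivors nb w T, st nb w T u = In)) K" and K0: "0 \<le> K"
  shows "queries_le (cluster w T M v i) (real i * (real M + real M * real \<Delta> * K))"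
proof (induction i)
  case 0
  show ?case by (rule queries_le_map[OF queries_le_const]) auto
next
  case (Suc i)
  have K': "queries_le (\<lambda>nb. u \<in> survivors nb w T) K" for u
    by (rule queries_le_map[OF K[of u], where g = fst]) simp
  let ?G = "\<lambda>W nb. if M < card W then W else W \<union> {u \<in> (\<Union>x\<in>W. nb x). u \<in> survivors nb w T}"
  show ?case
  proof (rule queries_le_bind[OF Suc, where G = ?G and b = "real M + real M * real \<Delta> * K"])
    fix nb W assume nb: "nb \<in> \<O>" and W: "W = cluster w T M v i nb"
    show "queries_le (?G W) (real M + real M * real \<Delta> * K)"
    proof (cases "M < card W")
      case True
      then show ?thesis using K0 by (simp add: queries_le_const)
    next
      case False
      have finW: "finite W" unfolding W by (rule finite_cluster[OF fin[OF nb]])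
      have cW: "card W \<le> M" using False by simp
      have F: "queries_le (\<lambda>nb y. if y \<in> W then Some (nb y) else None) (\<Sum>y\<in>W. 1)"
        by (rule queries_le_fun[OF finW queries_le_query]) simp
      let ?G' = "\<lambda>a nb. W \<union> {u \<in> (\<Union>x\<in>W. the (a x)). u \<in> survivors nb w T}"
      show ?thesis
      proof (rule queries_le_bind[OF F, where G = ?G' and b = "real M * real \<Delta> * K"])
        fix nb' :: "nat \<Rightarrow> nat set" and a assume nb': "nb' \<in> \<O>" and a: "a = (\<lambda>y. if y \<in> W then Some (nb' y) else None)"
        let ?S = "\<Union>x\<in>W. nb' x"
        have S: "(\<Union>x\<in>W. the (a x)) = ?S" by (auto simp: a)
        have finS: "finite ?S" using finW fin[OF nb'] by auto
        have "card ?S \<le> (\<Sum>x\<in>W. card (nb' x))" by (rule card_UN_le[OF finW])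
        also have "\<dots> \<le> (\<Sum>x\<in>W. \<Delta>)" by (intro sum_mono card[OF nb'])
        also have "\<dots> \<le> M * \<Delta>" using cW by simp
        finally have cS: "card ?S \<le> M * \<Delta>" .
        have "queries_le (\<lambda>nb y. if y \<in> ?S then Some (y \<in> survivors nb w T) else None) (real (M * \<Delta>) * K)"
          by (rule queries_le_fun_const[OF finS cS K' K0])
        then show "queries_le (?G' a) (real M * real \<Delta> * K)"
          unfolding S of_nat_mult by (rule queries_le_map[where g = "\<lambda>b. W \<union> {u \<in> ?S. b u = Some True}"]) auto
      next
        fix nb' :: "nat \<Rightarrow> nat set"
        show "?G W nb' = ?G' (\<lambda>y. if y \<in> W then Some (nb' y) else None) nb'"
          using False by simp
      qed (use cW in simp)
    qed
  qed (simp_all add: Let_def algebra_simps)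
qed

lemma queries_le_mis_answer:
  assumes fin: "\<And>nb v. nb \<in> \<O> \<Longrightarrow> finite (nb v)" and card: "\<And>nb v. nb \<in> \<O> \<Longrightarrow> card (nb v) \<le> \<Delta>"
    and st: "\<And>v. queries_le (\<lambda>nb. st nb w T v) J" and J: "0 \<le> J" and M: "1 \<le> M"
  shows "queries_le (mis_answer w T M v) (4 * real M ^ 2 * (real \<Delta> + 1) ^ 2 * (1 + J))"
proof -
  define K where "K = 1 + (real \<Delta> + 1) * J"
  have K0: "0 \<le> K" using J by (simp add: K_def)
  have K: "queries_le (\<lambda>nb. (u \<in> survivors nb w T, st nb w T u = In)) K" for u
    unfolding K_def by (rule queries_le_survivors) (use fin card st J in auto)
  let ?c = "real M * (real M + real M * real \<Delta> * K)"
  have C: "queries_le (cluster w T M v M) ?c"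
    by (rule queries_le_cluster[OF _ _ K K0]) (use fin card in auto)
  let ?L = "\<lambda>W f. card W \<le> M \<and> v \<in> local_mis W f"
  have c0: "0 \<le> ?c" using K0 by simp
  have bound: "K + (?c + real M) \<le> 4 * real M ^ 2 * (real \<Delta> + 1) ^ 2 * (1 + J)"
  proof -
    have M1: "1 \<le> real M" using M by simp
    have M2: "1 \<le> real M ^ 2" "real M \<le> real M ^ 2"
      using one_le_power[OF M1, of 2] mult_left_mono[OF M1, of "real M"] by (auto simp: power2_eq_square)
    define d where "d = real \<Delta> + 1"
    have d1: "1 \<le> d" by (simp add: d_def)
    have Kle: "K \<le> d * (1 + J)" unfolding K_def d_def[symmetric] using d1 by (simp add: algebra_simps)
    have d2: "d * (1 + J) \<le> d ^ 2 * (1 + J)" using d1 J by (intro mult_right_mono) (auto simp: power2_eq_square)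
    have e1: "1 \<le> d ^ 2 * (1 + J)"
      using mult_mono[of 1 "d ^ 2" 1 "1 + J"] one_le_power[OF d1, of 2] J by simp
    have X: "real \<Delta> * K \<le> d ^ 2 * (1 + J)"
    proof -
      have "real \<Delta> * K \<le> d * (d * (1 + J))" using Kle K0 d1 by (intro mult_mono) (auto simp: d_def)
      then show ?thesis by (simp add: power2_eq_square mult_ac)
    qed
    define Y where "Y = d ^ 2 * (1 + J)"
    have 1: "K \<le> real M ^ 2 * Y"
      using order_trans[OF Kle d2] mult_right_mono[OF M2(1), of Y] e1 unfolding Y_def by simp
    have 2: "real M \<le> real M ^ 2 * Y"
      using mult_mono[OF M2(2) e1] unfolding Y_def by simp
    have 3: "?c \<le> real M ^ 2 * Y + real M ^ 2 * Y"
    proof -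
      have "?c = real M ^ 2 * 1 + real M ^ 2 * (real \<Delta> * K)" by (simp add: power2_eq_square algebra_simps)
      also have "\<dots> \<le> real M ^ 2 * Y + real M ^ 2 * Y"
        using X e1 unfolding Y_def by (intro add_mono mult_left_mono) auto
      finally show ?thesis .
    qed
    have "4 * real M ^ 2 * (real \<Delta> + 1) ^ 2 * (1 + J) = 4 * (real M ^ 2 * Y)" by (simp add: Y_def d_def)
    then show ?thesis using 1 2 3 by linarith
  qed
  show ?thesis
  proof (rule queries_le_bind[OF K[of v], where b = "?c + real M"
        and G = "\<lambda>p nb. if fst p then (let W = cluster w T M v M nb in ?L W (\<lambda>x. if x \<in> W then nb x else {})) else snd p"])
    fix nb :: "nat \<Rightarrow> nat set" and p assume "p = (v \<in> survivors nb w T, st nb w T v = In)"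
    show "queries_le (\<lambda>nb. if fst p then (let W = cluster w T M v M nb in ?L W (\<lambda>x. if x \<in> W then nb x else {})) else snd p) (?c + real M)"
    proof (cases "fst p")
      case False
      then show ?thesis using c0 by (simp add: queries_le_const)
    next
      case True
      have "queries_le (\<lambda>nb. let W = cluster w T M v M nb in ?L W (\<lambda>x. if x \<in> W then nb x else {})) (?c + real M)"
      proof (rule queries_le_bind[OF C, where G = "\<lambda>W nb. ?L W (\<lambda>x. if x \<in> W then nb x else {})" and b = "real M"])
        fix nb W assume nb: "nb \<in> \<O>" and W: "W = cluster w T M v M nb"
        show "queries_le (\<lambda>nb. ?L W (\<lambda>x. if x \<in> W then nb x else {})) (real M)"
        proof (cases "card W \<le> M")
          case cW: True
          have finW: "finite W" unfolding W by (rule finite_cluster[OF fin[OF nb]])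
          have F: "queries_le (\<lambda>nb y. if y \<in> W then Some (nb y) else None) (\<Sum>y\<in>W. 1)"
            by (rule queries_le_fun[OF finW queries_le_query]) simp
          have "queries_le (\<lambda>nb. ?L W (\<lambda>x. if x \<in> W then nb x else {})) (\<Sum>y\<in>W. 1)"
          proof (rule queries_le_map[OF F, where g = "\<lambda>a. ?L W (\<lambda>x. if x \<in> W then the (a x) else {})"], goal_cases)
            case (1 nb)
            have "(\<lambda>x. if x \<in> W then the (if x \<in> W then Some (nb x) else None) else {}) = (\<lambda>x. if x \<in> W then nb x else {})"
              by (rule ext) simp
            then show ?case by simp
          qed
          then show ?thesis by (rule queries_le_mono) (use cW in simp)
        qed (simp add: queries_le_const)
      qed (auto simp: Let_def)
      then show ?thesis using True by simp
    qed
  next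
    show "K + (?c + real M) \<le> 4 * real M ^ 2 * (real \<Delta> + 1) ^ 2 * (1 + J)" by (rule bound)
  qed (auto simp: mis_answer_def Let_def)
qed

end

section \<open>From the random string to the coins\<close>

definition decode_row :: "nat \<Rightarrow> nat \<Rightarrow> bool list \<Rightarrow> nat \<Rightarrow> nat" where
  "decode_row n m r v = (if v < n then run_length (take m (drop (v * m) r)) else 0)"

definition decode :: "nat \<Rightarrow> nat \<Rightarrow> nat \<Rightarrow> bool list \<Rightarrow> coins" where
  "decode n m T r t = (if t < T then decode_row n m (take (n * m) (drop (t * (n * m)) r)) else (\<lambda>_. 0))"

text \<open>Surplus bits are ignored: the length of the string may depend on \<open>n\<close> only,
  whereas the number of rounds depends on \<Delta>.\<close>

lemma (in mis_graph) coin_pmf_decode: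
  assumes "T * (n * m) \<le> l"
  shows "map_pmf (decode n m T) (random_bits l) = coin_pmf T"
proof -
  obtain b where l: "l = T * (n * m) + b" using assms le_Suc_ex by blast
  have row: "row = map_pmf (decode_row n m) (random_bits (n * m))"
    unfolding row_def geo_def Pi_random_bits decode_row_def[abs_def] by simp
  have "coin_pmf T = map_pmf (decode n m T) (random_bits (T * (n * m)))"
    unfolding coin_pmf_def row Pi_random_bits decode_def[abs_def] by simp
  also have "\<dots> = map_pmf (\<lambda>(x, y). decode n m T x) (pair_pmf (random_bits (T * (n * m))) (random_bits b))"
  proof -
    have "random_bits (T * (n * m)) = map_pmf fst (pair_pmf (random_bits (T * (n * m))) (random_bits b))"
      by (simp only: map_fst_pair_pmf)
    then have "map_pmf (decode n m T) (random_bits (T * (n * m))) =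
      map_pmf (decode n m T) (map_pmf fst (pair_pmf (random_bits (T * (n * m))) (random_bits b)))"
      by (rule arg_cong)
    then show ?thesis by (simp only: pmf.map_comp o_def case_prod_unfold)
  qed
  also have "\<dots> = map_pmf (\<lambda>(x, y). decode n m T (x @ y)) (pair_pmf (random_bits (T * (n * m))) (random_bits b))"
  proof (rule map_pmf_cong[OF refl], clarsimp simp: set_random_bits fun_eq_iff, goal_cases)
    case (1 x y t v)
    have "t * (n * m) + n * m \<le> T * (n * m)" if "t < T"
      using that by (metis Suc_leI add.commute mult_Suc mult_le_mono1)
    then show ?case using 1 by (auto simp: decode_def)
  qed
  also have "\<dots> = map_pmf (decode n m T) (random_bits l)"
    by (simp add: l random_bits_add pmf.map_comp o_def case_prod_unfold)
  finally show ?thesis ..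
qed

text \<open>This is \<open>68 / \<alpha>\<close>, so \<open>T = c\<^sub>1 * L\<close> rounds give
  \<open>T * \<alpha> / 4 = 17 * L\<close>.\<close>

definition c\<^sub>1 :: nat where "c\<^sub>1 = 68 * (28000 * 51200)"

text \<open>The summand 1 makes the value positive from \<open>k = 1\<close> on and leaves room for
  closed neighbourhoods of size \<open>\<Delta> + 1\<close>.\<close>

definition size_log :: "nat \<Rightarrow> nat" where
  "size_log k = nat \<lceil>log 2 (real k + 1)\<rceil>"

lemma size_log_ge: "real k + 1 \<le> 2 ^ size_log k"
proof -
  have "real k + 1 = 2 powr (log 2 (real k + 1))" by simp
  also have "\<dots> \<le> 2 powr (real (size_log k))"
    unfolding size_log_def by (intro powr_mono) linarith+
  finally show ?thesis by (simp add: powr_realpow)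
qed

lemma size_log_mono: "k \<le> l \<Longrightarrow> size_log k \<le> size_log l"
  unfolding size_log_def by (intro nat_mono ceiling_mono) simp

lemma size_log_pos: "1 \<le> k \<Longrightarrow> 1 \<le> size_log k"
proof -
  assume "1 \<le> k"
  then have "0 < log 2 (real k + 1)" by simp
  then show ?thesis unfolding size_log_def by linarith
qed

lemma size_log_le:
  assumes "1 \<le> k"
  shows "real (size_log k) \<le> 2 + 2 * ln (real k)"
proof -
  have k: "1 \<le> real k" using assms by simp
  have "log 2 (real k + 1) \<le> log 2 (2 * real k)" using k by simp
  also have "\<dots> = 1 + ln (real k) / ln 2" using k by (simp add: log_def ln_mult_pos add_divide_distrib)
  also have "ln (real k) / ln 2 \<le> 2 * ln (real k)"
  proof -
    have "ln (real k) * 1 \<le> ln (real k) * (2 * ln 2)"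
      using k ln2_ge_two_thirds by (intro mult_left_mono) auto
    then show ?thesis by (simp add: field_simps)
  qed
  finally have "log 2 (real k + 1) \<le> 1 + 2 * ln (real k)" by simp
  moreover have "0 \<le> log 2 (real k + 1)" using k by simp
  ultimately show ?thesis unfolding size_log_def by linarith
qed

text \<open>Both summands of \<open>\<epsilon> T\<close> are at most \<open>2 ^ - (22 * L)\<close>.
  The decay yields \<open>exp (- 17 * L) * exp L\<close>, which is small enough as
  \<open>22 * ln 2 \<le> 16\<close>. For the failures, \<open>D = 202 * L\<close> is chosen by
  \<open>101 = 39 + 1 + 39 + 22\<close>.\<close>

lemma (in mis_graph) \<epsilon>_bound:
  assumes L: "1 \<le> L" "real \<Delta> + 1 \<le> 2 ^ L" and e0: "e0 = L" and D: "D = 202 * L" and T: "T = c\<^sub>1 * L"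
  shows "(real \<Delta> + 1) ^ 10 * \<epsilon> T \<le> 1 / 2 ^ 11"
proof -
  let ?h = "(1 / 2 :: real) ^ (22 * L)"
  have halve: "2 ^ a * (1 / 2) ^ (a + b) = (1 / 2 :: real) ^ b" for a b :: nat
    by (simp add: power_add power_one_over)
  have L1: "1 \<le> real L" using L by simp
  have F1: "(1 - \<alpha> / 4) ^ T * exp (\<alpha> * (ln 2 * real e0 + 30 * ln 200)) \<le> ?h"
  proof -
    have "1 - \<alpha> / 4 \<le> exp (- (\<alpha> / 4))" using exp_ge_add_one_self[of "- (\<alpha> / 4)"] by simp
    then have "(1 - \<alpha> / 4) ^ T \<le> exp (- (\<alpha> / 4)) ^ T" by (rule power_mono[OF _ lambda_nonneg])
    also have "\<dots> = exp (real T * (- (\<alpha> / 4)))" by (rule exp_of_nat_mult[symmetric])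
    also have "real T * (- (\<alpha> / 4)) = - 17 * real L" by (simp add: T c\<^sub>1_def \<alpha>_def)
    finally have 1: "(1 - \<alpha> / 4) ^ T \<le> exp (- 17 * real L)" .
    have "ln 2 * real e0 + 30 * ln 200 \<le> 1 * real L + 30 * 200"
      using ln2_le_25_over_36 ln_le_minus_one[of "200 :: real"] unfolding e0 by (intro add_mono mult_right_mono) auto
    also have "\<dots> \<le> 6001 * real L" using L1 by simp
    finally have "\<alpha> * (ln 2 * real e0 + 30 * ln 200) \<le> \<alpha> * (6001 * real L)"
      by (rule mult_left_mono) (simp add: \<alpha>_def)
    also have "\<dots> \<le> real L" by (simp add: \<alpha>_def)
    finally have 2: "exp (\<alpha> * (ln 2 * real e0 + 30 * ln 200)) \<le> exp (real L)" by simp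
    have "(1 - \<alpha> / 4) ^ T * exp (\<alpha> * (ln 2 * real e0 + 30 * ln 200)) \<le> exp (- 17 * real L) * exp (real L)"
      by (intro mult_mono 1 2) auto
    also have "\<dots> = exp (- 16 * real L)" by (simp flip: exp_add)
    also have "\<dots> \<le> exp (- (real (22 * L) * ln 2))"
      using ln2_le_25_over_36 mult_right_mono[of "ln 2" "16/22" "real L"] by (simp add: mult.commute)
    also have "\<dots> = ?h"
      by (simp add: exp_minus exp_of_nat_mult power_one_over inverse_eq_divide del: of_nat_mult)
    finally show ?thesis .
  qed
  have F2: "real T * ((real \<Delta> + 1) * \<eta> T) \<le> ?h"
  proof -
    \<comment> \<open>\<open>2 ^ 37\<close> exceeds \<open>c\<^sub>1\<close>.\<close>
    have "real T + 2 \<le> 2 ^ 37 * real L + 2 * real L" using L1 by (simp add: T c\<^sub>1_def)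
    also have "\<dots> \<le> 2 ^ 38 * real L" using L1 by simp
    also have "\<dots> \<le> 2 ^ 38 * 2 ^ L"
      using of_nat_less_two_power[of L, where ?'a = real] by (intro mult_left_mono) auto
    also have "\<dots> = 2 ^ (38 + L)" by (simp add: power_add)
    also have "\<dots> \<le> (2 :: real) ^ (39 * L)" using L by (intro power_increasing) auto
    finally have T2: "real T + 2 \<le> 2 ^ (39 * L)" .
    then have T3: "real T \<le> 2 ^ (39 * L)" by linarith
    have "2 powr (- (D / 2)) = 2 powr (- real (101 * L))" by (simp add: D)
    also have "\<dots> = (1 / 2) ^ (101 * L)"
      by (simp add: powr_minus powr_realpow power_one_over inverse_eq_divide del: of_nat_mult)
    finally have p: "2 powr (- (D / 2)) = (1 / 2) ^ (101 * L)" .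
    have "real T * ((real \<Delta> + 1) * \<eta> T) \<le> 2 ^ (39 * L) * (2 ^ L * (2 ^ (39 * L) * (1 / 2) ^ (101 * L)))"
      unfolding \<eta>_def p using T2 T3 L by (intro mult_mono mult_right_mono mult_nonneg_nonneg) auto
    also have "\<dots> = 2 ^ (39 * L + L + 39 * L) * (1 / 2) ^ (101 * L)"
      by (simp only: power_add mult.assoc)
    also have "39 * L + L + 39 * L = 79 * L" by simp
    also have "101 * L = 79 * L + 22 * L" by simp
    also have "2 ^ (79 * L) * (1 / 2) ^ (79 * L + 22 * L) = ?h" by (rule halve)
    finally show ?thesis .
  qed
  have "(real \<Delta> + 1) ^ 10 * \<epsilon> T \<le> (2 ^ L) ^ 10 * (?h + ?h)"
    unfolding \<epsilon>_def using L \<epsilon>_nonneg[of T, unfolded \<epsilon>_def] by (intro mult_mono add_mono power_mono F1 F2) auto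
  also have "\<dots> = 2 * (2 ^ (10 * L) * (1 / 2) ^ (10 * L + 12 * L))"
    by (simp add: mult.commute[of L] flip: power_mult)
  also have "\<dots> = 2 * (1 / 2) ^ (12 * L)" unfolding halve ..
  also have "\<dots> \<le> 2 * (1 / 2) ^ 12"
    using L by (intro mult_left_mono power_decreasing) auto
  finally show ?thesis by (simp add: power_one_over)
qed

definition is_mis :: "nat \<Rightarrow> (nat \<Rightarrow> nat set) \<Rightarrow> nat set \<Rightarrow> bool" where
  "is_mis n nb I \<longleftrightarrow> (\<forall>u\<in>I. \<forall>v\<in>I. v \<notin> nb u) \<and> (\<forall>u. u < n \<and> u \<notin> I \<longrightarrow> (\<exists>v\<in>I. v \<in> nb u))"

text \<open>Rounds and bits per coin are both taken for the largest admissible degree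
  \<open>max 1 n\<close>, so that \<Delta> disappears.\<close>

definition num_bits :: "nat \<Rightarrow> nat" where
  "num_bits n = (c\<^sub>1 * size_log (max 1 n)) * (n * ((1 + c\<^sub>1) * size_log (max 1 n)))"

definition query_bound :: "nat \<Rightarrow> nat \<Rightarrow> real" where
  "query_bound n \<Delta> = (let L = size_log \<Delta>; T = c\<^sub>1 * L; P = 2 * (real T + 1)\<^sup>2 in
     4 * real (Suc (size_log n) * (\<Delta> + 1) ^ 4) ^ 2 * (real \<Delta> + 1) ^ 2 *
     (1 + real T * (P * (8 + 128 * real (202 * L) * P) ^ T)))"

text \<open>For fixed \<open>n\<close> and \<Delta>, one family of trees serves all graphs. It is
  built for the class of all oracles with degrees at most \<Delta>, where the query bound holds for
  every string \<open>r\<close>.\<close>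

lemma mis_lca:
  assumes \<Delta>: "1 \<le> \<Delta>" "\<Delta> \<le> max 1 n"
  shows "\<exists>A. \<forall>nb. graph_nb nb n \<Delta> \<longrightarrow>
    (\<forall>r v. real (num_queries nb (A r v)) \<le> query_bound n \<Delta>) \<and>
    1 - 1 / real n ^ 10 \<le> Ev (random_bits (num_bits n)) (\<lambda>r. of_bool (is_mis n nb {v. v < n \<and> answer nb (A r v)}))"
proof -
  define L where "L = size_log \<Delta>"
  define T where "T = c\<^sub>1 * L"
  define D where "D = 202 * L"
  define P where "P = 2 * (real T + 1)\<^sup>2"
  define J where "J = real T * (P * (8 + 128 * real D * P) ^ T)"
  define k where "k = Suc (size_log n)"
  define M where "M = k * (\<Delta> + 1) ^ 4"
  define m where "m = (1 + c\<^sub>1) * size_log (max 1 n)"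
  have L1: "1 \<le> L" unfolding L_def by (rule size_log_pos[OF \<Delta>(1)])
  have L2: "real \<Delta> + 1 \<le> 2 ^ L" unfolding L_def by (rule size_log_ge)
  have Ln: "L \<le> size_log (max 1 n)" unfolding L_def by (rule size_log_mono[OF \<Delta>(2)])
  have qb: "query_bound n \<Delta> = 4 * real M ^ 2 * (real \<Delta> + 1) ^ 2 * (1 + J)"
    unfolding query_bound_def Let_def J_def P_def T_def D_def L_def M_def k_def ..
  have P0: "0 \<le> P" by (simp add: P_def)
  have J0: "0 \<le> J" unfolding J_def using P0 by (intro mult_nonneg_nonneg zero_le_power) auto
  have "0 < M" by (simp add: M_def k_def)
  then have M1: "1 \<le> M" by simp
  define \<O> where "\<O> = {nb :: nat \<Rightarrow> nat set. \<forall>v. finite (nb v) \<and> card (nb v) \<le> \<Delta>}"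
  interpret bp: bounded_process D L \<O> .
  have "bp.queries_le (bp.mis_answer (decode n m T r) T M v) (4 * real M ^ 2 * (real \<Delta> + 1) ^ 2 * (1 + J))" for r v
  proof (rule bp.queries_le_mis_answer[OF _ _ _ J0 M1])
    show "bp.queries_le (\<lambda>nb. bp.st nb (decode n m T r) T v) J" for v
      unfolding J_def by (rule bp.queries_le_st) (auto simp: \<O>_def P_def)
  qed (auto simp: \<O>_def)
  then have "\<forall>r v. \<exists>t. \<forall>nb\<in>\<O>. run nb t = bp.mis_answer (decode n m T r) T M v nb \<and> real (cost nb t) \<le> query_bound n \<Delta>"
    unfolding qb bp.queries_le_def by blast
  then obtain tr where tr: "\<And>r v nb. nb \<in> \<O> \<Longrightarrow>
      run nb (tr r v) = bp.mis_answer (decode n m T r) T M v nb \<and> real (cost nb (tr r v)) \<le> query_bound n \<Delta>"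
    by metis
  show ?thesis
  proof (intro exI[of _ "\<lambda>r v. to_procedure (tr r v)"] allI impI)
    fix nb :: "nat \<Rightarrow> nat set"
    assume g: "graph_nb nb n \<Delta>"
    then interpret gn: graph_nb nb n \<Delta> .
    have nbO: "nb \<in> \<O>" using gn.finite_nb gn.nb_card by (simp add: \<O>_def)
    interpret mg: mis_graph D L nb n \<Delta> m
    proof unfold_locales
      have "real \<Delta> \<le> real (2 ^ L)" using L2 unfolding of_nat_power of_nat_numeral by linarith
      then show "\<Delta> \<le> 2 ^ L" by (simp only: of_nat_le_iff)
    qed (use L1 in \<open>auto simp: D_def\<close>)
    let ?A = "\<lambda>r v. to_procedure (tr r v)"
    let ?I = "\<lambda>r. {v. v < n \<and> answer nb (?A r v)}"
    have Tm: "L + T \<le> m"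
    proof -
      have "L + T = (1 + c\<^sub>1) * L" by (simp add: T_def)
      also have "\<dots> \<le> m" unfolding m_def by (rule mult_left_mono[OF Ln]) simp
      finally show ?thesis .
    qed
    have bits: "T * (n * m) \<le> num_bits n"
      unfolding num_bits_def m_def T_def using Ln by (intro mult_right_mono mult_left_mono) auto
    let ?big = "\<lambda>w. \<exists>v\<in>mg.live w T. k * (\<Delta> + 1) ^ 4 < card (component nb (mg.live w T) v)"
    have mis: "is_mis n nb (?I r)" if "\<not> ?big (decode n m T r)" for r
    proof -
      let ?w = "decode n m T r"
      have small: "card (component nb (mg.live ?w T) v) \<le> M" if "v \<in> mg.live ?w T" for v
        using that \<open>\<not> ?big ?w\<close> unfolding M_def by (meson not_le)
      have I: "?I r = {v. v < n \<and> bp.mis_answer ?w T M v nb}"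
        using tr[OF nbO] by (simp add: answer_to_procedure)
      show ?thesis
        unfolding is_mis_def I using mg.mis_answer_correct[OF small] by blast
    qed
    have pr: "Ev (mg.coin_pmf T) (\<lambda>w. of_bool (?big w)) \<le> 1 / real n ^ 10"
    proof -
      have "Ev (mg.coin_pmf T) (\<lambda>w. of_bool (?big w)) \<le> n * ((real \<Delta> + 1) ^ 10 * mg.\<epsilon> T) ^ k"
        by (rule mg.large_component_prob[OF Tm]) (simp add: k_def)
      also have "\<dots> \<le> n * (1 / 2 ^ 11) ^ k"
        using mg.\<epsilon>_bound[OF L1 L2 refl D_def T_def] mg.\<epsilon>_nonneg[of T]
        by (intro mult_left_mono power_mono) auto
      \<comment> \<open>As \<open>n \<le> 2 ^ k\<close>, the factor \<open>2 ^ - 11\<close> per node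
        of the walk beats the \<open>n\<close> starting points and leaves \<open>n ^ - 10\<close>.
        For \<open>n = 0\<close> both sides are 0, since division by zero gives 0.\<close>
      also have "\<dots> \<le> 1 / real n ^ 10"
      proof (cases "n = 0")
        case False
        then have n0: "0 < real n" by simp
        have "real n \<le> 2 ^ size_log n" by (rule order_trans[OF _ size_log_ge]) simp
        also have "\<dots> \<le> 2 ^ k" by (rule power_increasing) (auto simp: k_def)
        finally have "real n ^ 11 \<le> (2 ^ k) ^ 11" by (rule power_mono) simp
        then have "real n ^ 11 \<le> (2 ^ 11) ^ k" by (simp only: power_mult[symmetric] mult.commute)
        then have "1 / (2 ^ 11) ^ k \<le> 1 / real n ^ 11"
          using n0 by (intro divide_left_mono) auto
        then have "real n * (1 / (2 ^ 11) ^ k) \<le> real n * (1 / real n ^ 11)"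
          using n0 by (intro mult_left_mono) auto
        also have "\<dots> = 1 / real n ^ 10" using n0 by (simp add: eval_nat_numeral)
        finally show ?thesis by (simp only: power_one_over)
      qed simp
      finally show ?thesis .
    qed
    show "(\<forall>r v. real (num_queries nb (?A r v)) \<le> query_bound n \<Delta>) \<and>
      1 - 1 / real n ^ 10 \<le> Ev (random_bits (num_bits n)) (\<lambda>r. of_bool (is_mis n nb (?I r)))"
    proof
      show "\<forall>r v. real (num_queries nb (?A r v)) \<le> query_bound n \<Delta>"
        using tr[OF nbO] by (simp add: num_queries_to_procedure)
      have "1 - 1 / real n ^ 10 \<le> 1 + - 1 * Ev (mg.coin_pmf T) (\<lambda>w. of_bool (?big w))"
        using pr by simp
      also have "\<dots> = 1 + - 1 * Ev (random_bits (num_bits n)) (\<lambda>r. of_bool (?big (decode n m T r)))"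
        unfolding mg.coin_pmf_decode[OF bits, symmetric] Ev_map ..
      also have "\<dots> = Ev (random_bits (num_bits n)) (\<lambda>r. 1 + - 1 * of_bool (?big (decode n m T r)))"
        by (simp only: Ev_add[OF finite_random_bits] Ev_cmult Ev_const)
      also have "\<dots> \<le> Ev (random_bits (num_bits n)) (\<lambda>r. of_bool (is_mis n nb (?I r)))"
      proof (rule Ev_mono[OF finite_random_bits])
        fix r
        show "1 + - 1 * of_bool (?big (decode n m T r)) \<le> (of_bool (is_mis n nb (?I r)) :: real)"
        proof (cases "?big (decode n m T r)")
          case True
          then have "(of_bool (?big (decode n m T r)) :: real) = 1" by (simp only: of_bool_eq)
          then show ?thesis by simp
        next
          case False
          then show ?thesis using mis[OF False] by simp
        qed
      qed
      finally show "1 - 1 / real n ^ 10 \<le> Ev (random_bits (num_bits n)) (\<lambda>r. of_bool (is_mis n nb (?I r)))" .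
    qed
  qed
qed

section \<open>The bound as a power of \<Delta> times a polynomial in log n\<close>

definition C\<^sub>1 :: nat where "C\<^sub>1 = 8 + 206848 * c\<^sub>1\<^sup>2"
definition C\<^sub>2 :: nat where "C\<^sub>2 = 14 + 3 * c\<^sub>1"

text \<open>Everything but the factor in \<open>n\<close> is absorbed into a power of
  \<open>Z = C\<^sub>1 * L\<close>. Here \<open>206848 = 128 * 202 * 8\<close> comes from
  \<open>X \<le> C\<^sub>1 * L ^ 3\<close>, and the exponent \<open>10 * L + 4 + 3 * T\<close> is at
  most \<open>C\<^sub>2 * L\<close>.\<close>

lemma query_bound_le:
  assumes "1 \<le> \<Delta>"
  shows "query_bound n \<Delta> \<le> 4 * real (Suc (size_log n)) ^ 2 * real (C\<^sub>1 * size_log \<Delta>) ^ (C\<^sub>2 * size_log \<Delta>)"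
proof -
  define L where "L = size_log \<Delta>"
  define T where "T = c\<^sub>1 * L"
  define P where "P = 2 * (real T + 1)\<^sup>2"
  define X where "X = 8 + 128 * real (202 * L) * P"
  define Z where "Z = real (C\<^sub>1 * L)"
  have L1: "1 \<le> real L" unfolding L_def using size_log_pos[OF assms] by simp
  have c1: "1 \<le> real c\<^sub>1" by (simp add: c\<^sub>1_def)
  have C: "real C\<^sub>1 = 8 + 206848 * real c\<^sub>1 ^ 2" by (simp add: C\<^sub>1_def)
  have cc: "real c\<^sub>1 \<le> real c\<^sub>1 ^ 2" using mult_left_mono[OF c1, of "real c\<^sub>1"] by (simp add: power2_eq_square)
  have c_le: "8 * real c\<^sub>1 ^ 2 \<le> real C\<^sub>1" "real c\<^sub>1 \<le> real C\<^sub>1" "2 \<le> real C\<^sub>1"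
    using cc zero_le_power2[of "real c\<^sub>1"] unfolding C by linarith+
  have LL: "real L \<le> real L ^ 2" "real L ^ 2 \<le> real L ^ 3" "1 \<le> real L ^ 3"
    using L1 by (auto intro: power_increasing[of 1 2 "real L", simplified] power_increasing[of 2 3] one_le_power)
  have Z1: "2 \<le> Z"
    unfolding Z_def of_nat_mult using mult_mono[OF c_le(3) L1] by simp
  have TZ: "real T \<le> Z" unfolding Z_def T_def of_nat_mult using c_le by (intro mult_right_mono) auto
  have "1 \<le> real c\<^sub>1 * real L" using mult_mono[OF c1 L1] by simp
  then have "real T + 1 \<le> 2 * (real c\<^sub>1 * real L)"
    unfolding T_def of_nat_mult by linarith
  then have "(real T + 1) ^ 2 \<le> (2 * (real c\<^sub>1 * real L)) ^ 2"
    by (rule power_mono) simp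
  then have P_le: "P \<le> 8 * real c\<^sub>1 ^ 2 * real L ^ 2"
    by (simp add: P_def power_mult_distrib mult_ac)
  also have "\<dots> \<le> real C\<^sub>1 * real L ^ 2" using c_le by (intro mult_right_mono) auto
  also have "\<dots> \<le> real C\<^sub>1 ^ 2 * real L ^ 2"
    using mult_right_mono[of 1 "real C\<^sub>1" "real C\<^sub>1"] c_le by (intro mult_right_mono) (auto simp: power2_eq_square)
  finally have PZ: "P \<le> Z ^ 2" by (simp add: Z_def power_mult_distrib)
  have P0: "0 \<le> P" by (simp add: P_def)
  have "X \<le> 8 * real L ^ 3 + 128 * (202 * real L) * (8 * real c\<^sub>1 ^ 2 * real L ^ 2)"
  proof -
    have a: "8 \<le> 8 * real L ^ 3" using LL(3) by simp
    have b: "128 * (202 * real L) * P \<le> 128 * (202 * real L) * (8 * real c\<^sub>1 ^ 2 * real L ^ 2)"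
      by (rule mult_left_mono[OF P_le]) simp
    show ?thesis unfolding X_def of_nat_mult of_nat_numeral by (rule add_mono[OF a b])
  qed
  also have "\<dots> = real C\<^sub>1 * real L ^ 3" by (simp add: C power2_eq_square power3_eq_cube algebra_simps)
  also have "\<dots> \<le> real C\<^sub>1 ^ 3 * real L ^ 3"
    using power_increasing[of 1 3 "real C\<^sub>1"] c_le by (intro mult_right_mono) auto
  finally have XZ: "X \<le> Z ^ 3" by (simp add: Z_def power_mult_distrib)
  have X0: "0 \<le> X" using P0 by (simp add: X_def)
  have "real T * (P * X ^ T) \<le> Z * (Z ^ 2 * (Z ^ 3) ^ T)"
    using TZ PZ XZ X0 P0 Z1 by (intro mult_mono power_mono mult_nonneg_nonneg zero_le_power) auto
  also have "\<dots> = Z ^ (1 + (2 + 3 * T))" by (simp only: power_add power_mult power_one_right)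
  also have "1 + (2 + 3 * T) = 3 + 3 * T" by simp
  finally have J: "real T * (P * X ^ T) \<le> Z ^ (3 + 3 * T)" .
  have "1 \<le> Z ^ (3 + 3 * T)" using Z1 by (intro one_le_power) auto
  then have "1 + real T * (P * X ^ T) \<le> 2 * Z ^ (3 + 3 * T)" using J by simp
  also have "\<dots> \<le> Z * Z ^ (3 + 3 * T)" using Z1 by (intro mult_right_mono) auto
  also have "\<dots> = Z ^ Suc (3 + 3 * T)" by (rule power_Suc[symmetric])
  also have "Suc (3 + 3 * T) = 4 + 3 * T" by simp
  finally have J': "1 + real T * (P * X ^ T) \<le> Z ^ (4 + 3 * T)" .
  have "real \<Delta> + 1 \<le> 2 ^ L" unfolding L_def by (rule size_log_ge)
  also have "\<dots> \<le> Z ^ L" using Z1 by (intro power_mono) auto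
  finally have "(real \<Delta> + 1) ^ 10 \<le> (Z ^ L) ^ 10" by (intro power_mono) auto
  then have DZ: "(real \<Delta> + 1) ^ 10 \<le> Z ^ (10 * L)" by (simp add: mult.commute flip: power_mult)
  have "query_bound n \<Delta> = 4 * real (Suc (size_log n)) ^ 2 * ((real \<Delta> + 1) ^ 10 * (1 + real T * (P * X ^ T)))"
  proof -
    have "real (Suc (size_log n) * (\<Delta> + 1) ^ 4) ^ 2 * (real \<Delta> + 1) ^ 2 =
      real (Suc (size_log n)) ^ 2 * (real \<Delta> + 1) ^ 10"
    proof -
      have "real (Suc (size_log n) * (\<Delta> + 1) ^ 4) = real (Suc (size_log n)) * (real \<Delta> + 1) ^ 4"
        by (simp only: of_nat_mult of_nat_power of_nat_add of_nat_1)
      moreover have "(a * b ^ 4) ^ 2 * b ^ 2 = a ^ 2 * b ^ 10" for a b :: real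
        by (simp add: power_mult_distrib mult.assoc flip: power_mult power_add)
      ultimately show ?thesis by (simp only:)
    qed
    then show ?thesis
      unfolding query_bound_def Let_def X_def P_def T_def L_def by (simp only: mult.assoc)
  qed
  also have "\<dots> \<le> 4 * real (Suc (size_log n)) ^ 2 * (Z ^ (10 * L) * Z ^ (4 + 3 * T))"
    using P0 X0 Z1 by (intro mult_left_mono mult_mono DZ J') auto
  also have "Z ^ (10 * L) * Z ^ (4 + 3 * T) = Z ^ (10 * L + (4 + 3 * T))" by (simp only: power_add)
  also have "\<dots> \<le> Z ^ (C\<^sub>2 * L)"
  proof (rule power_increasing)
    have "4 \<le> 4 * L" using L1 by simp
    then show "10 * L + (4 + 3 * T) \<le> C\<^sub>2 * L" by (simp add: C\<^sub>2_def T_def algebra_simps)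
  qed (use Z1 in simp)
  finally show ?thesis unfolding Z_def L_def by (simp add: mult_left_mono)
qed

definition lca_exponent :: "nat \<Rightarrow> real" where
  "lca_exponent \<Delta> = real (C\<^sub>2 * size_log \<Delta>) * ln (real (C\<^sub>1 * size_log \<Delta>)) / ln (real \<Delta>)"

text \<open>The factor \<open>size_log \<Delta>\<close> cancels against \<open>ln \<Delta>\<close>
  up to a constant, leaving the logarithm of \<open>size_log \<Delta>\<close>.\<close>

lemma lca_exponent_bigo: "lca_exponent \<in> O(\<lambda>\<Delta>. ln (ln (real \<Delta>)))"
proof -
  have C1: "1 \<le> real C\<^sub>1" and C2: "0 < real C\<^sub>2" by (simp_all add: C\<^sub>1_def C\<^sub>2_def)
  define a b where "a = real C\<^sub>1" and "b = real C\<^sub>2"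
  have ab: "0 < a" "0 < b" using C1 C2 by (simp_all add: a_def b_def)
  have "lca_exponent \<in> O(\<lambda>\<Delta>. (b * (2 + 2 * ln (real \<Delta>))) * ln (a * (2 + 2 * ln (real \<Delta>))) / ln (real \<Delta>))"
  proof (rule landau_o.big_mono, rule eventually_sequentiallyI[of 2])
    fix \<Delta> :: nat assume d: "2 \<le> \<Delta>"
    have s1: "1 \<le> real (size_log \<Delta>)" using size_log_pos[of \<Delta>] d by simp
    have s2: "real (size_log \<Delta>) \<le> 2 + 2 * ln (real \<Delta>)" using size_log_le[of \<Delta>] d by simp
    have ln0: "0 < ln (real \<Delta>)" using d by simp
    have p: "1 \<le> real (C\<^sub>1 * size_log \<Delta>)" using mult_mono[OF C1 s1] by simp
    have l0: "0 \<le> ln (real (C\<^sub>1 * size_log \<Delta>))" using p by (rule ln_ge_zero)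
    have l1: "ln (real (C\<^sub>1 * size_log \<Delta>)) \<le> ln (a * (2 + 2 * ln (real \<Delta>)))"
      using p s2 C1 by (subst ln_le_cancel_iff) (auto simp: a_def intro!: mult_pos_pos mult_left_mono add_pos_pos ln0)
    have "real (C\<^sub>2 * size_log \<Delta>) * ln (real (C\<^sub>1 * size_log \<Delta>)) \<le> (b * (2 + 2 * ln (real \<Delta>))) * ln (a * (2 + 2 * ln (real \<Delta>)))"
      unfolding of_nat_mult[of C\<^sub>2] b_def[symmetric] using s1 s2 l0 l1 ab by (intro mult_mono mult_left_mono) auto
    then have "lca_exponent \<Delta> \<le> (b * (2 + 2 * ln (real \<Delta>))) * ln (a * (2 + 2 * ln (real \<Delta>))) / ln (real \<Delta>)"
      unfolding lca_exponent_def using ln0 by (intro divide_right_mono) auto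
    moreover have "0 \<le> lca_exponent \<Delta>" unfolding lca_exponent_def using l0 ln0 by simp
    ultimately show "norm (lca_exponent \<Delta>) \<le> norm ((b * (2 + 2 * ln (real \<Delta>))) * ln (a * (2 + 2 * ln (real \<Delta>))) / ln (real \<Delta>))"
      unfolding real_norm_def by linarith
  qed
  also have "(\<lambda>\<Delta>. (b * (2 + 2 * ln (real \<Delta>))) * ln (a * (2 + 2 * ln (real \<Delta>))) / ln (real \<Delta>)) \<in> O(\<lambda>\<Delta>. ln (ln (real \<Delta>)))"
    using ab by real_asymp
  finally show ?thesis .
qed

text \<open>\<open>\<Delta>\<close> is the degree after capping, \<open>\<Delta>'\<close> the given
  one. For \<open>\<Delta>' = 1\<close> the power is just 1, whatever the exponent; the constant
  \<open>(C\<^sub>1 * size_log 1) ^ (C\<^sub>2 * size_log 1)\<close> covers this case.\<close>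

lemma query_bound_powr:
  assumes "1 \<le> \<Delta>" "\<Delta> \<le> \<Delta>'" "1 \<le> n"
  shows "query_bound n \<Delta> \<le> real \<Delta>' powr lca_exponent \<Delta>' *
    (4 * real (C\<^sub>1 * size_log 1) ^ (C\<^sub>2 * size_log 1) * (3 + 2 * ln (real n)) ^ 2)"
proof -
  let ?Y = "\<lambda>\<Delta>. real (C\<^sub>1 * size_log \<Delta>) ^ (C\<^sub>2 * size_log \<Delta>)"
  have C1: "1 \<le> C\<^sub>1" by (simp add: C\<^sub>1_def)
  have Y1: "1 \<le> ?Y d" if "1 \<le> d" for d
  proof (rule one_le_power)
    have "1 * 1 \<le> C\<^sub>1 * size_log d" using C1 size_log_pos[OF that] by (rule mult_le_mono)
    then show "1 \<le> real (C\<^sub>1 * size_log d)" by (metis mult_1 of_nat_1 of_nat_mono)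
  qed
  have YY: "?Y \<Delta> \<le> real \<Delta>' powr lca_exponent \<Delta>' * ?Y 1"
  proof (cases "\<Delta>' = 1")
    case True
    then have "\<Delta> = 1" using assms by simp
    then show ?thesis using True by simp
  next
    case False
    then have d: "2 \<le> \<Delta>'" using assms by simp
    have s: "size_log \<Delta> \<le> size_log \<Delta>'" by (rule size_log_mono[OF assms(2)])
    have s1: "1 \<le> size_log \<Delta>'" using size_log_pos d by simp
    have pos: "1 \<le> real (C\<^sub>1 * size_log \<Delta>')"
    proof -
      have "1 * 1 \<le> C\<^sub>1 * size_log \<Delta>'" using C1 s1 by (rule mult_le_mono)
      then show ?thesis by (metis mult_1 of_nat_1 of_nat_mono)
    qed
    have "?Y \<Delta> \<le> real (C\<^sub>1 * size_log \<Delta>') ^ (C\<^sub>2 * size_log \<Delta>)"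
      by (intro power_mono of_nat_mono mult_left_mono s) auto
    also have "\<dots> \<le> ?Y \<Delta>'" using s pos by (intro power_increasing) auto
    also have "\<dots> = exp (real (C\<^sub>2 * size_log \<Delta>') * ln (real (C\<^sub>1 * size_log \<Delta>')))"
      using pos by (simp add: exp_of_nat_mult del: of_nat_mult)
    also have "\<dots> = real \<Delta>' powr lca_exponent \<Delta>'"
      using d by (simp add: powr_def lca_exponent_def)
    finally have "?Y \<Delta> \<le> real \<Delta>' powr lca_exponent \<Delta>' * 1" by simp
    also have "\<dots> \<le> real \<Delta>' powr lca_exponent \<Delta>' * ?Y 1"
      by (intro mult_left_mono Y1) auto
    finally show ?thesis .
  qed
  have k: "real (Suc (size_log n)) \<le> 3 + 2 * ln (real n)" using size_log_le[OF assms(3)] by simp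
  have "query_bound n \<Delta> \<le> 4 * real (Suc (size_log n)) ^ 2 * ?Y \<Delta>" by (rule query_bound_le[OF assms(1)])
  also have "\<dots> \<le> 4 * (3 + 2 * ln (real n)) ^ 2 * (real \<Delta>' powr lca_exponent \<Delta>' * ?Y 1)"
    using k by (intro mult_mono mult_left_mono power_mono YY) auto
  finally show ?thesis by (simp only: mult_ac)
qed

lemma num_bits_le: "real (num_bits n) \<le> real n * (real (c\<^sub>1 * (1 + c\<^sub>1)) * (2 + 2 * ln (real n)) ^ 2)"
proof (cases "n = 0")
  case False
  then have n: "1 \<le> n" by simp
  have "num_bits n = n * (c\<^sub>1 * (1 + c\<^sub>1) * size_log n ^ 2)"
    unfolding num_bits_def max_absorb2[OF n] by (simp only: power2_eq_square mult_ac)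
  then have "real (num_bits n) = real n * (real (c\<^sub>1 * (1 + c\<^sub>1)) * real (size_log n) ^ 2)"
    by (simp only: of_nat_mult of_nat_power)
  also have "\<dots> \<le> real n * (real (c\<^sub>1 * (1 + c\<^sub>1)) * (2 + 2 * ln (real n)) ^ 2)"
    using size_log_le[OF n] by (intro mult_left_mono power_mono) auto
  finally show ?thesis .
qed (simp add: num_bits_def)

section \<open>From oracles to graphs of bounded degree\<close>

lemma neighbors_graph_nb:
  assumes "bounded_degree_graph n \<Delta> G"
  shows "graph_nb (neighbors G) n (max 1 (min \<Delta> n))" and "pverts G = {..<n}"
    and "\<And>v. card (neighbors G v) \<le> \<Delta>" and "\<And>v. finite (neighbors G v)"
proof -
  have G: "pair_graph G" and V: "pverts G = {..<n}"
    and deg: "\<And>v. v \<in> pverts G \<Longrightarrow> out_degree (with_proj G) v \<le> \<Delta>"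
    using assms by (auto simp: bounded_degree_graph_def)
  interpret pair_graph G by (rule G)
  show "pverts G = {..<n}" by (rule V)
  have sub: "neighbors G v \<subseteq> {..<n}" for v
    using in_arcsD2 V by (auto simp: neighbors_def)
  then show fin: "finite (neighbors G v)" for v using finite_subset by blast
  have card_n: "card (neighbors G v) \<le> n" for v
    using card_mono[OF finite_lessThan sub, of v] by simp
  show card: "card (neighbors G v) \<le> \<Delta>" for v
  proof (cases "v \<in> pverts G")
    case True
    have "out_arcs (with_proj G) v = Pair v ` neighbors G v"
      by (auto simp: out_arcs_def neighbors_def)
    then have "card (neighbors G v) = out_degree (with_proj G) v"
      by (simp add: out_degree_def card_image inj_on_def)
    then show ?thesis using deg[OF True] by simp
  next
    case False
    then have "neighbors G v = {}" using in_arcsD1 by (auto simp: neighbors_def)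
    then show ?thesis by simp
  qed
  \<comment> \<open>Capping the degree by \<open>n\<close> keeps the number of random bits a
    function of \<open>n\<close>; the floor 1 makes \<open>size_log\<close> positive.\<close>
  show "graph_nb (neighbors G) n (max 1 (min \<Delta> n))"
  proof
    show "neighbors G v \<subseteq> {..<n}" for v by (rule sub)
    show "v \<in> neighbors G u" if "u \<in> neighbors G v" for u v
      using that arcs_symmetric by (auto simp: neighbors_def)
    show "v \<notin> neighbors G v" for v
      using pair_no_loops by (force simp: neighbors_def)
    show "card (neighbors G v) \<le> max 1 (min \<Delta> n)" for v
      using card[of v] card_n[of v] by simp
  qed
qed

lemma is_mis_maximal:
  assumes "is_mis n (neighbors G) I" "I \<subseteq> {..<n}" "pverts G = {..<n}"
  shows "maximal_independent_set G I"
  unfolding maximal_independent_set_def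
proof (intro conjI allI impI)
  show "independent_set G I"
    using assms by (auto simp: independent_set_def is_mis_def neighbors_def)
  fix J assume J: "independent_set G J \<and> I \<subseteq> J"
  show "J = I"
  proof (rule ccontr)
    assume "J \<noteq> I"
    then obtain x where x: "x \<in> J" "x \<notin> I" using J by blast
    then have "x < n" using J assms(3) by (auto simp: independent_set_def)
    then obtain v where "v \<in> I" "(x, v) \<in> parcs G"
      using assms(1) x by (auto simp: is_mis_def neighbors_def)
    then show False using J x by (auto simp: independent_set_def)
  qed
qed

theorem theorem1p2:
  shows "\<exists>(A :: lca) (len :: nat \<Rightarrow> nat) (e :: nat \<Rightarrow> real) (p :: real poly) (q :: real poly).
    (\<forall>n. real (len n) \<le> real n * poly p (ln (real n))) \<and>
    e \<in> O(\<lambda>\<Delta>. ln (ln (real \<Delta>))) \<and>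
    (\<forall>n \<Delta> G. bounded_degree_graph n \<Delta> G \<longrightarrow>
       measure_pmf.prob (random_bits (len n)) {r. maximal_independent_set G (lca_output A n \<Delta> G r)}
         \<ge> 1 - 1 / real n ^ 10 \<and>
       (\<forall>r v. length r = len n \<and> v \<in> pverts G \<longrightarrow>
          real (num_queries (neighbors G) (A n \<Delta> r v)) \<le> real \<Delta> powr e \<Delta> * poly q (ln (real n))))"
proof -
  let ?ok = "\<lambda>n \<Delta> A. \<forall>nb. graph_nb nb n \<Delta> \<longrightarrow>
    (\<forall>r v. real (num_queries nb (A r v)) \<le> query_bound n \<Delta>) \<and>
    1 - 1 / real n ^ 10 \<le> Ev (random_bits (num_bits n)) (\<lambda>r. of_bool (is_mis n nb {v. v < n \<and> answer nb (A r v)}))"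
  \<comment> \<open>Existence is known for each \<open>n\<close> and \<Delta> separately; choice
    turns this into a single function.\<close>
  define B where "B n \<Delta> = (SOME A. ?ok n \<Delta> A)" for n \<Delta>
  have B: "?ok n \<Delta> (B n \<Delta>)" if "1 \<le> \<Delta>" "\<Delta> \<le> max 1 n" for n \<Delta>
    unfolding B_def by (rule someI_ex[OF mis_lca[OF that]])
  \<comment> \<open>For \<Delta> = 0 the query bound is 0, because \<open>0 powr e\<close> is 0.
    Every node answers yes without a query, which is right in an edgeless graph.\<close>
  define A :: lca where "A n \<Delta> r v = (if \<Delta> = 0 then Answer True else B n (max 1 (min \<Delta> n)) r v)" for n \<Delta> r v
  define p :: "real poly" where "p = smult (real (c\<^sub>1 * (1 + c\<^sub>1))) ([:2, 2:] ^ 2)"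
  define q :: "real poly" where "q = smult (4 * real (C\<^sub>1 * size_log 1) ^ (C\<^sub>2 * size_log 1)) ([:3, 2:] ^ 2)"
  have "maximal_independent_set G (lca_output A n \<Delta> G r)"
    if "is_mis n (neighbors G) {v. v < n \<and> answer (neighbors G) (A n \<Delta> r v)}" "pverts G = {..<n}" for n \<Delta> G r
  proof -
    have "lca_output A n \<Delta> G r = {v. v < n \<and> answer (neighbors G) (A n \<Delta> r v)}"
      using that(2) by (auto simp: lca_output_def)
    then show ?thesis using is_mis_maximal[OF that(1) _ that(2)] by auto
  qed
  note mis = this
  show ?thesis
  proof (rule exI[of _ A], rule exI[of _ num_bits], rule exI[of _ lca_exponent], rule exI[of _ p], rule exI[of _ q],
      intro conjI allI impI)
    show "real (num_bits n) \<le> real n * poly p (ln (real n))" for n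
      using num_bits_le[of n] by (simp add: p_def poly_power mult_ac)
    show "lca_exponent \<in> O(\<lambda>\<Delta>. ln (ln (real \<Delta>)))" by (rule lca_exponent_bigo)
    fix n \<Delta> G assume G: "bounded_degree_graph n \<Delta> G"
    note nb = neighbors_graph_nb[OF G]
    show "1 - 1 / real n ^ 10 \<le> measure_pmf.prob (random_bits (num_bits n)) {r. maximal_independent_set G (lca_output A n \<Delta> G r)}"
    proof (cases "\<Delta> = 0")
      case True
      then have "neighbors G v = {}" for v using nb(3,4)[of v] by simp
      then have "is_mis n (neighbors G) {v. v < n \<and> answer (neighbors G) (A n \<Delta> r v)}" for r
        using True by (simp add: is_mis_def A_def)
      then have "{r. maximal_independent_set G (lca_output A n \<Delta> G r)} = UNIV"
        using mis[OF _ nb(2)] by blast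
      then show ?thesis by simp
    next
      case False
      let ?\<Delta> = "max 1 (min \<Delta> n)"
      have "1 - 1 / real n ^ 10 \<le> Ev (random_bits (num_bits n)) (\<lambda>r. of_bool (is_mis n (neighbors G) {v. v < n \<and> answer (neighbors G) (A n \<Delta> r v)}))"
        using B[of ?\<Delta> n] nb(1) False by (simp add: A_def)
      also have "\<dots> \<le> Ev (random_bits (num_bits n)) (\<lambda>r. of_bool (maximal_independent_set G (lca_output A n \<Delta> G r)))"
        using mis[OF _ nb(2)] by (intro Ev_mono) auto
      finally show ?thesis by (simp only: prob_eq_Ev)
    qed
    fix r :: "bool list" and v assume "length r = num_bits n \<and> v \<in> pverts G"
    then have n: "1 \<le> n" using nb(2) by auto
    show "real (num_queries (neighbors G) (A n \<Delta> r v)) \<le> real \<Delta> powr lca_exponent \<Delta> * poly q (ln (real n))"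
    proof (cases "\<Delta> = 0")
      case False
      let ?\<Delta> = "max 1 (min \<Delta> n)"
      have "real (num_queries (neighbors G) (A n \<Delta> r v)) \<le> query_bound n ?\<Delta>"
        using B[of ?\<Delta> n] nb(1) False by (simp add: A_def)
      also have "\<dots> \<le> real \<Delta> powr lca_exponent \<Delta> *
        (4 * real (C\<^sub>1 * size_log 1) ^ (C\<^sub>2 * size_log 1) * (3 + 2 * ln (real n)) ^ 2)"
        by (rule query_bound_powr) (use False n in auto)
      also have "4 * real (C\<^sub>1 * size_log 1) ^ (C\<^sub>2 * size_log 1) * (3 + 2 * ln (real n)) ^ 2 = poly q (ln (real n))"
        by (simp add: q_def poly_power mult.commute[of "ln (real n)"])
      finally show ?thesis .
    qed (simp add: A_def)
  qed
qed

end
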